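(* Let $E \colon \mathfrak{C}^* \to \mathrm{Ab}$ be an $M_2$-stable functor from the category of $C^*$-algebras to the category of abelian groups. Let $\mathcal{O}$ be a properly infinite $C^*$-algebra, let $\mathcal{K} = \mathcal{K}(\ell^2(\mathbb{Z}_{\ge 0}))$ be the $C^*$-algebra of compact operators, with standard system of matrix units $(e_{j,k})_{j,k\ge 0}$, and let $j \colon \mathcal{O} \to \mathcal{O} \,\underline{\otimes}\, \mathcal{K}$ be the inclusion $j(a) = a \,\underline{\otimes}\, e_{0,0}$ for $a \in \mathcal{O}$. Then $E(j) \colon E(\mathcal{O}) \to E(\mathcal{O} \,\underline{\otimes}\, \mathcal{K})$ is an isomorphism.
   Context: $\mathfrak{C}^*$ is the category of (not necessarily unital) $C^*$-algebras and $*$-homomorphisms, $\mathrm{Ab}$ the category of abelian groups, and $\underline{\otimes}$ the spatial (minimal) $C^*$-tensor product. For a ring $A$, $\iota_A \colon A \to M_2(A)$ is the upper left corner inclusion $a \mapsto \mathrm{diag}(a,0)$. A functor $E \colon \mathfrak{C}^* \to \mathrm{Ab}$ is $M_2$-stable if $E(\iota_A)$ is an isomorphism for every $C^*$-algebra $A$. A properly infinite $C^*$-algebra is a unital $C^*$-algebra whose unit is a properly infinite projection, i.e. it contains two isometries with mutually orthogonal range projections (equivalently, an infinite sequence of isometries with pairwise orthogonal range projections). *)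

theory Defs
  imports "HOL-Analysis.Analysis" "HOL-Algebra.Group"
begin

section \<open>The Hilbert spaces of square-summable families\<close>

text \<open>Up to unitary equivalence every complex Hilbert space is of this form.\<close>

typedef 'i ell2 = "{f :: 'i \<Rightarrow> complex. (\<lambda>i. (cmod (f i))\<^sup>2) summable_on UNIV}"
  morphisms ell2_nth Abs_ell2
  by (rule exI[of _ "\<lambda>_. 0"]) simp

setup_lifting type_definition_ell2

lemma ell2_inner_summable:
  fixes f g :: "'i \<Rightarrow> complex"
  assumes "(\<lambda>i. (cmod (f i))\<^sup>2) summable_on UNIV" and "(\<lambda>i. (cmod (g i))\<^sup>2) summable_on UNIV"
  shows "(\<lambda>i. f i \<bullet> g i) summable_on UNIV"
proof -
  have "(\<lambda>i. norm (f i \<bullet> g i)) summable_on UNIV"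
  proof (rule summable_on_comparison_test)
    show "(\<lambda>i. (cmod (f i))\<^sup>2 + (cmod (g i))\<^sup>2) summable_on UNIV"
      using assms by (rule summable_on_add)
    show "norm (f i \<bullet> g i) \<le> (cmod (f i))\<^sup>2 + (cmod (g i))\<^sup>2" for i
    proof -
      have "norm (f i \<bullet> g i) \<le> cmod (f i) * cmod (g i)"
        unfolding real_norm_def by (rule Cauchy_Schwarz_ineq2)
      also have "\<dots> \<le> (cmod (f i))\<^sup>2 + (cmod (g i))\<^sup>2"
        using sum_squares_bound[of "cmod (f i)" "cmod (g i)"]
          mult_nonneg_nonneg[OF norm_ge_zero[of "f i"] norm_ge_zero[of "g i"]] by linarith
      finally show ?thesis .
    qed
  qed (rule norm_ge_zero)
  then show ?thesis by (rule abs_summable_summable)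
qed

instantiation ell2 :: (type) real_vector
begin

lift_definition zero_ell2 :: "'a ell2" is "\<lambda>_. 0" by simp

lift_definition plus_ell2 :: "'a ell2 \<Rightarrow> 'a ell2 \<Rightarrow> 'a ell2" is "\<lambda>f g i. f i + g i"
proof -
  fix f g :: "'a \<Rightarrow> complex"
  assume fg: "(\<lambda>i. (cmod (f i))\<^sup>2) summable_on UNIV" "(\<lambda>i. (cmod (g i))\<^sup>2) summable_on UNIV"
  have "(cmod (f i + g i))\<^sup>2 = (cmod (f i))\<^sup>2 + (cmod (g i))\<^sup>2 + 2 * (f i \<bullet> g i)" for i
    unfolding power2_norm_eq_inner inner_add_left inner_add_right
    using inner_commute[of "g i" "f i"] by linarith
  then show "(\<lambda>i. (cmod (f i + g i))\<^sup>2) summable_on UNIV"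
    using fg by (auto intro!: summable_on_add summable_on_cmult_right ell2_inner_summable)
qed

lift_definition uminus_ell2 :: "'a ell2 \<Rightarrow> 'a ell2" is "\<lambda>f i. - f i" by simp

definition minus_ell2 :: "'a ell2 \<Rightarrow> 'a ell2 \<Rightarrow> 'a ell2" where
  "f - g = f + - g" for f g :: "'a ell2"

lift_definition scaleR_ell2 :: "real \<Rightarrow> 'a ell2 \<Rightarrow> 'a ell2" is "\<lambda>r f i. r *\<^sub>R f i"
  by (simp add: power_mult_distrib summable_on_cmult_right)

instance
proof
  fix f g h :: "'a ell2" and r s :: real
  show "f + g + h = f + (g + h)" by transfer (simp add: add.assoc)
  show "f + g = g + f" by transfer (simp add: add.commute)
  show "0 + f = f" by transfer simp
  show "- f + f = 0" by transfer simp
  show "f - g = f + - g" by (rule minus_ell2_def)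
  show "r *\<^sub>R (f + g) = r *\<^sub>R f + r *\<^sub>R g" by transfer (simp add: scaleR_add_right)
  show "(r + s) *\<^sub>R f = r *\<^sub>R f + s *\<^sub>R f" by transfer (simp add: scaleR_add_left)
  show "r *\<^sub>R s *\<^sub>R f = (r * s) *\<^sub>R f" by transfer simp
  show "1 *\<^sub>R f = f" by transfer simp
qed

end

instantiation ell2 :: (type) real_inner
begin

lift_definition inner_ell2 :: "'a ell2 \<Rightarrow> 'a ell2 \<Rightarrow> real" is "\<lambda>f g. \<Sum>\<^sub>\<infinity>i. f i \<bullet> g i" .

definition norm_ell2 :: "'a ell2 \<Rightarrow> real" where "norm f = sqrt (f \<bullet> f)" for f :: "'a ell2"
definition sgn_ell2 :: "'a ell2 \<Rightarrow> 'a ell2" where "sgn f = f /\<^sub>R norm f" for f :: "'a ell2"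
definition dist_ell2 :: "'a ell2 \<Rightarrow> 'a ell2 \<Rightarrow> real" where
  "dist f g = norm (f - g)" for f g :: "'a ell2"
definition uniformity_ell2 :: "('a ell2 \<times> 'a ell2) filter" where
  "uniformity_ell2 = (INF e\<in>{0<..}. principal {(f, g). dist f g < e})"
definition open_ell2 :: "'a ell2 set \<Rightarrow> bool" where
  "open_ell2 U \<longleftrightarrow> (\<forall>f\<in>U. eventually (\<lambda>(f', g). f' = f \<longrightarrow> g \<in> U) uniformity)"

instance
proof
  fix f g h :: "'a ell2" and r :: real and U :: "'a ell2 set"
  show "sgn f = f /\<^sub>R norm f" by (rule sgn_ell2_def)
  show "dist f g = norm (f - g)" by (rule dist_ell2_def)
  show "uniformity = (INF e\<in>{0<..}. principal {(f :: 'a ell2, g). dist f g < e})"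
    by (rule uniformity_ell2_def)
  show "open U \<longleftrightarrow> (\<forall>f\<in>U. eventually (\<lambda>(f', g). f' = f \<longrightarrow> g \<in> U) uniformity)"
    by (rule open_ell2_def)
  show "f \<bullet> g = g \<bullet> f" by transfer (simp add: inner_commute)
  show "(f + g) \<bullet> h = f \<bullet> h + g \<bullet> h"
    by transfer (simp add: inner_add_left infsum_add ell2_inner_summable)
  show "(r *\<^sub>R f) \<bullet> g = r * (f \<bullet> g)" by transfer (simp add: infsum_cmult_right')
  show "0 \<le> f \<bullet> f" by transfer (simp add: infsum_nonneg)
  show "f \<bullet> f = 0 \<longleftrightarrow> f = 0"
  proof transfer
    fix f :: "'a \<Rightarrow> complex"
    assume f: "(\<lambda>i. (cmod (f i))\<^sup>2) summable_on UNIV"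
    have zero: "f i = 0" if "(\<Sum>\<^sub>\<infinity>i. f i \<bullet> f i) = 0" for i
    proof -
      have "f i \<bullet> f i = 0"
        by (rule nonneg_infsum_le_0D[of "\<lambda>i. f i \<bullet> f i" UNIV])
          (use that ell2_inner_summable[OF f f] in \<open>simp_all only: inner_ge_zero UNIV_I order_refl\<close>)
      then show ?thesis by (simp only: inner_eq_zero_iff)
    qed
    show "(\<Sum>\<^sub>\<infinity>i. f i \<bullet> f i) = 0 \<longleftrightarrow> f = (\<lambda>_. 0)"
    proof
      assume "(\<Sum>\<^sub>\<infinity>i. f i \<bullet> f i) = 0"
      then show "f = (\<lambda>_. 0)" using zero by blast
    next
      assume "f = (\<lambda>_. 0)"
      then show "(\<Sum>\<^sub>\<infinity>i. f i \<bullet> f i) = 0" by simp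
    qed
  qed
  show "norm f = sqrt (f \<bullet> f)" by (rule norm_ell2_def)
qed

end

lift_definition ell2_scaleC :: "complex \<Rightarrow> 'i ell2 \<Rightarrow> 'i ell2" is "\<lambda>c f i. c * f i"
  by (simp add: norm_mult power_mult_distrib summable_on_cmult_right)

text \<open>The complex inner product, antilinear in the first argument; the real inner product above is
  its real part.\<close>

definition ell2_cinner :: "'i ell2 \<Rightarrow> 'i ell2 \<Rightarrow> complex" where
  "ell2_cinner f g = (\<Sum>\<^sub>\<infinity>i. cnj (ell2_nth f i) * ell2_nth g i)"

definition ell2_unit :: "'i \<Rightarrow> 'i ell2" where
  "ell2_unit j = Abs_ell2 (\<lambda>i. if i = j then 1 else 0)"

text \<open>The Hilbert space tensor product of \<open>\<ell>\<^sup>2(I)\<close> and \<open>\<ell>\<^sup>2(J)\<close> is \<open>\<ell>\<^sup>2(I \<times> J)\<close>, with the following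
  elementary tensors.\<close>

definition ell2_tensor :: "'i ell2 \<Rightarrow> 'j ell2 \<Rightarrow> ('i \<times> 'j) ell2" where
  "ell2_tensor f g = Abs_ell2 (\<lambda>(i, j). ell2_nth f i * ell2_nth g j)"


section \<open>C*-algebras and *-homomorphisms\<close>

record 'a star_alg = "'a partial_object" +
  aplus :: "'a \<Rightarrow> 'a \<Rightarrow> 'a"
  azero :: 'a
  amult :: "'a \<Rightarrow> 'a \<Rightarrow> 'a"
  ascale :: "complex \<Rightarrow> 'a \<Rightarrow> 'a"
  astar :: "'a \<Rightarrow> 'a"

record 'a cstar_alg = "'a star_alg" +
  anorm :: "'a \<Rightarrow> real"

locale star_algebra =
  fixes A :: "('a, 'm) star_alg_scheme"
  assumes zero_closed: "azero A \<in> carrier A"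
    and plus_closed: "\<lbrakk>x \<in> carrier A; y \<in> carrier A\<rbrakk> \<Longrightarrow> aplus A x y \<in> carrier A"
    and mult_closed: "\<lbrakk>x \<in> carrier A; y \<in> carrier A\<rbrakk> \<Longrightarrow> amult A x y \<in> carrier A"
    and scale_closed: "x \<in> carrier A \<Longrightarrow> ascale A c x \<in> carrier A"
    and star_closed: "x \<in> carrier A \<Longrightarrow> astar A x \<in> carrier A"
    and plus_assoc: "\<lbrakk>x \<in> carrier A; y \<in> carrier A; z \<in> carrier A\<rbrakk>
      \<Longrightarrow> aplus A (aplus A x y) z = aplus A x (aplus A y z)"
    and plus_commute: "\<lbrakk>x \<in> carrier A; y \<in> carrier A\<rbrakk> \<Longrightarrow> aplus A x y = aplus A y x"
    and zero_plus: "x \<in> carrier A \<Longrightarrow> aplus A (azero A) x = x"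
    and plus_minus: "x \<in> carrier A \<Longrightarrow> aplus A x (ascale A (- 1) x) = azero A"
    and scale_plus: "\<lbrakk>x \<in> carrier A; y \<in> carrier A\<rbrakk>
      \<Longrightarrow> ascale A c (aplus A x y) = aplus A (ascale A c x) (ascale A c y)"
    and plus_scale: "x \<in> carrier A \<Longrightarrow> ascale A (c + d) x = aplus A (ascale A c x) (ascale A d x)"
    and scale_scale: "x \<in> carrier A \<Longrightarrow> ascale A c (ascale A d x) = ascale A (c * d) x"
    and scale_one: "x \<in> carrier A \<Longrightarrow> ascale A 1 x = x"
    and mult_assoc: "\<lbrakk>x \<in> carrier A; y \<in> carrier A; z \<in> carrier A\<rbrakk>
      \<Longrightarrow> amult A (amult A x y) z = amult A x (amult A y z)"
    and plus_mult: "\<lbrakk>x \<in> carrier A; y \<in> carrier A; z \<in> carrier A\<rbrakk>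
      \<Longrightarrow> amult A (aplus A x y) z = aplus A (amult A x z) (amult A y z)"
    and mult_plus: "\<lbrakk>x \<in> carrier A; y \<in> carrier A; z \<in> carrier A\<rbrakk>
      \<Longrightarrow> amult A x (aplus A y z) = aplus A (amult A x y) (amult A x z)"
    and scale_mult: "\<lbrakk>x \<in> carrier A; y \<in> carrier A\<rbrakk>
      \<Longrightarrow> amult A (ascale A c x) y = ascale A c (amult A x y)"
    and mult_scale: "\<lbrakk>x \<in> carrier A; y \<in> carrier A\<rbrakk>
      \<Longrightarrow> amult A x (ascale A c y) = ascale A c (amult A x y)"
    and star_star: "x \<in> carrier A \<Longrightarrow> astar A (astar A x) = x"
    and star_plus: "\<lbrakk>x \<in> carrier A; y \<in> carrier A\<rbrakk>
      \<Longrightarrow> astar A (aplus A x y) = aplus A (astar A x) (astar A y)"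
    and star_scale: "x \<in> carrier A \<Longrightarrow> astar A (ascale A c x) = ascale A (cnj c) (astar A x)"
    and star_mult: "\<lbrakk>x \<in> carrier A; y \<in> carrier A\<rbrakk>
      \<Longrightarrow> astar A (amult A x y) = amult A (astar A y) (astar A x)"

definition aminus :: "('a, 'm) star_alg_scheme \<Rightarrow> 'a \<Rightarrow> 'a \<Rightarrow> 'a" where
  "aminus A x y = aplus A x (ascale A (- 1) y)"

locale cstar_algebra = star_algebra A for A :: "('a, 'm) cstar_alg_scheme" +
  assumes norm_zero_iff: "x \<in> carrier A \<Longrightarrow> anorm A x = 0 \<longleftrightarrow> x = azero A"
    and norm_triangle: "\<lbrakk>x \<in> carrier A; y \<in> carrier A\<rbrakk>
      \<Longrightarrow> anorm A (aplus A x y) \<le> anorm A x + anorm A y"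
    and norm_scale: "x \<in> carrier A \<Longrightarrow> anorm A (ascale A c x) = cmod c * anorm A x"
    and norm_submult: "\<lbrakk>x \<in> carrier A; y \<in> carrier A\<rbrakk>
      \<Longrightarrow> anorm A (amult A x y) \<le> anorm A x * anorm A y"
    and cstar_identity: "x \<in> carrier A \<Longrightarrow> anorm A (amult A (astar A x) x) = (anorm A x)\<^sup>2"
    and complete: "\<lbrakk>\<And>n. X n \<in> carrier A;
        \<And>e. e > 0 \<Longrightarrow> \<exists>N. \<forall>m\<ge>N. \<forall>n\<ge>N. anorm A (aminus A (X m) (X n)) < e\<rbrakk>
      \<Longrightarrow> \<exists>L\<in>carrier A. (\<lambda>n. anorm A (aminus A (X n) L)) \<longlonglongrightarrow> 0"

text \<open>No continuity is required of *-homomorphisms: between C*-algebras they are automatically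
  contractive, and *-isomorphisms are automatically isometric.\<close>

definition star_hom :: "('a, 'm) star_alg_scheme \<Rightarrow> ('b, 'n) star_alg_scheme \<Rightarrow> ('a \<Rightarrow> 'b) set" where
  "star_hom A B = {f \<in> carrier A \<rightarrow>\<^sub>E carrier B.
     (\<forall>x\<in>carrier A. \<forall>y\<in>carrier A. f (aplus A x y) = aplus B (f x) (f y)) \<and>
     (\<forall>x\<in>carrier A. \<forall>y\<in>carrier A. f (amult A x y) = amult B (f x) (f y)) \<and>
     (\<forall>c. \<forall>x\<in>carrier A. f (ascale A c x) = ascale B c (f x)) \<and>
     (\<forall>x\<in>carrier A. f (astar A x) = astar B (f x))}"

definition star_iso :: "('a, 'm) star_alg_scheme \<Rightarrow> ('b, 'n) star_alg_scheme \<Rightarrow> ('a \<Rightarrow> 'b) set" where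
  "star_iso A B = {f \<in> star_hom A B. bij_betw f (carrier A) (carrier B)}"

definition properly_infinite :: "('a, 'm) star_alg_scheme \<Rightarrow> bool" where
  "properly_infinite A \<longleftrightarrow> (\<exists>e\<in>carrier A.
     (\<forall>x\<in>carrier A. amult A e x = x \<and> amult A x e = x) \<and>
     (\<exists>s\<in>carrier A. \<exists>t\<in>carrier A. amult A (astar A s) s = e \<and> amult A (astar A t) t = e \<and>
        amult A (amult A s (astar A s)) (amult A t (astar A t)) = azero A))"


section \<open>Bounded and compact operators, spatial tensor product\<close>

text \<open>The library's \<^typ>\<open>'a \<Rightarrow>\<^sub>L 'b\<close> consists of the bounded real-linear maps, so complex linearity
  is imposed on carriers.\<close>

definition adjoint_op :: "('i ell2 \<Rightarrow>\<^sub>L 'i ell2) \<Rightarrow> ('i ell2 \<Rightarrow>\<^sub>L 'i ell2)" where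
  "adjoint_op T = (THE S. \<forall>f g. ell2_cinner (blinfun_apply S f) g = ell2_cinner f (blinfun_apply T g))"

definition bounded_ops :: "('i ell2 \<Rightarrow>\<^sub>L 'i ell2) cstar_alg" where
  "bounded_ops = \<lparr>
     carrier = {T. \<forall>c f. blinfun_apply T (ell2_scaleC c f) = ell2_scaleC c (blinfun_apply T f)},
     aplus = (+),
     azero = 0,
     amult = (o\<^sub>L),
     ascale = (\<lambda>c T. Blinfun (\<lambda>f. ell2_scaleC c (blinfun_apply T f))),
     astar = adjoint_op,
     anorm = norm\<rparr>"

definition compact_ops :: "('i ell2 \<Rightarrow>\<^sub>L 'i ell2) cstar_alg" where
  "compact_ops = bounded_ops
     \<lparr>carrier := {T \<in> carrier bounded_ops. compact (closure (blinfun_apply T ` cball 0 1))}\<rparr>"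

definition matrix_unit :: "'i \<Rightarrow> 'i \<Rightarrow> ('i ell2 \<Rightarrow>\<^sub>L 'i ell2)" where
  "matrix_unit j k = Blinfun (\<lambda>f. ell2_scaleC (ell2_nth f k) (ell2_unit j))"

text \<open>For complex-linear \<open>S\<close> and \<open>T\<close>, the unique bounded operator with
  \<open>(S \<otimes> T)(f \<otimes> g) = S f \<otimes> T g\<close>.\<close>

definition op_tensor ::
  "('i ell2 \<Rightarrow>\<^sub>L 'i ell2) \<Rightarrow> ('j ell2 \<Rightarrow>\<^sub>L 'j ell2) \<Rightarrow> (('i \<times> 'j) ell2 \<Rightarrow>\<^sub>L ('i \<times> 'j) ell2)" where
  "op_tensor S T = (THE R. R \<in> carrier bounded_ops \<and>
     (\<forall>f g. blinfun_apply R (ell2_tensor f g) = ell2_tensor (blinfun_apply S f) (blinfun_apply T g)))"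

definition faithful_rep :: "('a, 'm) star_alg_scheme \<Rightarrow> ('a \<Rightarrow> ('i ell2 \<Rightarrow>\<^sub>L 'i ell2)) \<Rightarrow> bool" where
  "faithful_rep A \<pi> \<longleftrightarrow> \<pi> \<in> star_hom A bounded_ops \<and> inj_on \<pi> (carrier A)"

text \<open>The spatial tensor product of \<open>A\<close> and \<open>B\<close>, formed with faithful representations \<open>\<pi>\<close> of \<open>A\<close>
  and \<open>\<rho>\<close> of \<open>B\<close>; up to canonical isomorphism it does not depend on them. The real span used here
  is already a complex subspace, because the set of all \<open>\<pi> a \<otimes> \<rho> b\<close> is closed under complex
  scalars.\<close>

definition spatial_tensor ::
  "('a, 'm) star_alg_scheme \<Rightarrow> ('b, 'n) star_alg_scheme \<Rightarrow>
   ('a \<Rightarrow> ('i ell2 \<Rightarrow>\<^sub>L 'i ell2)) \<Rightarrow> ('b \<Rightarrow> ('j ell2 \<Rightarrow>\<^sub>L 'j ell2)) \<Rightarrow>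
   (('i \<times> 'j) ell2 \<Rightarrow>\<^sub>L ('i \<times> 'j) ell2) cstar_alg" where
  "spatial_tensor A B \<pi> \<rho> = bounded_ops
     \<lparr>carrier := closure (span {op_tensor (\<pi> a) (\<rho> b) | a b. a \<in> carrier A \<and> b \<in> carrier B})\<rparr>"


section \<open>Functors from C*-algebras to abelian groups\<close>

text \<open>The type \<open>'u\<close> is the universe of the category of C*-algebras: its objects are the C*-algebras
  with carrier contained in \<open>'u\<close>, its morphisms are the *-homomorphisms. Abelian groups are written
  multiplicatively, as in HOL-Algebra.\<close>

locale cstar_functor =
  fixes E :: "'u cstar_alg \<Rightarrow> 'g monoid"
    and Emap :: "'u cstar_alg \<Rightarrow> 'u cstar_alg \<Rightarrow> ('u \<Rightarrow> 'u) \<Rightarrow> 'g \<Rightarrow> 'g"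
  assumes obj_comm_group: "cstar_algebra A \<Longrightarrow> comm_group (E A)"
    and map_hom: "\<lbrakk>cstar_algebra A; cstar_algebra B; f \<in> star_hom A B\<rbrakk>
      \<Longrightarrow> Emap A B f \<in> hom (E A) (E B)"
    and map_id: "\<lbrakk>cstar_algebra A; x \<in> carrier (E A)\<rbrakk>
      \<Longrightarrow> Emap A A (restrict id (carrier A)) x = x"
    and map_compose: "\<lbrakk>cstar_algebra A; cstar_algebra B; cstar_algebra C;
        f \<in> star_hom A B; g \<in> star_hom B C; x \<in> carrier (E A)\<rbrakk>
      \<Longrightarrow> Emap A C (compose (carrier A) g f) x = Emap B C g (Emap A B f x)"

text \<open>The *-algebra of \<open>2 \<times> 2\<close> matrices over \<open>A\<close>. Its C*-norm is unique, hence not recorded.\<close>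

definition M2 :: "('a, 'm) star_alg_scheme \<Rightarrow> ('a^2^2) star_alg" where
  "M2 A = \<lparr>
     carrier = {x. \<forall>i j. x $ i $ j \<in> carrier A},
     aplus = (\<lambda>x y. \<chi> i j. aplus A (x $ i $ j) (y $ i $ j)),
     azero = (\<chi> i j. azero A),
     amult = (\<lambda>x y. \<chi> i j. aplus A (amult A (x $ i $ 1) (y $ 1 $ j)) (amult A (x $ i $ 2) (y $ 2 $ j))),
     ascale = (\<lambda>c x. \<chi> i j. ascale A c (x $ i $ j)),
     astar = (\<lambda>x. \<chi> i j. astar A (x $ j $ i))\<rparr>"

definition M2_corner :: "('a, 'm) star_alg_scheme \<Rightarrow> 'a \<Rightarrow> 'a^2^2" where
  "M2_corner A = (\<lambda>a\<in>carrier A. \<chi> i j. if i = 1 \<and> j = 1 then a else azero A)"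

text \<open>The elements of \<open>M2 A\<close> do not have type \<open>'u\<close>, so \<open>E\<close> is applied to an arbitrary object \<open>B\<close>
  of the category together with an isomorphism \<open>\<phi>\<close> from \<open>M2 A\<close> onto \<open>B\<close>. Such a \<open>B\<close> always
  exists: either \<open>A\<close> is zero, or \<open>'u\<close> is infinite and hence equinumerous with \<open>'u^2^2\<close>.
  By functoriality the condition does not depend on the choice of \<open>B\<close> and \<open>\<phi>\<close>. Spatial tensor
  products, which are built as concrete operator algebras, are brought into the category in the
  same way.\<close>

definition M2_stable ::
  "('u cstar_alg \<Rightarrow> 'g monoid) \<Rightarrow> ('u cstar_alg \<Rightarrow> 'u cstar_alg \<Rightarrow> ('u \<Rightarrow> 'u) \<Rightarrow> 'g \<Rightarrow> 'g) \<Rightarrow> bool" where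
  "M2_stable E Emap \<longleftrightarrow> (\<forall>A B \<phi>. cstar_algebra A \<longrightarrow> cstar_algebra B \<longrightarrow> \<phi> \<in> star_iso (M2 A) B \<longrightarrow>
     Emap A B (compose (carrier A) \<phi> (M2_corner A)) \<in> iso (E A) (E B))"

end

theory Submission
  imports Defs "HOL-Computational_Algebra.Polynomial" "HOL-Real_Asymp.Real_Asymp"
begin

text \<open>Let \<open>s\<close>, \<open>t\<close> be isometries in the properly infinite algebra \<open>A\<close> with orthogonal ranges and put
  \<open>s\<^sub>j = t\<^sup>j s\<close>. The row operator \<open>W = (s\<^sub>0, s\<^sub>1, \<dots>)\<close> satisfies \<open>W\<^sup>* W = diag(1, 1, \<dots>)\<close> with the unit of
  \<open>A\<close> on the diagonal, so conjugation by it is a *-homomorphism \<open>A \<otimes> K \<rightarrow> A\<close> that sends \<open>a \<otimes> e\<^sub>j\<^sub>k\<close>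
  to \<open>s\<^sub>j a s\<^sub>k\<^sup>*\<close>. Its composites with the corner inclusion are conjugation by \<open>s\<^sub>0\<close> on \<open>A\<close> and conjugation by \<open>e\<^sub>0 W\<close> on \<open>A \<otimes> K\<close>, where \<open>e\<^sub>0\<close> embeds the Hilbert space
  of \<open>A\<close> as the column with index 0. So it suffices that a stable functor maps conjugation by an
  isometric multiplier \<open>v\<close> to the identity (\<open>stable_functor_conj_map\<close>). This is the usual argument with
  conjugation by \<open>diag(1, v)\<close> on \<open>2 \<times> 2\<close> matrices, which fixes one corner and restricts to conjugation
  by \<open>v\<close> on the other. The multiplier \<open>e\<^sub>0 W\<close> acts on \<open>A \<otimes> K\<close> from the left only, and the argument is set
  up for such one-sided multipliers.

  The \<open>2 \<times> 2\<close> matrices have to be realised as an object of the category. Two isometric multipliers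
  \<open>\<sigma>\<close>, \<open>\<tau>\<close> with orthogonal ranges do this: \<open>(a\<^sub>i\<^sub>j)\<close> is sent to the element
  \<open>\<sigma> a\<^sub>1\<^sub>1 \<sigma>\<^sup>* + \<sigma> a\<^sub>1\<^sub>2 \<tau>\<^sup>* + \<tau> a\<^sub>2\<^sub>1 \<sigma>\<^sup>* + \<tau> a\<^sub>2\<^sub>2 \<tau>\<^sup>*\<close> of the algebra itself, and the image inherits a
  complete C*-norm (\<open>M2_map_iso\<close>). For \<open>A\<close> one takes \<open>s\<close> and \<open>t\<close>, for \<open>A \<otimes> K\<close> their amplifications.

  The tensor product is completed in the operator norm of a faithful representation \<open>\<pi>\<close>, whereas \<open>A\<close>
  carries an abstract C*-norm. That conjugation by \<open>W\<close> has values in \<open>\<pi> A\<close>, and not only in its closure,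
  rests on the fact that injective *-homomorphisms are isometric (\<open>norm_eq_N\<close>,
  \<open>closed_in_operator_norm\<close>). For a self-adjoint contraction \<open>a\<close> the
  unitary \<open>a + \<i> \<surd>(1 - a\<^sup>2)\<close> is approximated by polynomials in \<open>a\<close>, which bounds the norm of every
  Chebyshev polynomial of \<open>a\<close> by 1. Expanding \<open>p\<^sup>N\<close> in Chebyshev polynomials and letting \<open>N\<close> grow yields
  \<open>\<parallel>p(a)\<parallel> \<le> sup {\<bar>p x\<bar> | \<bar>x\<bar> \<le> 1}\<close> for every polynomial \<open>p\<close>, in any C*-norm. By Weierstrass approximation
  this provides enough continuous functions of \<open>a\<close> to compare two C*-norms.\<close>


section \<open>Square-summable families as a real Hilbert space\<close>

lemma ell2_eqI: "(\<And>i. ell2_nth f i = ell2_nth g i) \<Longrightarrow> f = g"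
  by (metis ell2_nth_inject ext)

lemma ell2_nth_simps [simp]:
  "ell2_nth 0 i = 0"
  "ell2_nth (f + g) i = ell2_nth f i + ell2_nth g i"
  "ell2_nth (- f) i = - ell2_nth f i"
  "ell2_nth (f - g) i = ell2_nth f i - ell2_nth g i"
  "ell2_nth (r *\<^sub>R f) i = r *\<^sub>R ell2_nth f i"
  "ell2_nth (ell2_scaleC c f) i = c * ell2_nth f i"
  unfolding minus_ell2_def by (transfer; simp)+

lemma ell2_nth_sum [simp]: "ell2_nth (\<Sum>x\<in>F. f x) i = (\<Sum>x\<in>F. ell2_nth (f x) i)"
  by (induction F rule: infinite_finite_induct) auto

lemma ell2_square_summable: "(\<lambda>i. (cmod (ell2_nth f i))\<^sup>2) summable_on UNIV"
  using ell2_nth[of f] by simp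

lemma ell2_inner_eq: "f \<bullet> g = (\<Sum>\<^sub>\<infinity>i. ell2_nth f i \<bullet> ell2_nth g i)" for f g :: "'i ell2"
  by transfer simp

lemma ell2_norm_square: "(norm f)\<^sup>2 = (\<Sum>\<^sub>\<infinity>i. (cmod (ell2_nth f i))\<^sup>2)" for f :: "'i ell2"
  by (simp add: power2_norm_eq_inner ell2_inner_eq)

lemma ell2_sum_le_norm_square:
  fixes f :: "'i ell2"
  assumes "finite F"
  shows "(\<Sum>i\<in>F. (cmod (ell2_nth f i))\<^sup>2) \<le> (norm f)\<^sup>2"
  unfolding ell2_norm_square
  by (rule finite_sum_le_infsum) (use assms ell2_square_summable in auto)

text \<open>Vectors are constructed from prescribed coordinates. A uniform bound on finite sums
  of squares yields the vector together with a bound on its norm.\<close>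

lemma ell2_exists:
  fixes h :: "'i \<Rightarrow> complex"
  assumes bound: "\<And>F. finite F \<Longrightarrow> (\<Sum>i\<in>F. (cmod (h i))\<^sup>2) \<le> C"
  obtains f where "\<And>i. ell2_nth f i = h i" "(norm f)\<^sup>2 \<le> C"
proof -
  have summable: "(\<lambda>i. (cmod (h i))\<^sup>2) summable_on UNIV"
    by (rule nonneg_bdd_above_summable_on) (auto intro!: bdd_aboveI[of _ C] bound)
  then have nth: "ell2_nth (Abs_ell2 h) = h"
    by (simp add: Abs_ell2_inverse)
  moreover have "(norm (Abs_ell2 h))\<^sup>2 \<le> C"
    unfolding ell2_norm_square nth
    by (rule infsum_le_finite_sums) (use summable bound in auto)
  ultimately show ?thesis by (intro that[of "Abs_ell2 h"]) auto
qed

lemma ell2_norm_bound: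
  fixes f :: "'i ell2"
  assumes "\<And>F. finite F \<Longrightarrow> (\<Sum>i\<in>F. (cmod (ell2_nth f i))\<^sup>2) \<le> C\<^sup>2" "C \<ge> 0"
  shows "norm f \<le> C"
proof -
  obtain f' where f': "\<And>i. ell2_nth f' i = ell2_nth f i" "(norm f')\<^sup>2 \<le> C\<^sup>2"
    using ell2_exists[where h = "ell2_nth f", OF assms(1)] by blast
  then have "f' = f" by (intro ell2_eqI)
  then show ?thesis using f'(2) assms(2) by (auto intro: power2_le_imp_le)
qed

lemma ell2_nth_unit [simp]: "ell2_nth (ell2_unit j) i = (if i = j then 1 else 0)"
proof -
  have "(\<lambda>i. (cmod (if i = j then 1 else 0))\<^sup>2) summable_on UNIV"
  proof (rule finite_nonzero_values_imp_summable_on)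
    have "{x. (cmod (if x = j then 1 else 0))\<^sup>2 \<noteq> 0} \<subseteq> {j}" by auto
    then show "finite {x \<in> UNIV. (cmod (if x = j then 1 else 0))\<^sup>2 \<noteq> 0}"
      by (simp add: finite_subset)
  qed
  then show ?thesis by (simp add: ell2_unit_def Abs_ell2_inverse)
qed

lemma inner_ell2_scaleC_unit: "ell2_scaleC c (ell2_unit j) \<bullet> g = c \<bullet> ell2_nth g j"
proof -
  have "ell2_scaleC c (ell2_unit j) \<bullet> g
      = (\<Sum>\<^sub>\<infinity>i. ell2_nth (ell2_scaleC c (ell2_unit j)) i \<bullet> ell2_nth g i)"
    by (rule ell2_inner_eq)
  also have "\<dots> = (\<Sum>\<^sub>\<infinity>i\<in>{j}. ell2_nth (ell2_scaleC c (ell2_unit j)) i \<bullet> ell2_nth g i)"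
    by (rule infsum_cong_neutral) auto
  finally show ?thesis by simp
qed

lemma ell2_eq_by_inner:
  assumes "\<And>h. f \<bullet> h = g \<bullet> h"
  shows "f = (g :: 'i ell2)"
  by (metis assms inner_commute vector_eq_ldot)

lemma scaleC_of_real: "ell2_scaleC (of_real r) f = r *\<^sub>R f"
  by (rule ell2_eqI) (simp add: scaleR_conv_of_real)

lemma scaleC_zero [simp]: "ell2_scaleC 0 f = 0"
  by (rule ell2_eqI) simp

lemma scaleC_one [simp]: "ell2_scaleC 1 f = f"
  by (rule ell2_eqI) simp

lemma scaleC_add: "ell2_scaleC c (f + g) = ell2_scaleC c f + ell2_scaleC c g"
  by (rule ell2_eqI) (simp add: algebra_simps)

lemma scaleC_add_left: "ell2_scaleC (c + d) f = ell2_scaleC c f + ell2_scaleC d f"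
  by (rule ell2_eqI) (simp add: algebra_simps)

lemma scaleC_scaleC [simp]: "ell2_scaleC c (ell2_scaleC d f) = ell2_scaleC (c * d) f"
  by (rule ell2_eqI) (simp add: algebra_simps)

lemma scaleC_scaleR: "ell2_scaleC c (r *\<^sub>R f) = r *\<^sub>R ell2_scaleC c f"
  by (rule ell2_eqI) (simp add: algebra_simps)

lemma norm_scaleC: "norm (ell2_scaleC c f) = cmod c * norm f"
proof -
  have "(norm (ell2_scaleC c f))\<^sup>2 = (cmod c * norm f)\<^sup>2"
    by (simp add: ell2_norm_square power_mult_distrib norm_mult infsum_cmult_right')
  then show ?thesis by (simp add: power2_eq_iff_nonneg)
qed

lemma inner_scaleC: "ell2_scaleC c f \<bullet> g = f \<bullet> ell2_scaleC (cnj c) g"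
proof -
  have "(c * z) \<bullet> w = z \<bullet> (cnj c * w)" for z w :: complex
    by (simp add: inner_complex_def algebra_simps)
  then show ?thesis by (simp add: ell2_inner_eq)
qed

lemma complex_eq_by_inner:
  assumes "\<And>c. c \<bullet> z = c \<bullet> w"
  shows "z = (w :: complex)"
  using assms[of 1] assms[of \<i>] by (auto simp: inner_complex_def complex_eq_iff)

text \<open>The finite truncations of a square-summable family converge to it. All density arguments
  below rest on this.\<close>

lemma ell2_truncation_tendsto:
  fixes g :: "'i ell2"
  shows "((\<lambda>F. \<Sum>i\<in>F. ell2_scaleC (ell2_nth g i) (ell2_unit i)) \<longlongrightarrow> g)
    (finite_subsets_at_top UNIV)"
proof -
  let ?t = "\<lambda>F. \<Sum>i\<in>F. ell2_scaleC (ell2_nth g i) (ell2_unit i)"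
  have nth: "ell2_nth (?t F) k = (if k \<in> F then ell2_nth g k else 0)" if "finite F" for F k
    using that by (simp add: sum.delta mult_if_delta if_distrib cong: if_cong)
  have eq: "(norm (?t F - g))\<^sup>2 = (norm g)\<^sup>2 - (\<Sum>i\<in>F. (cmod (ell2_nth g i))\<^sup>2)" if "finite F" for F
  proof -
    have "?t F \<bullet> h = (\<Sum>i\<in>F. ell2_nth g i \<bullet> ell2_nth h i)" for h
      by (simp add: inner_sum_left inner_ell2_scaleC_unit)
    then have "?t F \<bullet> g = (\<Sum>i\<in>F. (cmod (ell2_nth g i))\<^sup>2)"
      and "?t F \<bullet> ?t F = (\<Sum>i\<in>F. (cmod (ell2_nth g i))\<^sup>2)"
      using nth[OF that] by (simp_all add: power2_norm_eq_inner)
    then show ?thesis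
      by (simp add: power2_norm_eq_inner inner_diff_left inner_diff_right inner_commute)
  qed
  have "((\<lambda>F. \<Sum>i\<in>F. (cmod (ell2_nth g i))\<^sup>2) \<longlongrightarrow> (norm g)\<^sup>2) (finite_subsets_at_top UNIV)"
    unfolding ell2_norm_square
    by (rule infsum_tendsto) (rule ell2_square_summable)
  then have "((\<lambda>F. sqrt ((norm g)\<^sup>2 - (\<Sum>i\<in>F. (cmod (ell2_nth g i))\<^sup>2))) \<longlongrightarrow> sqrt ((norm g)\<^sup>2 - (norm g)\<^sup>2))
      (finite_subsets_at_top UNIV)"
    by (intro tendsto_intros)
  moreover have "eventually (\<lambda>F. sqrt ((norm g)\<^sup>2 - (\<Sum>i\<in>F. (cmod (ell2_nth g i))\<^sup>2)) = norm (?t F - g))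
      (finite_subsets_at_top UNIV)"
    by (rule eventually_finite_subsets_at_top_weakI) (metis eq norm_ge_zero real_sqrt_unique)
  ultimately have "((\<lambda>F. norm (?t F - g)) \<longlongrightarrow> 0) (finite_subsets_at_top UNIV)"
    by (simp add: filterlim_cong)
  then show ?thesis
    by (rule LIM_zero_cancel[OF tendsto_norm_zero_cancel])
qed


section \<open>Adjoints and complex linearity\<close>

lemma blinfun_exists:
  fixes F :: "'a::real_normed_vector \<Rightarrow> 'b::real_normed_vector"
  assumes "\<And>x y. F (x + y) = F x + F y" "\<And>r x. F (r *\<^sub>R x) = r *\<^sub>R F x"
    and "\<And>x. norm (F x) \<le> K * norm x"
  shows "blinfun_apply (Blinfun F) = F"
  by (rule bounded_linear_Blinfun_apply)
    (use assms in \<open>auto intro!: bounded_linear_intro simp: mult.commute\<close>)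

lemma blinfun_eq_on_units:
  fixes S T :: "'i ell2 \<Rightarrow>\<^sub>L 'b::real_normed_vector"
  assumes "\<And>c i. S (ell2_scaleC c (ell2_unit i)) = T (ell2_scaleC c (ell2_unit i))"
  shows "S = T"
proof (rule blinfun_eqI)
  fix g :: "'i ell2"
  let ?t = "\<lambda>F. \<Sum>i\<in>F. ell2_scaleC (ell2_nth g i) (ell2_unit i)"
  have "((\<lambda>F. S (?t F)) \<longlongrightarrow> S g) (finite_subsets_at_top UNIV)"
    and "((\<lambda>F. T (?t F)) \<longlongrightarrow> T g) (finite_subsets_at_top UNIV)"
    by (intro blinfun.tendsto[OF tendsto_const ell2_truncation_tendsto])+
  moreover have "(\<lambda>F. S (?t F)) = (\<lambda>F. T (?t F))"
    using assms by (simp add: blinfun.sum_right)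
  ultimately show "S g = T g"
    using tendsto_unique finite_subsets_at_top_neq_bot by metis
qed

text \<open>Taken with respect to the real inner product, the adjoint exists for every real-linear
  bounded operator between possibly different spaces, and so obeys its rules without side
  conditions. Its coordinates are prescribed by testing against the real orthonormal family of the
  vectors \<open>e\<^sub>i\<close> and \<open>\<i> e\<^sub>i\<close>; the Cauchy-Schwarz inequality makes them square-summable.\<close>

lemma real_adjoint_exists:
  fixes T :: "'i ell2 \<Rightarrow>\<^sub>L 'j ell2"
  shows "\<exists>S. \<forall>f g. blinfun_apply S f \<bullet> g = f \<bullet> blinfun_apply T g"
proof -
  define coord where "coord f i = Complex (T (ell2_unit i) \<bullet> f) (T (ell2_scaleC \<i> (ell2_unit i)) \<bullet> f)"
    for f i
  have coord: "T (ell2_scaleC c (ell2_unit i)) \<bullet> f = c \<bullet> coord f i" for c i f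
  proof -
    have "ell2_scaleC c (ell2_unit i) = Re c *\<^sub>R ell2_unit i + Im c *\<^sub>R ell2_scaleC \<i> (ell2_unit i)"
      by (rule ell2_eqI) (simp add: complex_eq_iff)
    then show ?thesis
      by (simp add: coord_def blinfun.add_right blinfun.scaleR_right inner_add_left inner_complex_def)
  qed
  have bound: "(\<Sum>i\<in>F. (cmod (coord f i))\<^sup>2) \<le> (norm T * norm f)\<^sup>2" if "finite F" for F f
  proof -
    let ?x = "\<Sum>i\<in>F. ell2_scaleC (coord f i) (ell2_unit i)"
    let ?s = "\<Sum>i\<in>F. (cmod (coord f i))\<^sup>2"
    have nth: "ell2_nth ?x k = (if k \<in> F then coord f k else 0)" for k
      using that by (simp add: sum.delta mult_if_delta if_distrib cong: if_cong)
    have "?x \<bullet> ?x = ?s"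
      using nth by (simp add: inner_sum_left inner_ell2_scaleC_unit power2_norm_eq_inner
          del: ell2_nth_sum)
    then have norm_x: "(norm ?x)\<^sup>2 = ?s" by (simp only: power2_norm_eq_inner)
    have "?s = T ?x \<bullet> f"
      by (simp add: blinfun.sum_right inner_sum_left coord power2_norm_eq_inner)
    also have "\<dots> \<le> norm (T ?x) * norm f" by (rule norm_cauchy_schwarz)
    also have "\<dots> \<le> norm T * norm ?x * norm f"
      by (intro mult_right_mono norm_blinfun) auto
    finally have "(norm ?x)\<^sup>2 \<le> norm ?x * (norm T * norm f)"
      unfolding norm_x by (simp add: ac_simps)
    then have "norm ?x \<le> norm T * norm f"
      by (cases "norm ?x = 0") (auto simp: power2_eq_square)
    then show ?thesis unfolding norm_x[symmetric] by (intro power_mono) auto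
  qed
  have "\<exists>h. (\<forall>i. ell2_nth h i = coord f i) \<and> (norm h)\<^sup>2 \<le> (norm T * norm f)\<^sup>2" for f
    using ell2_exists[where h = "coord f", OF bound] by metis
  then obtain S where S: "\<And>f i. ell2_nth (S f) i = coord f i"
      and S_bound: "\<And>f. (norm (S f))\<^sup>2 \<le> (norm T * norm f)\<^sup>2"
    by metis
  have "blinfun_apply (Blinfun S) = S"
  proof (rule blinfun_exists)
    show "S (x + y) = S x + S y" for x y
      by (rule ell2_eqI) (simp add: S coord_def inner_add_right complex_eq_iff)
    show "S (r *\<^sub>R x) = r *\<^sub>R S x" for r x
      by (rule ell2_eqI) (simp add: S coord_def complex_eq_iff)
    show "norm (S x) \<le> norm T * norm x" for x
      by (rule power2_le_imp_le[OF S_bound]) simp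
  qed
  moreover have "S f \<bullet> g = f \<bullet> T g" for f g
  proof -
    let ?l = "Blinfun (\<lambda>g. S f \<bullet> g)" and ?r = "Blinfun (\<lambda>g. f \<bullet> T g)"
    have l: "blinfun_apply ?l = (\<lambda>g. S f \<bullet> g)"
      by (rule bounded_linear_Blinfun_apply) (intro bounded_linear_intros)
    have r: "blinfun_apply ?r = (\<lambda>g. f \<bullet> T g)"
      by (rule bounded_linear_Blinfun_apply) (intro bounded_linear_intros)
    have "?l = ?r"
    proof (rule blinfun_eq_on_units)
      fix c i
      show "?l (ell2_scaleC c (ell2_unit i)) = ?r (ell2_scaleC c (ell2_unit i))"
        unfolding l r
        by (metis coord inner_commute inner_ell2_scaleC_unit S)
    qed
    then show ?thesis using l r by metis
  qed
  ultimately show ?thesis by (intro exI[of _ "Blinfun S"]) simp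
qed

definition adj :: "('i ell2 \<Rightarrow>\<^sub>L 'j ell2) \<Rightarrow> ('j ell2 \<Rightarrow>\<^sub>L 'i ell2)" where
  "adj T = (SOME S. \<forall>f g. blinfun_apply S f \<bullet> g = f \<bullet> blinfun_apply T g)"

lemma adj_inner: "adj T f \<bullet> g = f \<bullet> T g" for T :: "'i ell2 \<Rightarrow>\<^sub>L 'j ell2"
  using someI_ex[OF real_adjoint_exists[of T]] unfolding adj_def by blast

lemma adj_inner': "f \<bullet> adj T g = T f \<bullet> g" for T :: "'i ell2 \<Rightarrow>\<^sub>L 'j ell2"
  using adj_inner[of T g f] by (simp add: inner_commute)

lemma adj_unique:
  fixes T :: "'i ell2 \<Rightarrow>\<^sub>L 'j ell2"
  assumes "\<And>f g. blinfun_apply S f \<bullet> g = f \<bullet> T g"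
  shows "adj T = S"
  by (intro blinfun_eqI ell2_eq_by_inner) (simp add: adj_inner assms)

lemma adj_adj [simp]: "adj (adj T) = T"
  by (rule adj_unique) (simp add: adj_inner')

lemma adj_compose [simp]: "adj (S o\<^sub>L T) = adj T o\<^sub>L adj S"
  by (rule adj_unique) (simp add: adj_inner)

lemma adj_add [simp]: "adj (S + T) = adj S + adj T"
  by (rule adj_unique) (simp add: blinfun.add_left inner_add_left inner_add_right adj_inner)

lemma adj_scaleR [simp]: "adj (r *\<^sub>R T) = r *\<^sub>R adj T"
  by (rule adj_unique) (simp add: blinfun.scaleR_left adj_inner)

lemma adj_zero [simp]: "adj 0 = 0"
  by (rule adj_unique) simp

lemma adj_minus [simp]: "adj (- T) = - adj T"
  using adj_scaleR[of "-1" T] by simp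

lemma adj_diff [simp]: "adj (S - T) = adj S - adj T"
  using adj_add[of S "- T"] by simp

lemma norm_adj [simp]: "norm (adj T) = norm T"
proof -
  have le: "norm (adj T) \<le> norm T" for T :: "'x ell2 \<Rightarrow>\<^sub>L 'y ell2"
  proof (rule norm_blinfun_bound)
    fix f
    have "(norm (adj T f))\<^sup>2 = f \<bullet> T (adj T f)"
      by (simp add: power2_norm_eq_inner adj_inner)
    also have "\<dots> \<le> norm f * norm (T (adj T f))" by (rule norm_cauchy_schwarz)
    also have "\<dots> \<le> norm f * (norm T * norm (adj T f))"
      by (intro mult_left_mono norm_blinfun) auto
    finally show "norm (adj T f) \<le> norm T * norm f"
      by (cases "norm (adj T f) = 0") (auto simp: power2_eq_square ac_simps)
  qed auto
  show ?thesis using le[of T] le[of "adj T"] by simp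
qed

lemma bounded_linear_adj: "bounded_linear adj"
  by (rule bounded_linear_intro[of _ 1]) auto

lemma norm_square_adj: "(norm (T f))\<^sup>2 = (adj T o\<^sub>L T) f \<bullet> f" for T :: "'i ell2 \<Rightarrow>\<^sub>L 'j ell2"
  by (simp add: power2_norm_eq_inner adj_inner)

text \<open>With the multiplication by a complex scalar as an operator, scalar multiples are compositions and
  complex linearity is commutation with these operators.\<close>

definition cscale :: "complex \<Rightarrow> 'i ell2 \<Rightarrow>\<^sub>L 'i ell2" where
  "cscale c = Blinfun (ell2_scaleC c)"

lemma cscale_apply [simp]: "cscale c f = ell2_scaleC c f"
  unfolding cscale_def
  by (rule fun_cong[OF blinfun_exists[of _ "cmod c"]])
    (simp_all add: scaleC_add scaleC_scaleR norm_scaleC)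

lemma adj_cscale [simp]: "adj (cscale c) = cscale (cnj c)"
  by (rule adj_unique) (simp add: inner_scaleC)

lemma compose_assoc: "(R o\<^sub>L S) o\<^sub>L T = R o\<^sub>L (S o\<^sub>L T)"
  by (rule blinfun_eqI) simp

definition clin :: "('i ell2 \<Rightarrow>\<^sub>L 'j ell2) \<Rightarrow> bool" where
  "clin T \<longleftrightarrow> (\<forall>c. T o\<^sub>L cscale c = cscale c o\<^sub>L T)"

lemma clin_apply:
  fixes T :: "'i ell2 \<Rightarrow>\<^sub>L 'j ell2"
  shows "clin T \<Longrightarrow> T (ell2_scaleC c f) = ell2_scaleC c (T f)"
  unfolding clin_def by (metis blinfun_apply_blinfun_compose cscale_apply)

lemma clinI:
  fixes T :: "'i ell2 \<Rightarrow>\<^sub>L 'j ell2"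
  shows "(\<And>c f. T (ell2_scaleC c f) = ell2_scaleC c (T f)) \<Longrightarrow> clin T"
  unfolding clin_def by (auto intro!: blinfun_eqI)

lemma clin_comm: "clin T \<Longrightarrow> T o\<^sub>L cscale c = cscale c o\<^sub>L T"
  by (simp add: clin_def)

lemma clin_comm': "clin T \<Longrightarrow> T o\<^sub>L (cscale c o\<^sub>L X) = cscale c o\<^sub>L (T o\<^sub>L X)"
  by (metis clin_def compose_assoc)

lemma clin_adj: "clin T \<Longrightarrow> clin (adj T)"
  unfolding clin_def by (metis adj_adj adj_compose adj_cscale complex_cnj_cnj)

lemma clin_compose: "clin S \<Longrightarrow> clin T \<Longrightarrow> clin (S o\<^sub>L T)"
  by (auto intro!: clinI simp: clin_apply)

lemma clin_add: "clin S \<Longrightarrow> clin T \<Longrightarrow> clin (S + T)"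
  by (auto intro!: clinI simp: clin_apply blinfun.add_left scaleC_add)

lemma clin_zero: "clin 0"
  by (auto intro!: clinI ell2_eqI)

lemma clin_scaleR: "clin S \<Longrightarrow> clin (r *\<^sub>R S)"
  by (auto intro!: clinI simp: clin_apply blinfun.scaleR_left scaleC_scaleR)

lemma clin_cscale: "clin (cscale c)"
  by (auto intro!: clinI simp: mult.commute)

lemma clin_eq_on_units:
  fixes S T :: "'i ell2 \<Rightarrow>\<^sub>L 'j ell2"
  assumes "clin S" "clin T" "\<And>i. S (ell2_unit i) = T (ell2_unit i)"
  shows "S = T"
  by (rule blinfun_eq_on_units) (simp add: clin_apply assms)

text \<open>The complex inner product is determined by the real one. Hence for complex-linear operators
  the adjoint in the category of complex Hilbert spaces is the real adjoint.\<close>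

lemma ell2_cinner_eq: "ell2_cinner f g = Complex (f \<bullet> g) (f \<bullet> ell2_scaleC (- \<i>) g)"
proof -
  have abs: "(\<lambda>i. norm (cnj (ell2_nth f i) * ell2_nth g i)) summable_on UNIV"
  proof (rule summable_on_comparison_test)
    show "(\<lambda>i. (cmod (ell2_nth f i))\<^sup>2 + (cmod (ell2_nth g i))\<^sup>2) summable_on UNIV"
      by (intro summable_on_add ell2_square_summable)
    show "norm (cnj (ell2_nth f i) * ell2_nth g i) \<le> (cmod (ell2_nth f i))\<^sup>2 + (cmod (ell2_nth g i))\<^sup>2" for i
    proof -
      let ?a = "cmod (ell2_nth f i)" and ?b = "cmod (ell2_nth g i)"
      have "norm (cnj (ell2_nth f i) * ell2_nth g i) = ?a * ?b" by (simp add: norm_mult)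
      moreover have "2 * ?a * ?b \<le> ?a\<^sup>2 + ?b\<^sup>2" by (rule sum_squares_bound)
      moreover have "0 \<le> ?a * ?b" by simp
      ultimately show ?thesis by linarith
    qed
  qed simp
  have summable: "(\<lambda>i. cnj (ell2_nth f i) * ell2_nth g i) summable_on UNIV"
    by (rule abs_summable_summable[OF abs])
  show ?thesis
    unfolding ell2_cinner_def
    by (simp add: complex_eq_iff infsum_Re[OF summable, symmetric] infsum_Im[OF summable, symmetric]
        ell2_inner_eq inner_complex_def)
qed

lemma bounded_ops_simps [simp]:
  "carrier bounded_ops = {T. clin T}" "aplus bounded_ops = (+)" "azero bounded_ops = 0"
  "amult bounded_ops = (o\<^sub>L)" "astar bounded_ops = adjoint_op" "anorm bounded_ops = norm"
proof -
  show "carrier bounded_ops = {T. clin T}"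
    by (auto simp: bounded_ops_def clin_apply intro!: clinI)
qed (auto simp: bounded_ops_def)

lemma ascale_bounded_ops [simp]: "ascale bounded_ops c T = cscale c o\<^sub>L T"
proof -
  have "(\<lambda>f. ell2_scaleC c (blinfun_apply T f)) = blinfun_apply (cscale c o\<^sub>L T)"
    by (rule ext) simp
  then show ?thesis by (simp add: bounded_ops_def blinfun_apply_inverse)
qed

lemma adjoint_op_eq_adj:
  assumes "clin T"
  shows "adjoint_op T = adj T"
  unfolding adjoint_op_def
proof (rule the_equality)
  show "\<forall>f g. ell2_cinner (adj T f) g = ell2_cinner f (T g)"
    by (simp add: ell2_cinner_eq adj_inner clin_apply[OF assms])
next
  fix S assume S: "\<forall>f g. ell2_cinner (blinfun_apply S f) g = ell2_cinner f (T g)"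
  have "S f \<bullet> g = f \<bullet> T g" for f g
    using S[rule_format, of f g] by (simp add: ell2_cinner_eq)
  then show "S = adj T" by (rule adj_unique[symmetric])
qed


section \<open>Columns of a square-summable family on a product\<close>

text \<open>For injective \<open>h\<close> the composition with \<open>h\<close> is a contraction. Its instances are the columns of
  a family on a product and the exchange of the two factors.\<close>

definition pullback :: "('a \<Rightarrow> 'b) \<Rightarrow> 'b ell2 \<Rightarrow>\<^sub>L 'a ell2" where
  "pullback h = Blinfun (\<lambda>f. Abs_ell2 (\<lambda>a. ell2_nth f (h a)))"

lemma ell2_nth_pullback:
  assumes "inj h"
  shows "ell2_nth (pullback h f) a = ell2_nth f (h a)"
proof -
  define P where "P = (\<lambda>f. Abs_ell2 (\<lambda>a. ell2_nth f (h a)))"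
  have bound: "(\<Sum>a\<in>F. (cmod (ell2_nth f (h a)))\<^sup>2) \<le> (norm f)\<^sup>2" if "finite F" for F f
    using ell2_sum_le_norm_square[of "h ` F" f] that assms
    by (simp add: sum.reindex inj_on_subset)
  have P: "(\<forall>a. ell2_nth (P f) a = ell2_nth f (h a)) \<and> (norm (P f))\<^sup>2 \<le> (norm f)\<^sup>2" for f
  proof (rule ell2_exists[where h = "\<lambda>a. ell2_nth f (h a)" and C = "(norm f)\<^sup>2"])
    fix g assume g: "\<And>a. ell2_nth g a = ell2_nth f (h a)" "(norm g)\<^sup>2 \<le> (norm f)\<^sup>2"
    then have "P f = g"
      unfolding P_def by (metis (no_types, lifting) ell2_nth_inverse ext)
    then show ?thesis using g by simp
  qed (rule bound)
  have "blinfun_apply (Blinfun P) = P"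
  proof (rule blinfun_exists[where K = 1])
    show "norm (P f) \<le> 1 * norm f" for f
      using P[of f] by (auto intro: power2_le_imp_le)
  qed (auto intro!: ell2_eqI simp: P)
  then show ?thesis using P by (simp add: pullback_def P_def)
qed

lemma norm_pullback_le: "inj h \<Longrightarrow> norm (pullback h f) \<le> norm f"
proof (rule ell2_norm_bound)
  fix F :: "'a set" assume "inj h" "finite F"
  then show "(\<Sum>i\<in>F. (cmod (ell2_nth (pullback h f) i))\<^sup>2) \<le> (norm f)\<^sup>2"
    using ell2_sum_le_norm_square[of "h ` F" f]
    by (simp add: ell2_nth_pullback sum.reindex inj_on_subset)
qed simp

lemma clin_pullback: "inj h \<Longrightarrow> clin (pullback h)"
  by (auto intro!: clinI ell2_eqI simp: ell2_nth_pullback)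

definition col :: "'j \<Rightarrow> ('i \<times> 'j) ell2 \<Rightarrow>\<^sub>L 'i ell2" where
  "col j = pullback (\<lambda>i. (i, j))"

definition emb :: "'j \<Rightarrow> 'i ell2 \<Rightarrow>\<^sub>L ('i \<times> 'j) ell2" where
  "emb j = adj (col j)"

definition swap_op :: "('i \<times> 'j) ell2 \<Rightarrow>\<^sub>L ('j \<times> 'i) ell2" where
  "swap_op = pullback prod.swap"

lemma ell2_nth_col [simp]: "ell2_nth (col j f) i = ell2_nth f (i, j)"
  unfolding col_def by (subst ell2_nth_pullback) (auto intro: injI)

lemma ell2_nth_swap_op [simp]: "ell2_nth (swap_op f) p = ell2_nth f (prod.swap p)"
  unfolding swap_op_def by (subst ell2_nth_pullback) auto

lemma clin_col: "clin (col j)"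
  unfolding col_def by (rule clin_pullback) (auto intro: injI)

lemma clin_emb: "clin (emb j)"
  unfolding emb_def by (intro clin_adj clin_col)

lemma clin_swap_op: "clin swap_op"
  unfolding swap_op_def by (rule clin_pullback) auto

lemma adj_emb [simp]: "adj (emb j) = col j"
  by (simp add: emb_def)

lemma adj_col [simp]: "adj (col j) = emb j"
  by (simp add: emb_def)

lemma norm_swap_op: "norm (swap_op f) \<le> norm f"
  unfolding swap_op_def by (rule norm_pullback_le) auto

lemma col_scaleC_unit:
  "col j (ell2_scaleC c (ell2_unit (i, k))) = (if k = j then ell2_scaleC c (ell2_unit i) else 0)"
  by (rule ell2_eqI) auto

lemma ell2_nth_emb [simp]: "ell2_nth (emb j f) (i, k) = (if k = j then ell2_nth f i else 0)"
proof (rule complex_eq_by_inner)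
  fix c
  have "c \<bullet> ell2_nth (emb j f) (i, k) = col j (ell2_scaleC c (ell2_unit (i, k))) \<bullet> f"
    unfolding inner_ell2_scaleC_unit[symmetric] emb_def by (rule adj_inner')
  then show "c \<bullet> ell2_nth (emb j f) (i, k) = c \<bullet> (if k = j then ell2_nth f i else 0)"
    by (simp add: col_scaleC_unit inner_ell2_scaleC_unit)
qed

lemma col_emb: "col j o\<^sub>L emb k = (if j = k then id_blinfun else 0)"
  by (auto intro!: blinfun_eqI ell2_eqI)

lemma norm_emb_apply [simp]: "norm (emb j f) = norm f"
proof -
  have "(norm (emb j f))\<^sup>2 = (norm f)\<^sup>2"
    unfolding norm_square_adj by (simp only: adj_emb col_emb) (simp add: power2_norm_eq_inner)
  then show ?thesis by (simp add: power2_eq_iff_nonneg)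
qed

lemma ell2_eq_by_col: "(\<And>j. col j f = col j g) \<Longrightarrow> f = g"
  by (rule ell2_eqI) (metis ell2_nth_col surj_pair)

lemma blinfun_eq_by_col:
  fixes S T :: "'a::real_normed_vector \<Rightarrow>\<^sub>L ('i \<times> 'j) ell2"
  shows "(\<And>j. col j o\<^sub>L S = col j o\<^sub>L T) \<Longrightarrow> S = T"
  by (intro blinfun_eqI ell2_eq_by_col) (metis blinfun_apply_blinfun_compose)

text \<open>Bessel's inequality for isometric embeddings with pairwise orthogonal ranges. It makes it
  possible to assemble the adjoints of such embeddings into one bounded operator.\<close>

lemma bessel:
  fixes V :: "'j \<Rightarrow> ('i ell2 \<Rightarrow>\<^sub>L 'k ell2)"
  assumes orth: "\<And>j k. j \<noteq> k \<Longrightarrow> adj (V j) o\<^sub>L V k = 0"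
    and contr: "\<And>j f. norm (V j f) \<le> norm f"
    and "finite F"
  shows "(\<Sum>j\<in>F. (norm (adj (V j) x))\<^sup>2) \<le> (norm x)\<^sup>2"
proof -
  let ?y = "\<Sum>j\<in>F. V j (adj (V j) x)" and ?b = "\<Sum>j\<in>F. (norm (adj (V j) x))\<^sup>2"
  have orth': "V j f \<bullet> V k g = 0" if "j \<noteq> k" for j k f g
    using adj_inner'[of f "V j" "V k g"] arg_cong[OF orth[OF that], of "\<lambda>T. blinfun_apply T g"] by simp
  have "(norm ?y)\<^sup>2 = (\<Sum>j\<in>F. \<Sum>k\<in>F. V j (adj (V j) x) \<bullet> V k (adj (V k) x))"
    by (simp only: power2_norm_eq_inner inner_sum_left inner_sum_right) (rule sum.swap)
  also have "\<dots> = (\<Sum>j\<in>F. \<Sum>k\<in>F. if j = k then (norm (V j (adj (V j) x)))\<^sup>2 else 0)"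
    by (intro sum.cong refl) (auto simp: power2_norm_eq_inner orth')
  also have "\<dots> = (\<Sum>j\<in>F. (norm (V j (adj (V j) x)))\<^sup>2)"
    using \<open>finite F\<close> by simp
  also have "\<dots> \<le> ?b"
    by (intro sum_mono power_mono contr) auto
  finally have y_le: "(norm ?y)\<^sup>2 \<le> ?b" .
  have b_eq: "?b = ?y \<bullet> x"
    by (simp add: inner_sum_left power2_norm_eq_inner adj_inner')
  have "?b\<^sup>2 \<le> (norm ?y)\<^sup>2 * (norm x)\<^sup>2"
    unfolding b_eq power_mult_distrib[symmetric]
    by (rule power2_le_iff_abs_le[THEN iffD2]) (auto simp: Cauchy_Schwarz_ineq2)
  also have "\<dots> \<le> ?b * (norm x)\<^sup>2"
    by (intro mult_right_mono y_le) auto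
  finally have "?b * ?b \<le> ?b * (norm x)\<^sup>2" by (simp add: power2_eq_square)
  moreover have "?b \<ge> 0" by (intro sum_nonneg) auto
  ultimately show ?thesis by (cases "?b = 0") (auto simp: mult_le_cancel_left)
qed

lemma col_bessel: "finite F \<Longrightarrow> (\<Sum>j\<in>F. (norm (col j f))\<^sup>2) \<le> (norm f)\<^sup>2"
  using bessel[of emb F f] by (simp add: col_emb)

text \<open>The operator whose \<open>j\<close>-th column is \<open>C j\<close>. It exists as soon as the norms of the columns satisfy a
  Bessel inequality. Amplifications and the adjoint of the row operator are built this way.\<close>

definition stack :: "('j \<Rightarrow> ('h ell2 \<Rightarrow>\<^sub>L 'i ell2)) \<Rightarrow> ('h ell2 \<Rightarrow>\<^sub>L ('i \<times> 'j) ell2)" where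
  "stack C = (SOME R. \<forall>j. col j o\<^sub>L R = C j)"

lemma stack_exists:
  fixes C :: "'j \<Rightarrow> ('h ell2 \<Rightarrow>\<^sub>L 'i ell2)"
  assumes bound: "\<And>F f. finite F \<Longrightarrow> (\<Sum>j\<in>F. (norm (C j f))\<^sup>2) \<le> (K * norm f)\<^sup>2" and "K \<ge> 0"
  shows "\<exists>R. (\<forall>j. col j o\<^sub>L R = C j) \<and> norm R \<le> K"
proof -
  have "\<exists>g. (\<forall>p. ell2_nth g p = ell2_nth (C (snd p) f) (fst p)) \<and> (norm g)\<^sup>2 \<le> (K * norm f)\<^sup>2" for f
  proof (rule ell2_exists[where h = "\<lambda>p. ell2_nth (C (snd p) f) (fst p)" and C = "(K * norm f)\<^sup>2"])
    fix F :: "('i \<times> 'j) set" assume F: "finite F"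
    let ?h = "\<lambda>p. (cmod (ell2_nth (C (snd p) f) (fst p)))\<^sup>2"
    have "sum ?h F \<le> sum ?h (fst ` F \<times> snd ` F)"
      using F by (intro sum_mono2) (auto simp: rev_image_eqI)
    also have "\<dots> = (\<Sum>j\<in>snd ` F. \<Sum>i\<in>fst ` F. (cmod (ell2_nth (C j f) i))\<^sup>2)"
      by (subst sum.swap) (simp add: sum.cartesian_product split_def)
    also have "\<dots> \<le> (\<Sum>j\<in>snd ` F. (norm (C j f))\<^sup>2)"
      using F by (intro sum_mono ell2_sum_le_norm_square) auto
    also have "\<dots> \<le> (K * norm f)\<^sup>2"
      using F by (intro bound) auto
    finally show "sum ?h F \<le> (K * norm f)\<^sup>2" .
  qed blast
  then obtain R where R: "\<And>f p. ell2_nth (R f) p = ell2_nth (C (snd p) f) (fst p)"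
      and R_bound: "\<And>f. (norm (R f))\<^sup>2 \<le> (K * norm f)\<^sup>2"
    by metis
  have R_le: "norm (R f) \<le> K * norm f" for f
    using R_bound[of f] \<open>K \<ge> 0\<close> by (auto intro: power2_le_imp_le)
  have app: "blinfun_apply (Blinfun R) = R"
    by (rule blinfun_exists[OF _ _ R_le])
      (auto intro!: ell2_eqI simp: R blinfun.add_right blinfun.scaleR_right)
  show ?thesis
    by (rule exI[of _ "Blinfun R"])
      (auto intro!: blinfun_eqI ell2_eqI norm_blinfun_bound simp: app R R_le \<open>K \<ge> 0\<close>)
qed

lemma
  fixes C :: "'j \<Rightarrow> ('h ell2 \<Rightarrow>\<^sub>L 'i ell2)"
  assumes "\<And>F f. finite F \<Longrightarrow> (\<Sum>j\<in>F. (norm (C j f))\<^sup>2) \<le> (K * norm f)\<^sup>2" and "K \<ge> 0"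
  shows col_stack: "col j o\<^sub>L stack C = C j"
    and norm_stack_le: "norm (stack C) \<le> K"
proof -
  obtain R where R: "\<forall>j. col j o\<^sub>L R = C j" "norm R \<le> K"
    using stack_exists[OF assms] by blast
  have stack: "\<forall>j. col j o\<^sub>L stack C = C j"
    unfolding stack_def by (rule someI[of _ R]) (rule R)
  then show "col j o\<^sub>L stack C = C j" by blast
  have "stack C = R"
    using R stack by (intro blinfun_eq_by_col) simp
  then show "norm (stack C) \<le> K" using R by simp
qed

lemma clin_by_col:
  fixes R :: "'h ell2 \<Rightarrow>\<^sub>L ('i \<times> 'j) ell2"
  assumes "\<And>j. clin (col j o\<^sub>L R)"
  shows "clin R"
proof (intro clinI ell2_eq_by_col)
  fix c f j
  show "col j (R (ell2_scaleC c f)) = col j (ell2_scaleC c (R f))"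
    using clin_apply[OF assms, of j c f] by (simp add: clin_apply[OF clin_col])
qed


section \<open>Tensor products of operators\<close>

text \<open>The operators \<open>X \<otimes> 1\<close> and \<open>1 \<otimes> T\<close>.\<close>

definition left_amp :: "('i ell2 \<Rightarrow>\<^sub>L 'i ell2) \<Rightarrow> (('i \<times> 'j) ell2 \<Rightarrow>\<^sub>L ('i \<times> 'j) ell2)" where
  "left_amp X = stack (\<lambda>j. X o\<^sub>L col j)"

definition right_amp :: "('j ell2 \<Rightarrow>\<^sub>L 'j ell2) \<Rightarrow> (('i \<times> 'j) ell2 \<Rightarrow>\<^sub>L ('i \<times> 'j) ell2)" where
  "right_amp T = swap_op o\<^sub>L left_amp T o\<^sub>L swap_op"

lemma left_amp_bound:
  assumes "finite F"
  shows "(\<Sum>j\<in>F. (norm ((X o\<^sub>L col j) f))\<^sup>2) \<le> (norm X * norm f)\<^sup>2"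
proof -
  have "(\<Sum>j\<in>F. (norm ((X o\<^sub>L col j) f))\<^sup>2) \<le> (\<Sum>j\<in>F. (norm X)\<^sup>2 * (norm (col j f))\<^sup>2)"
    by (intro sum_mono) (simp add: norm_blinfun power_mono flip: power_mult_distrib)
  also have "\<dots> \<le> (norm X)\<^sup>2 * (norm f)\<^sup>2"
    unfolding sum_distrib_left[symmetric] using col_bessel[OF assms]
    by (intro mult_left_mono) auto
  finally show ?thesis by (simp add: power_mult_distrib)
qed

lemma col_left_amp: "col j o\<^sub>L left_amp X = X o\<^sub>L col j"
  unfolding left_amp_def by (rule col_stack[OF left_amp_bound]) auto

lemma col_left_amp_apply [simp]: "col j (left_amp X f) = X (col j f)"
  using arg_cong[OF col_left_amp, of "\<lambda>T. blinfun_apply T f" j X] by simp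

lemma norm_left_amp: "norm (left_amp X) \<le> norm X"
  unfolding left_amp_def by (rule norm_stack_le[OF left_amp_bound]) auto

lemma norm_left_amp_apply: "norm (left_amp X f) \<le> norm X * norm f"
  by (rule order_trans[OF norm_blinfun mult_right_mono[OF norm_left_amp norm_ge_zero]])

lemma left_amp_diff: "left_amp (X - Y) = left_amp X - left_amp Y"
  by (intro blinfun_eqI ell2_eq_by_col) (simp add: blinfun.diff_left blinfun.diff_right)

lemma clin_left_amp: "clin X \<Longrightarrow> clin (left_amp X)"
  by (rule clin_by_col) (simp add: col_left_amp clin_compose clin_col)

lemma left_amp_emb: "left_amp X o\<^sub>L emb j = emb j o\<^sub>L X"
proof (rule blinfun_eq_by_col)
  fix k
  show "col k o\<^sub>L (left_amp X o\<^sub>L emb j) = col k o\<^sub>L (emb j o\<^sub>L X)"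
    unfolding compose_assoc[symmetric] col_left_amp
    by (simp add: compose_assoc col_emb) (auto intro!: blinfun_eqI)
qed

lemma norm_right_amp:
  fixes T :: "'j ell2 \<Rightarrow>\<^sub>L 'j ell2"
  shows "norm (right_amp T :: ('i \<times> 'j) ell2 \<Rightarrow>\<^sub>L ('i \<times> 'j) ell2) \<le> norm T"
proof (rule norm_blinfun_bound)
  fix f :: "('i \<times> 'j) ell2"
  have "norm (right_amp T f) \<le> norm (left_amp T (swap_op f))"
    by (simp add: right_amp_def norm_swap_op)
  also have "\<dots> \<le> norm T * norm (swap_op f)"
    by (rule norm_left_amp_apply)
  also have "\<dots> \<le> norm T * norm f"
    by (intro mult_left_mono norm_swap_op) auto
  finally show "norm (right_amp T f) \<le> norm T * norm f" .
qed simp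

lemma right_amp_diff: "right_amp (S - T) = right_amp S - right_amp T"
  by (rule blinfun_eqI) (simp add: right_amp_def left_amp_diff blinfun.diff_left blinfun.diff_right)

lemma clin_right_amp: "clin T \<Longrightarrow> clin (right_amp T)"
  unfolding right_amp_def by (intro clin_compose clin_left_amp clin_swap_op)

lemma ell2_nth_tensor [simp]: "ell2_nth (ell2_tensor f g) (i, j) = ell2_nth f i * ell2_nth g j"
proof -
  let ?h = "\<lambda>(i, j). ell2_nth f i * ell2_nth g j"
  have "\<exists>x. \<forall>p. ell2_nth x p = ?h p"
  proof (rule ell2_exists[where h = ?h and C = "(norm f)\<^sup>2 * (norm g)\<^sup>2"])
    fix F :: "('a \<times> 'b) set" assume F: "finite F"
    have "(\<Sum>p\<in>F. (cmod (?h p))\<^sup>2) \<le> (\<Sum>p\<in>fst ` F \<times> snd ` F. (cmod (?h p))\<^sup>2)"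
      using F by (intro sum_mono2) (auto simp: rev_image_eqI)
    also have "\<dots> = (\<Sum>i\<in>fst ` F. (cmod (ell2_nth f i))\<^sup>2) * (\<Sum>j\<in>snd ` F. (cmod (ell2_nth g j))\<^sup>2)"
      by (simp add: sum_product sum.cartesian_product split_def norm_mult power_mult_distrib)
    also have "\<dots> \<le> (norm f)\<^sup>2 * (norm g)\<^sup>2"
      using F by (intro mult_mono ell2_sum_le_norm_square) (auto intro: sum_nonneg)
    finally show "(\<Sum>p\<in>F. (cmod (?h p))\<^sup>2) \<le> (norm f)\<^sup>2 * (norm g)\<^sup>2" .
  qed auto
  then obtain x where x: "ell2_nth x = ?h" by blast
  then have "ell2_tensor f g = x"
    unfolding ell2_tensor_def by (metis ell2_nth_inverse)
  then show ?thesis using x by simp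
qed

lemma left_amp_tensor: "left_amp X (ell2_tensor f g) = ell2_tensor (X f) g" if "clin X"
proof (rule ell2_eq_by_col)
  fix j
  have *: "col j (ell2_tensor f' g) = ell2_scaleC (ell2_nth g j) f'" for f' :: "'a ell2"
    by (rule ell2_eqI) simp
  show "col j (left_amp X (ell2_tensor f g)) = col j (ell2_tensor (X f) g)"
    by (simp add: * clin_apply[OF that])
qed

lemma swap_op_tensor: "swap_op (ell2_tensor f g) = ell2_tensor g f"
  by (rule ell2_eqI) (auto simp: mult.commute)

lemma tensor_unit: "ell2_tensor (ell2_unit i) (ell2_unit j) = ell2_unit (i, j)"
  by (rule ell2_eqI) (auto split: if_splits)

text \<open>Elementary tensors of basis vectors are the basis vectors of the product, so a
  complex-linear operator is determined by its values on elementary tensors.\<close>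

lemma op_tensor_unique:
  fixes S :: "'i ell2 \<Rightarrow>\<^sub>L 'i ell2" and T :: "'j ell2 \<Rightarrow>\<^sub>L 'j ell2"
  assumes "clin R" "\<And>f g. blinfun_apply R (ell2_tensor f g) = ell2_tensor (S f) (T g)"
  shows "op_tensor S T = R"
  unfolding op_tensor_def
proof (rule the_equality)
  fix R' assume R': "R' \<in> carrier bounded_ops \<and>
    (\<forall>f g. blinfun_apply R' (ell2_tensor f g) = ell2_tensor (S f) (T g))"
  show "R' = R"
  proof (rule clin_eq_on_units)
    show "R' (ell2_unit p) = R (ell2_unit p)" for p
      using R' assms by (cases p) (metis tensor_unit)
  qed (use R' assms in auto)
qed (use assms in simp)

lemma op_tensor_eq_amp:
  assumes "clin S" "clin T"
  shows "op_tensor S T = left_amp S o\<^sub>L right_amp T"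
proof (rule op_tensor_unique)
  show "clin (left_amp S o\<^sub>L right_amp T)"
    by (intro clin_compose clin_left_amp clin_right_amp assms)
  show "(left_amp S o\<^sub>L right_amp T) (ell2_tensor f g) = ell2_tensor (S f) (T g)" for f g
    by (simp add: right_amp_def left_amp_tensor assms swap_op_tensor)
qed

lemma norm_ell2_unit [simp]: "norm (ell2_unit j) = 1"
  using inner_ell2_scaleC_unit[of 1 j "ell2_unit j"] by (simp add: norm_eq_sqrt_inner)

lemma norm_ell2_nth_le: "cmod (ell2_nth f k) \<le> norm f"
  using ell2_sum_le_norm_square[of "{k}" f] by (auto intro: power2_le_imp_le)

lemma matrix_unit_apply [simp]: "matrix_unit j k f = ell2_scaleC (ell2_nth f k) (ell2_unit j)"
  unfolding matrix_unit_def
proof (rule fun_cong[OF blinfun_exists[of _ 1]])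
  show "norm (ell2_scaleC (ell2_nth f k) (ell2_unit j)) \<le> 1 * norm f" for f :: "'a ell2"
    by (simp add: norm_scaleC norm_ell2_nth_le)
qed (auto simp: scaleC_add_left intro!: ell2_eqI)

lemma clin_matrix_unit: "clin (matrix_unit j k)"
  by (rule clinI) (simp add: mult.commute)

lemma op_tensor_matrix_unit:
  fixes S :: "'i ell2 \<Rightarrow>\<^sub>L 'i ell2" and j k :: 'j
  assumes "clin S"
  shows "op_tensor S (matrix_unit j k) = emb j o\<^sub>L S o\<^sub>L col k"
proof (rule op_tensor_unique)
  show "clin (emb j o\<^sub>L S o\<^sub>L col k)"
    by (intro clin_compose clin_emb clin_col assms)
  fix f :: "'i ell2" and g :: "'j ell2"
  have "col k (ell2_tensor f g) = ell2_scaleC (ell2_nth g k) f"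
    by (rule ell2_eqI) simp
  then show "(emb j o\<^sub>L S o\<^sub>L col k) (ell2_tensor f g) = ell2_tensor (S f) (matrix_unit j k g)"
    by (auto intro!: ell2_eqI simp: clin_apply[OF assms])
qed


section \<open>Compact operators as limits of finite matrices\<close>

definition trunc :: "nat \<Rightarrow> nat ell2 \<Rightarrow>\<^sub>L nat ell2" where
  "trunc n = (\<Sum>i<n. matrix_unit i i)"

lemma clin_sum: "(\<And>i. i \<in> F \<Longrightarrow> clin (f i)) \<Longrightarrow> clin (\<Sum>i\<in>F. f i)"
  by (induction F rule: infinite_finite_induct) (auto intro: clin_add clin_zero)

lemma trunc_nth [simp]: "ell2_nth (trunc n f) i = (if i < n then ell2_nth f i else 0)"
  by (simp add: trunc_def blinfun.sum_left sum.delta mult_if_delta if_distrib cong: if_cong)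

lemma trunc_tendsto: "(\<lambda>n. trunc n f) \<longlonglongrightarrow> f"
proof -
  have "((\<lambda>n. \<Sum>i<n. ell2_scaleC (ell2_nth f i) (ell2_unit i)) \<longlongrightarrow> f) sequentially"
    by (rule filterlim_compose[OF ell2_truncation_tendsto filterlim_lessThan_at_top])
  then show ?thesis by (simp add: trunc_def blinfun.sum_left)
qed

lemma norm_trunc_le: "norm (f - trunc n f) \<le> norm f"
proof (rule ell2_norm_bound)
  fix F :: "nat set" assume F: "finite F"
  have "(\<Sum>i\<in>F. (cmod (ell2_nth (f - trunc n f) i))\<^sup>2) \<le> (\<Sum>i\<in>F. (cmod (ell2_nth f i))\<^sup>2)"
    by (intro sum_mono) auto
  also have "\<dots> \<le> (norm f)\<^sup>2" by (rule ell2_sum_le_norm_square[OF F])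
  finally show "(\<Sum>i\<in>F. (cmod (ell2_nth (f - trunc n f) i))\<^sup>2) \<le> (norm f)\<^sup>2" .
qed simp

lemma adj_trunc [simp]: "adj (trunc n) = trunc n"
proof (rule adj_unique)
  fix f g
  have "trunc n f \<bullet> g = (\<Sum>\<^sub>\<infinity>i. (if i < n then ell2_nth f i else 0) \<bullet> ell2_nth g i)"
    by (simp add: ell2_inner_eq)
  also have "\<dots> = (\<Sum>\<^sub>\<infinity>i. ell2_nth f i \<bullet> (if i < n then ell2_nth g i else 0))"
    by (rule infsum_cong) auto
  finally show "trunc n f \<bullet> g = f \<bullet> trunc n g" by (simp add: ell2_inner_eq)
qed

text \<open>Strong convergence of contractions is uniform on compact sets.\<close>

lemma trunc_uniform_on_compact:
  assumes "compact C" "e > 0"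
  shows "\<exists>n0. \<forall>n\<ge>n0. \<forall>y\<in>C. norm (y - trunc n y) < e"
proof -
  obtain k where k: "finite k" "C \<subseteq> (\<Union>x\<in>k. ball x (e/2))"
    using assms unfolding compact_eq_totally_bounded by (meson half_gt_zero)
  have "\<forall>x\<in>k. \<exists>n0. \<forall>n\<ge>n0. norm (x - trunc n x) < e/2"
  proof
    fix x
    have "(\<lambda>n. norm (x - trunc n x)) \<longlonglongrightarrow> norm (x - x)"
      by (intro tendsto_intros trunc_tendsto)
    then show "\<exists>n0. \<forall>n\<ge>n0. norm (x - trunc n x) < e/2"
      using order_tendstoD(2)[of _ "norm (x - x)" sequentially "e/2"] assms(2)
      by (simp add: eventually_sequentially)
  qed
  then obtain n0 where n0: "\<And>x n. x \<in> k \<Longrightarrow> n \<ge> n0 x \<Longrightarrow> norm (x - trunc n x) < e/2" by metis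
  show ?thesis
  proof (intro exI[of _ "Max (insert 0 (n0 ` k))"] allI impI ballI)
    fix n y assume n: "Max (insert 0 (n0 ` k)) \<le> n" and "y \<in> C"
    then obtain x where x: "x \<in> k" "dist x y < e/2" using k by (auto simp: ball_def)
    have "n0 x \<le> n" using n x k by auto
    \<comment> \<open>The first summand is small because \<open>1 - trunc n\<close> is a contraction, the second one because
      \<open>x\<close> is one of the finitely many centres.\<close>
    have "y - trunc n y = ((y - x) - trunc n (y - x)) + (x - trunc n x)"
      by (simp add: blinfun.diff_right)
    then have "norm (y - trunc n y) \<le> norm ((y - x) - trunc n (y - x)) + norm (x - trunc n x)"
      by (metis norm_triangle_ineq)
    also have "\<dots> < e/2 + e/2"
      using norm_trunc_le[of "y - x" n] x(2) n0[OF x(1) \<open>n0 x \<le> n\<close>]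
      by (simp add: dist_norm norm_minus_commute)
    finally show "norm (y - trunc n y) < e" by simp
  qed
qed

text \<open>Truncating the range of a compact operator \<open>T\<close> works by uniform convergence on the compact
  closure of the image of the unit ball. Truncating the domain is reduced to this for \<open>T\<^sup>* T\<close>, since
  \<open>\<parallel>T (1 - p)\<parallel>\<^sup>2 \<le> \<parallel>(1 - p) T\<^sup>* T\<parallel>\<close> for a projection \<open>p\<close>.\<close>

lemma compact_op_approx:
  fixes T :: "nat ell2 \<Rightarrow>\<^sub>L nat ell2"
  assumes compact: "compact (closure (blinfun_apply T ` cball 0 1))" and e: "e > 0"
  shows "\<exists>n. norm (T - (trunc n o\<^sub>L T o\<^sub>L trunc n)) < e"
proof -
  let ?C = "closure (blinfun_apply T ` cball 0 1)"
  have in_C: "T f \<in> ?C" if "norm f \<le> 1" for f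
    using that closure_subset by (fastforce simp: image_iff)
  have compact': "compact (adj T ` ?C)"
    by (rule compact_continuous_image[OF _ compact]) (intro continuous_intros)
  obtain n1 where n1: "\<And>n y. n \<ge> n1 \<Longrightarrow> y \<in> ?C \<Longrightarrow> norm (y - trunc n y) < e/4"
    using trunc_uniform_on_compact[OF compact, of "e/4"] e by auto
  obtain n2 where n2: "\<And>n y. n \<ge> n2 \<Longrightarrow> y \<in> ?C \<Longrightarrow> norm (adj T y - trunc n (adj T y)) < (e/4)\<^sup>2"
    using trunc_uniform_on_compact[OF compact', of "(e/4)\<^sup>2"] e by auto
  define n where "n = max n1 n2"
  have unit_bound: "norm (T f - trunc n (T (trunc n f))) \<le> e/2" if f: "norm f \<le> 1" for f
  proof -
    let ?g = "f - trunc n f"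
    have g: "norm ?g \<le> 1" using norm_trunc_le[of f n] f by simp
    have trunc_g: "trunc n ?g = 0" by (rule ell2_eqI) auto
    have "(norm (T ?g))\<^sup>2 = adj T (T ?g) \<bullet> ?g - trunc n (adj T (T ?g)) \<bullet> ?g"
      using adj_inner[of "trunc n" "adj T (T ?g)" ?g]
      by (simp add: norm_square_adj trunc_g del: blinfun.diff_right)
    also have "\<dots> \<le> norm (adj T (T ?g) - trunc n (adj T (T ?g))) * norm ?g"
      by (simp add: inner_diff_left[symmetric] norm_cauchy_schwarz)
    also have "\<dots> \<le> (e/4)\<^sup>2 * 1"
      using n2[OF _ in_C[OF g], of n] g by (intro mult_mono) (auto simp: n_def)
    finally have Tg: "norm (T ?g) \<le> e/4"
      using e by (auto intro: power2_le_imp_le)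
    have tf: "norm (trunc n f) \<le> 1"
      by (rule order_trans[OF _ f], rule ell2_norm_bound)
        (auto intro!: order_trans[OF sum_mono ell2_sum_le_norm_square])
    have "T f - trunc n (T (trunc n f)) = T ?g + (T (trunc n f) - trunc n (T (trunc n f)))"
      by (simp add: blinfun.diff_right)
    also have "norm \<dots> \<le> e/4 + e/4"
      using Tg n1[OF _ in_C[OF tf], of n] by (intro norm_triangle_le) (auto simp: n_def)
    finally show ?thesis by simp
  qed
  have "norm (T - (trunc n o\<^sub>L T o\<^sub>L trunc n)) \<le> e/2"
  proof (rule norm_blinfun_bound)
    fix f :: "nat ell2"
    show "norm ((T - (trunc n o\<^sub>L T o\<^sub>L trunc n)) f) \<le> e/2 * norm f"
    proof (cases "f = 0")
      case False
      let ?R = "T - (trunc n o\<^sub>L T o\<^sub>L trunc n)" and ?g = "inverse (norm f) *\<^sub>R f"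
      have "?R f = norm f *\<^sub>R ?R ?g"
        using False by (simp only: blinfun.scaleR_right) simp
      moreover have "norm (?R ?g) \<le> e/2"
        using unit_bound[of ?g] False by (simp add: blinfun.diff_left)
      ultimately show ?thesis
        using mult_left_mono[of "norm (?R ?g)" "e/2" "norm f"] by (simp add: mult.commute)
    qed simp
  qed (use e in simp)
  then show ?thesis using e by (intro exI[of _ n]) simp
qed

lemma trunc_compose_trunc:
  assumes "clin T"
  shows "trunc n o\<^sub>L T o\<^sub>L trunc n
    = (\<Sum>j<n. \<Sum>k<n. cscale (ell2_nth (T (ell2_unit k)) j) o\<^sub>L matrix_unit j k)"
proof (rule clin_eq_on_units)
  show "clin (trunc n o\<^sub>L T o\<^sub>L trunc n)"
    unfolding trunc_def by (intro clin_compose clin_sum clin_matrix_unit assms)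
  show "clin (\<Sum>j<n. \<Sum>k<n. cscale (ell2_nth (T (ell2_unit k)) j) o\<^sub>L matrix_unit j k)"
    by (intro clin_compose clin_sum clin_matrix_unit clin_cscale)
  fix i :: nat
  have m: "matrix_unit j k (ell2_unit i) = (if k = i then ell2_unit j else 0)" for j k :: nat
    by (rule ell2_eqI) auto
  have t: "trunc n (ell2_unit i) = (if i < n then ell2_unit i else 0)"
    by (rule ell2_eqI) auto
  show "(trunc n o\<^sub>L T o\<^sub>L trunc n) (ell2_unit i)
      = (\<Sum>j<n. \<Sum>k<n. cscale (ell2_nth (T (ell2_unit k)) j) o\<^sub>L matrix_unit j k) (ell2_unit i)"
    by (rule ell2_eqI)
      (auto simp: t m blinfun.sum_left if_distrib[where f = "ell2_scaleC _"]
        if_distrib[where f = "\<lambda>x. ell2_nth x _"] if_distrib[where f = "(*) _"] simp del: matrix_unit_apply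
        cong: if_cong)
qed

lemma matrix_unit_in_compact_ops: "matrix_unit j k \<in> carrier compact_ops"
proof -
  let ?u = "\<lambda>c. ell2_scaleC c (ell2_unit j)"
  have "bounded_linear ?u"
    by (rule bounded_linear_intro[of _ "norm (ell2_unit j)"])
      (auto simp: norm_scaleC scaleC_add_left intro!: ell2_eqI)
  then have cont: "continuous_on (cball 0 1) ?u"
    by (rule linear_continuous_on)
  have "compact (?u ` cball 0 1)"
    by (rule compact_continuous_image[OF cont]) simp
  moreover have "matrix_unit j k ` cball 0 1 \<subseteq> ?u ` cball 0 1"
  proof (rule image_subsetI)
    fix f :: "'a ell2" assume "f \<in> cball 0 1"
    then have "ell2_nth f k \<in> cball 0 1"
      using norm_ell2_nth_le[of f k] by simp
    then show "matrix_unit j k f \<in> ?u ` cball 0 1" by simp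
  qed
  ultimately have "compact (closure (matrix_unit j k ` cball 0 1))"
    by (metis closed_closure closure_minimal compact_Int_closed compact_imp_closed inf.absorb_iff2)
  then show ?thesis by (simp add: compact_ops_def clin_matrix_unit)
qed


section \<open>Polynomials in a self-adjoint element\<close>

text \<open>For a self-adjoint element \<open>a\<close> of a unital C*-algebra, read \<open>\<nu> p\<close> as \<open>\<parallel>p(a)\<parallel>\<close>. The statements of
  this part concern the commutative algebra generated by \<open>a\<close> and are proved for polynomials, so that
  they apply to the abstract C*-norm and to the operator norm alike. The last condition is the C*-identity
  for \<open>p(a) + \<i> q(a)\<close>, whose real part is \<open>p(a)\<close>.\<close>

locale poly_seminorm =
  fixes \<nu> :: "real poly \<Rightarrow> real"
  assumes add: "\<nu> (p + q) \<le> \<nu> p + \<nu> q"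
    and mult: "\<nu> (p * q) \<le> \<nu> p * \<nu> q"
    and smult: "\<nu> (smult c p) = \<bar>c\<bar> * \<nu> p"
    and one: "\<nu> 1 \<le> 1"
    and square: "(\<nu> p)\<^sup>2 \<le> \<nu> (p\<^sup>2 + q\<^sup>2)"
begin

lemma zero [simp]: "\<nu> 0 = 0"
  using smult[of 0 0] by simp

lemma minus [simp]: "\<nu> (- p) = \<nu> p"
  using smult[of "-1" p] by simp

lemma nonneg: "0 \<le> \<nu> p"
  using add[of p "- p"] by simp

lemma diff: "\<nu> (p - q) \<le> \<nu> p + \<nu> q"
  using add[of p "- q"] by simp

lemma sum: "\<nu> (\<Sum>x\<in>F. f x) \<le> (\<Sum>x\<in>F. \<nu> (f x))"
proof (induction F rule: infinite_finite_induct)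
  case (insert x F)
  then show ?case using add[of "f x" "sum f F"] by simp
qed auto

lemma power: "\<nu> (p ^ n) \<le> \<nu> p ^ n"
proof (induction n)
  case (Suc n)
  have "\<nu> (p ^ Suc n) \<le> \<nu> p * \<nu> (p ^ n)" using mult[of p "p ^ n"] by simp
  also have "\<dots> \<le> \<nu> p * \<nu> p ^ n" by (intro mult_left_mono Suc nonneg)
  finally show ?case by simp
qed (simp add: one)

lemma power_two_power: "\<nu> p ^ (2 ^ m) \<le> \<nu> (p ^ (2 ^ m))"
proof (induction m)
  case (Suc m)
  have "\<nu> p ^ (2 ^ Suc m) = (\<nu> p ^ (2 ^ m))\<^sup>2" by (simp add: power_even_eq)
  also have "\<dots> \<le> (\<nu> (p ^ (2 ^ m)))\<^sup>2" by (intro power_mono Suc zero_le_power nonneg)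
  also have "\<dots> \<le> \<nu> ((p ^ (2 ^ m))\<^sup>2)" using square[of "p ^ (2 ^ m)" 0] by simp
  also have "(p ^ (2 ^ m))\<^sup>2 = p ^ (2 ^ Suc m)" by (simp add: power_even_eq)
  finally show ?case .
qed simp

lemma nonneg_coeffs_bound:
  assumes X: "\<nu> [:0, 1:] \<le> 1" and p: "\<And>i. coeff p i \<ge> 0"
  shows "\<nu> p \<le> poly p 1"
proof -
  have monom: "\<nu> (monom c i) \<le> \<bar>c\<bar>" for c i
  proof -
    have "\<nu> (monom c i) = \<bar>c\<bar> * \<nu> ([:0, 1:] ^ i)"
      by (simp add: monom_altdef smult)
    also have "\<dots> \<le> \<bar>c\<bar> * 1"
      using power[of "[:0,1:]" i] power_le_one[OF nonneg X, of i] by (intro mult_left_mono) auto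
    finally show ?thesis by simp
  qed
  have "\<nu> p = \<nu> (\<Sum>i\<le>degree p. monom (coeff p i) i)"
    by (simp add: poly_as_sum_of_monoms)
  also have "\<dots> \<le> (\<Sum>i\<le>degree p. \<nu> (monom (coeff p i) i))" by (rule sum)
  also have "\<dots> \<le> (\<Sum>i\<le>degree p. \<bar>coeff p i\<bar>)" by (intro sum_mono monom)
  also have "\<dots> = poly p 1" by (simp add: poly_altdef p)
  finally show ?thesis .
qed

end

text \<open>An iteration for \<open>w = 1 - \<surd>(1 - x\<^sup>2)\<close>, the fixed point of \<open>w = (x\<^sup>2 + w\<^sup>2) / 2\<close>. All
  increments have nonnegative coefficients, so their seminorms are bounded by their values at 1,
  and the latter sum up to at most 1. Hence the iteration converges in every C*-algebra as soon as
  \<open>\<parallel>a\<parallel> \<le> 1\<close>.\<close>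

primrec sqrt_iter :: "nat \<Rightarrow> real poly" where
  "sqrt_iter 0 = 0"
| "sqrt_iter (Suc n) = smult (1/2) ([:0, 1:]\<^sup>2 + (sqrt_iter n)\<^sup>2)"

lemma coeff_mult_nonneg:
  assumes "\<And>i. coeff p i \<ge> 0" "\<And>i. coeff q i \<ge> (0::real)"
  shows "coeff (p * q) i \<ge> 0"
  unfolding coeff_mult by (intro sum_nonneg mult_nonneg_nonneg assms)

lemma sqrt_iter_diff_Suc:
  "sqrt_iter (Suc (Suc n)) - sqrt_iter (Suc n)
    = smult (1/2) ((sqrt_iter (Suc n) - sqrt_iter n) * (sqrt_iter (Suc n) + sqrt_iter n))"
  unfolding sqrt_iter.simps(2)[of "Suc n"] sqrt_iter.simps(2)[of n]
    smult_diff_right[symmetric] by (rule arg_cong[of _ _ "smult (1/2)"]) (simp add: power2_eq_square algebra_simps)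

lemma sqrt_iter_coeffs:
  "coeff (sqrt_iter n) i \<ge> 0 \<and> coeff (sqrt_iter (Suc n) - sqrt_iter n) i \<ge> 0"
proof (induction n arbitrary: i)
  case 0
  show ?case by (auto simp: power2_eq_square coeff_pCons split: nat.splits)
next
  case (Suc n)
  have *: "coeff (sqrt_iter (Suc n)) i \<ge> 0" for i
    using Suc[of i] by simp
  have "coeff (sqrt_iter (Suc n) + sqrt_iter n) i \<ge> 0" for i
    using * Suc by simp
  then show ?case
    using * coeff_mult_nonneg[of "sqrt_iter (Suc n) - sqrt_iter n" "sqrt_iter (Suc n) + sqrt_iter n" i] Suc
    unfolding sqrt_iter_diff_Suc by simp
qed

lemma sqrt_iter_at_1: "0 \<le> poly (sqrt_iter n) 1 \<and> poly (sqrt_iter n) 1 \<le> 1"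
proof (induction n)
  case (Suc n)
  then have "(poly (sqrt_iter n) 1)\<^sup>2 \<le> 1" by (simp add: power_le_one)
  then show ?case by simp
qed simp

lemma sqrt_iter_at_1_mono: "incseq (\<lambda>n. poly (sqrt_iter n) 1)"
proof (rule incseq_SucI)
  fix n
  have "poly (sqrt_iter (Suc n) - sqrt_iter n) 1 \<ge> 0"
    unfolding poly_altdef using sqrt_iter_coeffs by (intro sum_nonneg) auto
  then show "poly (sqrt_iter n) 1 \<le> poly (sqrt_iter (Suc n)) 1" by simp
qed

lemma sqrt_iter_at_1_convergent: "convergent (\<lambda>n. poly (sqrt_iter n) 1)"
  by (rule incseq_convergent[OF sqrt_iter_at_1_mono, of 1])
    (use sqrt_iter_at_1 in \<open>auto simp: convergent_def\<close>)

lemma sqrt_iter_identity: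
  "[:0, 1:]\<^sup>2 + (1 - sqrt_iter n)\<^sup>2 - 1 = smult 2 (sqrt_iter (Suc n) - sqrt_iter n)"
  by (simp add: smult_diff_right power2_eq_square algebra_simps numeral_poly flip: smult_add_left)

text \<open>A bound for the distance of \<open>x + \<i> (1 - w\<^sub>n)\<close> from being unitary.\<close>

definition unitary_error :: "nat \<Rightarrow> real" where
  "unitary_error n = 2 * (poly (sqrt_iter (Suc n)) 1 - poly (sqrt_iter n) 1)"

lemma unitary_error_tendsto: "unitary_error \<longlonglongrightarrow> 0"
proof -
  obtain l where l: "(\<lambda>n. poly (sqrt_iter n) 1) \<longlonglongrightarrow> l"
    using sqrt_iter_at_1_convergent by (auto simp: convergent_def)
  have "(\<lambda>n. 2 * (poly (sqrt_iter (Suc n)) 1 - poly (sqrt_iter n) 1)) \<longlonglongrightarrow> 2 * (l - l)"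
    by (intro tendsto_intros l LIMSEQ_Suc[OF l])
  then show ?thesis by (simp add: unitary_error_def[abs_def])
qed

context poly_seminorm
begin

text \<open>The increments have nonnegative coefficients, which turns convergence at the point 1 into
  convergence in the seminorm.\<close>

lemma sqrt_iter_Cauchy:
  assumes "\<nu> [:0, 1:] \<le> 1" "m \<le> n"
  shows "\<nu> (sqrt_iter n - sqrt_iter m) \<le> poly (sqrt_iter n) 1 - poly (sqrt_iter m) 1"
proof -
  have "coeff (sqrt_iter n - sqrt_iter m) i \<ge> 0" for i
    using assms(2)
  proof (induction rule: dec_induct)
    case (step n)
    then show ?case using sqrt_iter_coeffs[of n i] by (simp del: sqrt_iter.simps)
  qed simp
  from nonneg_coeffs_bound[OF assms(1) this] show ?thesis by simp
qed

lemma sqrt_iter_error: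
  assumes "\<nu> [:0, 1:] \<le> 1"
  shows "\<nu> ([:0, 1:]\<^sup>2 + (1 - sqrt_iter n)\<^sup>2 - 1) \<le> unitary_error n"
  using sqrt_iter_Cauchy[OF assms, of n "Suc n"]
  unfolding sqrt_iter_identity smult unitary_error_def by (simp del: sqrt_iter.simps)

end


section \<open>Chebyshev polynomials\<close>

fun cheb :: "nat \<Rightarrow> real poly" where
  "cheb 0 = 1"
| "cheb (Suc 0) = [:0, 1:]"
| "cheb (Suc (Suc k)) = smult 2 ([:0, 1:] * cheb (Suc k)) - cheb k"

lemma poly_cheb_cos: "poly (cheb k) (cos t) = cos (real k * t)"
proof (induction k rule: cheb.induct)
  case (3 k)
  have "cos (real (Suc (Suc k)) * t) = 2 * (cos t * cos (real (Suc k) * t)) - cos (real k * t)"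
  proof -
    have "cos (real (Suc (Suc k)) * t) = cos (real (Suc k) * t + t)"
      and "cos (real k * t) = cos (real (Suc k) * t - t)"
      by (simp_all add: algebra_simps)
    then show ?thesis by (simp only: cos_add cos_diff) simp
  qed
  then show ?case by (simp only: cheb.simps poly_diff poly_smult poly_mult 3) simp
qed auto

text \<open>With \<open>s = 1 - w\<^sub>n\<close>, the pair below consists of the real and imaginary part of \<open>(x + \<i> s)\<^sup>k\<close>.
  Since \<open>x\<^sup>2 + s\<^sup>2\<close> is close to 1, the element \<open>x + \<i> s\<close> is almost unitary and the real part of its
  \<open>k\<close>-th power is almost \<open>cheb k\<close>.\<close>

primrec upow :: "nat \<Rightarrow> nat \<Rightarrow> real poly \<times> real poly" where
  "upow n 0 = (1, 0)"
| "upow n (Suc k) = ([:0, 1:] * fst (upow n k) - (1 - sqrt_iter n) * snd (upow n k),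
     (1 - sqrt_iter n) * fst (upow n k) + [:0, 1:] * snd (upow n k))"

lemma upow_square:
  "(fst (upow n k))\<^sup>2 + (snd (upow n k))\<^sup>2 = ([:0, 1:]\<^sup>2 + (1 - sqrt_iter n)\<^sup>2) ^ k"
proof (induction k)
  case (Suc k)
  have "(x * p - s * q)\<^sup>2 + (s * p + x * q)\<^sup>2 = (x\<^sup>2 + s\<^sup>2) * (p\<^sup>2 + q\<^sup>2)" for x s p q :: "real poly"
    by (simp add: power2_eq_square algebra_simps)
  then show ?case using Suc by (simp only: upow.simps fst_conv snd_conv power_Suc)
qed simp

lemma smult_two: "smult 2 p = p + (p :: real poly)"
  using smult_add_left[of 1 1 p] by simp

lemma upow_rec:
  "fst (upow n (Suc (Suc k))) = smult 2 ([:0, 1:] * fst (upow n (Suc k)))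
    - (1 + ([:0, 1:]\<^sup>2 + (1 - sqrt_iter n)\<^sup>2 - 1)) * fst (upow n k)"
proof -
  have "x * (x * p - s * q) - s * (s * p + x * q) = smult 2 (x * (x * p - s * q)) - (1 + (x\<^sup>2 + s\<^sup>2 - 1)) * p"
    for x s p q :: "real poly"
    unfolding smult_two by (simp add: power2_eq_square algebra_simps)
  then show ?thesis by (simp only: upow.simps fst_conv snd_conv)
qed

context poly_seminorm
begin

lemma upow_bound:
  assumes X: "\<nu> [:0, 1:] \<le> 1"
  shows "\<nu> (fst (upow n k)) \<le> sqrt ((1 + unitary_error n) ^ k)"
proof (rule real_le_rsqrt)
  let ?d = "[:0, 1:]\<^sup>2 + (1 - sqrt_iter n)\<^sup>2 - 1"
  have "(\<nu> (fst (upow n k)))\<^sup>2 \<le> \<nu> ((1 + ?d) ^ k)"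
    using square[of "fst (upow n k)" "snd (upow n k)"] by (simp add: upow_square)
  also have "\<dots> \<le> \<nu> (1 + ?d) ^ k" by (rule power)
  also have "\<dots> \<le> (1 + unitary_error n) ^ k"
    using add[of 1 ?d] one sqrt_iter_error[OF X, of n] by (intro power_mono nonneg) linarith
  finally show "(\<nu> (fst (upow n k)))\<^sup>2 \<le> (1 + unitary_error n) ^ k" .
qed

lemma upow_tendsto_cheb:
  assumes X: "\<nu> [:0, 1:] \<le> 1"
  shows "(\<lambda>n. \<nu> (fst (upow n k) - cheb k)) \<longlonglongrightarrow> 0"
proof (induction k rule: cheb.induct)
  case (3 k)
  let ?D = "\<lambda>n k. fst (upow n k) - cheb k"
  let ?d = "\<lambda>n. [:0, 1:]\<^sup>2 + (1 - sqrt_iter n)\<^sup>2 - 1"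
  have bound: "\<nu> (?D n (Suc (Suc k)))
      \<le> 2 * \<nu> (?D n (Suc k)) + \<nu> (?D n k) + unitary_error n * (\<nu> (?D n k) + \<nu> (cheb k))" for n
  proof -
    have eq: "?D n (Suc (Suc k)) = smult 2 ([:0, 1:] * ?D n (Suc k)) - ?D n k - ?d n * fst (upow n k)"
      unfolding upow_rec cheb.simps smult_two
      by (simp only: distrib_left distrib_right right_diff_distrib mult_1_left)
    have "\<nu> (?D n (Suc (Suc k)))
        \<le> \<nu> (smult 2 ([:0, 1:] * ?D n (Suc k))) + \<nu> (?D n k) + \<nu> (?d n * fst (upow n k))"
      unfolding eq by (rule order_trans[OF diff add_right_mono[OF diff]])
    moreover have "\<nu> (smult 2 ([:0, 1:] * ?D n (Suc k))) \<le> 2 * (1 * \<nu> (?D n (Suc k)))"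
      unfolding smult using order_trans[OF mult mult_right_mono[OF X nonneg]] by auto
    moreover have "\<nu> (?d n * fst (upow n k)) \<le> unitary_error n * (\<nu> (?D n k) + \<nu> (cheb k))"
    proof (rule order_trans[OF mult], rule mult_mono)
      show "\<nu> (?d n) \<le> unitary_error n" by (rule sqrt_iter_error[OF X])
      then show "0 \<le> unitary_error n" using nonneg[of "?d n"] by linarith
      show "\<nu> (fst (upow n k)) \<le> \<nu> (?D n k) + \<nu> (cheb k)"
        using add[of "?D n k" "cheb k"] by simp
    qed (rule nonneg)
    ultimately show ?thesis by linarith
  qed
  have lim: "(\<lambda>n. 2 * \<nu> (?D n (Suc k)) + \<nu> (?D n k) + unitary_error n * (\<nu> (?D n k) + \<nu> (cheb k)))
      \<longlonglongrightarrow> 2 * 0 + 0 + 0 * (0 + \<nu> (cheb k))"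
    by (intro tendsto_intros 3 unitary_error_tendsto)
  have zero_eq: "2 * 0 + 0 + 0 * (0 + \<nu> (cheb k)) = 0" by simp
  show ?case
  proof (rule tendsto_sandwich[OF _ _ tendsto_const])
    show "eventually (\<lambda>n. 0 \<le> \<nu> (?D n (Suc (Suc k)))) sequentially"
      by (intro always_eventually allI nonneg)
    show "eventually (\<lambda>n. \<nu> (?D n (Suc (Suc k)))
        \<le> 2 * \<nu> (?D n (Suc k)) + \<nu> (?D n k) + unitary_error n * (\<nu> (?D n k) + \<nu> (cheb k))) sequentially"
      by (intro always_eventually allI bound)
  qed (rule lim[unfolded zero_eq])
qed auto

text \<open>The estimate for the almost unitary powers is inherited by their limit.\<close>

lemma cheb_bound:
  assumes X: "\<nu> [:0, 1:] \<le> 1"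
  shows "\<nu> (cheb k) \<le> 1"
proof -
  have "(\<lambda>n. sqrt ((1 + unitary_error n) ^ k) + \<nu> (fst (upow n k) - cheb k)) \<longlonglongrightarrow> sqrt ((1 + 0) ^ k) + 0"
    by (intro tendsto_intros unitary_error_tendsto upow_tendsto_cheb[OF X])
  moreover have "\<nu> (cheb k) \<le> sqrt ((1 + unitary_error n) ^ k) + \<nu> (fst (upow n k) - cheb k)" for n
    using diff[of "fst (upow n k)" "fst (upow n k) - cheb k"] upow_bound[OF X, of n k] by simp
  ultimately show ?thesis
    by (intro LIMSEQ_le_const[of _ 1]) auto
qed

end

text \<open>The polynomials spanned by the first Chebyshev polynomials. They turn out to be all
  polynomials of degree at most \<open>n\<close>, since multiplication by \<open>x\<close> raises the index by at most one.\<close>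

definition cheb_comb :: "nat \<Rightarrow> real poly \<Rightarrow> bool" where
  "cheb_comb n p \<longleftrightarrow> (\<exists>c. p = (\<Sum>k\<le>n. smult (c k) (cheb k)))"

lemma smult_sum_right: "smult a (\<Sum>x\<in>F. f x) = (\<Sum>x\<in>F. smult a (f x))"
  by (induction F rule: infinite_finite_induct) (auto simp: smult_add_right)

lemma cheb_comb_add:
  assumes "cheb_comb n p" "cheb_comb n q"
  shows "cheb_comb n (p + q)"
proof -
  obtain c d where "p = (\<Sum>k\<le>n. smult (c k) (cheb k))" "q = (\<Sum>k\<le>n. smult (d k) (cheb k))"
    using assms by (auto simp: cheb_comb_def)
  then have "p + q = (\<Sum>k\<le>n. smult (c k + d k) (cheb k))"
    by (simp add: smult_add_left sum.distrib)
  then show ?thesis unfolding cheb_comb_def by (rule exI[of _ "\<lambda>k. c k + d k"])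
qed

lemma cheb_comb_smult: "cheb_comb n p \<Longrightarrow> cheb_comb n (smult a p)"
  unfolding cheb_comb_def
proof (elim exE)
  fix c assume "p = (\<Sum>k\<le>n. smult (c k) (cheb k))"
  then have "smult a p = (\<Sum>k\<le>n. smult (a * c k) (cheb k))" by (simp add: smult_sum_right)
  then show "\<exists>c. smult a p = (\<Sum>k\<le>n. smult (c k) (cheb k))" by (rule exI[of _ "\<lambda>k. a * c k"])
qed

lemma cheb_comb_cheb: "k \<le> n \<Longrightarrow> cheb_comb n (cheb k)"
  unfolding cheb_comb_def
  by (rule exI[of _ "\<lambda>i. if i = k then 1 else 0"])
    (simp add: if_distrib[of "\<lambda>c. smult c _"] cong: if_cong)

lemma cheb_comb_sum: "(\<And>x. x \<in> F \<Longrightarrow> cheb_comb n (f x)) \<Longrightarrow> cheb_comb n (\<Sum>x\<in>F. f x)"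
proof (induction F rule: infinite_finite_induct)
  case empty
  show ?case using cheb_comb_smult[OF cheb_comb_cheb[of 0 n], of 0] by simp
qed (use cheb_comb_smult[OF cheb_comb_cheb[of 0 n], of 0] in \<open>auto intro: cheb_comb_add\<close>)

lemma cheb_comb_degree: "degree p \<le> n \<Longrightarrow> cheb_comb n p"
proof (induction n arbitrary: p)
  case 0
  then obtain a where "p = smult a (cheb 0)" using degree_eq_zeroE[of p] by auto
  then show ?case using cheb_comb_smult[OF cheb_comb_cheb[of 0 0]] by simp
next
  case (Suc n)
  obtain a q where p: "p = pCons a q" by (rule pCons_cases)
  then have "degree q \<le> n" using Suc.prems by (cases "q = 0") auto
  then obtain c where q: "q = (\<Sum>k\<le>n. smult (c k) (cheb k))"
    using Suc.IH by (auto simp: cheb_comb_def)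
  have X: "cheb_comb (Suc n) ([:0, 1:] * cheb k)" if "k \<le> n" for k
  proof (cases k)
    case 0
    then show ?thesis using cheb_comb_cheb[of 1 "Suc n"] by simp
  next
    case (Suc j)
    have "[:0, 1:] * cheb k = smult (1/2) (cheb (Suc (Suc j)) + cheb j)"
      by (simp add: Suc)
    then show ?thesis
      using that Suc by (simp only:) (intro cheb_comb_smult cheb_comb_add cheb_comb_cheb; simp)
  qed
  have "p = smult a (cheb 0) + (\<Sum>k\<le>n. smult (c k) ([:0, 1:] * cheb k))"
  proof -
    have "p = smult a (cheb 0) + [:0, 1:] * q" by (simp add: p)
    then show ?thesis by (simp only: q sum_distrib_left mult_smult_right)
  qed
  then show ?case
    by (simp only:) (intro cheb_comb_add cheb_comb_sum cheb_comb_smult cheb_comb_cheb X; simp)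
qed

lemma has_integral_cos_int:
  fixes j :: int
  shows "((\<lambda>t. cos (of_int j * t)) has_integral (if j = 0 then 2 * pi else 0)) {0..2*pi}"
proof (cases "j = 0")
  case True
  then show ?thesis using has_integral_const_real[of "1::real" 0 "2 * pi"] by simp
next
  case False
  have "((\<lambda>t. cos (of_int j * t)) has_integral
      sin (of_int j * (2*pi)) / of_int j - sin (of_int j * 0) / of_int j) {0..2*pi}"
  proof (rule fundamental_theorem_of_calculus)
    show "((\<lambda>t. sin (of_int j * t) / of_int j) has_vector_derivative cos (of_int j * t)) (at t within {0..2*pi})" for t
      unfolding has_real_derivative_iff_has_vector_derivative[symmetric]
      using False by (auto intro!: derivative_eq_intros)
  qed simp
  moreover have "sin (of_int j * (2*pi)) = 0"
    using sin_zero_iff_int2[of "of_int j * (2*pi)"] by (metis mult.assoc of_int_mult of_int_numeral)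
  ultimately show ?thesis using False by simp
qed

lemma cos_orthogonal:
  "((\<lambda>t. cos (real k * t) * cos (real m * t)) has_integral
    (if k = m then (if k = 0 then 2 * pi else pi) else 0)) {0..2*pi}"
proof -
  have "cos (real k * t) * cos (real m * t)
      = (cos (of_int (int k - int m) * t) + cos (of_int (int k + int m) * t)) / 2" for t
    by (simp add: cos_times_cos algebra_simps)
  moreover have "((\<lambda>t. (cos (of_int (int k - int m) * t) + cos (of_int (int k + int m) * t)) / 2) has_integral
     ((if int k - int m = 0 then 2 * pi else 0) + (if int k + int m = 0 then 2 * pi else 0)) / 2) {0..2*pi}"
    by (intro has_integral_divide has_integral_add has_integral_cos_int)
  moreover have "((if int k - int m = 0 then 2 * pi else 0) + (if int k + int m = 0 then 2 * pi else 0)) / 2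
      = (if k = m then (if k = 0 then 2 * pi else pi) else 0)"
    by auto
  ultimately show ?thesis by (simp only:)
qed

text \<open>The coefficients of a Chebyshev expansion are Fourier coefficients of \<open>t \<mapsto> p (cos t)\<close>.\<close>

lemma cheb_coeff_bound:
  assumes p: "p = (\<Sum>k\<le>n. smult (c k) (cheb k))"
    and M: "\<And>x. \<bar>x\<bar> \<le> 1 \<Longrightarrow> \<bar>poly p x\<bar> \<le> M" and m: "m \<le> n"
  shows "\<bar>c m\<bar> \<le> 2 * M"
proof -
  have "((\<lambda>t. \<Sum>k\<le>n. c k * (cos (real k * t) * cos (real m * t))) has_integral
      (\<Sum>k\<le>n. c k * (if k = m then (if k = 0 then 2 * pi else pi) else 0))) {0..2*pi}"
    by (intro has_integral_sum has_integral_mult_right cos_orthogonal) auto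
  moreover have "(\<Sum>k\<le>n. c k * (cos (real k * t) * cos (real m * t))) = poly p (cos t) * cos (real m * t)" for t
    by (simp add: p poly_sum poly_cheb_cos sum_distrib_right mult.assoc)
  moreover have "(\<Sum>k\<le>n. c k * (if k = m then (if k = 0 then 2 * pi else pi) else 0))
      = c m * (if m = 0 then 2 * pi else pi)"
    using m by (simp add: if_distrib[of "(*) _"] cong: if_cong)
  ultimately have int: "((\<lambda>t. poly p (cos t) * cos (real m * t)) has_integral c m * (if m = 0 then 2 * pi else pi)) {0..2*pi}"
    by simp
  have "M \<ge> 0" using M[of 0] by linarith
  have "norm (c m * (if m = 0 then 2 * pi else pi)) \<le> M * measure lborel {0..2*pi}"
  proof (rule has_integral_bound_real[OF \<open>M \<ge> 0\<close> finite.emptyI int])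
    fix t :: real
    have "\<bar>poly p (cos t)\<bar> * \<bar>cos (real m * t)\<bar> \<le> M * 1"
      using \<open>M \<ge> 0\<close> by (intro mult_mono M) auto
    then show "norm (poly p (cos t) * cos (real m * t)) \<le> M" by (simp add: abs_mult)
  qed
  then have *: "\<bar>c m\<bar> * (if m = 0 then 2 * pi else pi) \<le> 2 * pi * M"
    by (simp add: abs_mult ac_simps split: if_splits)
  have "\<bar>c m\<bar> * pi \<le> \<bar>c m\<bar> * (if m = 0 then 2 * pi else pi)"
    by (intro mult_left_mono) auto
  also note *
  also have "2 * pi * M = (2 * M) * pi" by simp
  finally have "\<bar>c m\<bar> * pi \<le> (2 * M) * pi" .
  then show ?thesis by (rule mult_right_le_imp_le) simp
qed


section \<open>The spectral bound\<close>

context poly_seminorm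
begin

lemma crude_bound:
  assumes X: "\<nu> [:0, 1:] \<le> 1" and M: "\<And>x. \<bar>x\<bar> \<le> 1 \<Longrightarrow> \<bar>poly p x\<bar> \<le> M" and n: "degree p \<le> n"
  shows "\<nu> p \<le> 2 * M * (real n + 1)"
proof -
  obtain c where c: "p = (\<Sum>k\<le>n. smult (c k) (cheb k))"
    using cheb_comb_degree[OF n] by (auto simp: cheb_comb_def)
  have "\<nu> p \<le> (\<Sum>k\<le>n. \<nu> (smult (c k) (cheb k)))" unfolding c by (rule sum)
  also have "\<dots> \<le> (\<Sum>k\<le>n. 2 * M)"
  proof (rule sum_mono)
    fix k assume "k \<in> {..n}"
    then have "\<bar>c k\<bar> \<le> 2 * M" using cheb_coeff_bound[OF c M] by simp
    then show "\<nu> (smult (c k) (cheb k)) \<le> 2 * M"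
      using mult_mono[OF _ cheb_bound[OF X, of k] _ nonneg, of "\<bar>c k\<bar>" "2 * M"] by (simp add: smult)
  qed
  finally show ?thesis by (simp add: algebra_simps)
qed

text \<open>Applying the crude bound to the powers \<open>p ^ N\<close> with \<open>N = 2 ^ m\<close>, whose seminorms are
  \<open>\<nu> p ^ N\<close>, removes the factor that depends on the degree, because it grows only linearly in \<open>N\<close>.\<close>

lemma unit_interval_bound:
  assumes X: "\<nu> [:0, 1:] \<le> 1" and M: "\<And>x. \<bar>x\<bar> \<le> 1 \<Longrightarrow> \<bar>poly p x\<bar> \<le> M"
  shows "\<nu> p \<le> M"
proof (rule ccontr)
  assume "\<not> \<nu> p \<le> M"
  moreover have "M \<ge> 0" using M[of 0] by linarith
  ultimately obtain L where L: "M < L" "L < \<nu> p" "0 < L"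
    by (metis dense not_le order_le_less_trans)
  \<comment> \<open>Exponential growth of \<open>q ^ N\<close> will contradict the linear bound.\<close>
  define q where "q = \<nu> p / L"
  have q: "q > 1" using L by (simp add: q_def)
  let ?d = "real (degree p)"
  have bound: "q ^ (2 ^ m) \<le> 2 * (?d * real (2 ^ m) + 1)" for m
  proof -
    let ?N = "2 ^ m :: nat"
    have "\<nu> p ^ ?N \<le> \<nu> (p ^ ?N)" by (rule power_two_power)
    also have "\<dots> \<le> 2 * L ^ ?N * (real (degree p * ?N) + 1)"
    proof (rule crude_bound[OF X])
      fix x :: real assume "\<bar>x\<bar> \<le> 1"
      then have "\<bar>poly p x\<bar> \<le> L" using M[of x] L by linarith
      then show "\<bar>poly (p ^ ?N) x\<bar> \<le> L ^ ?N"
        by (simp add: poly_power power_abs power_mono)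
    qed (rule degree_power_le)
    finally show ?thesis using L by (simp add: q_def power_divide divide_le_eq algebra_simps)
  qed
  have "eventually (\<lambda>n::nat. q ^ n > 2 * (?d * real n + 1)) at_top"
    using q by real_asymp
  then obtain n0 where n0: "\<And>n. n \<ge> n0 \<Longrightarrow> q ^ n > 2 * (?d * real n + 1)"
    by (auto simp: eventually_at_top_linorder)
  have "n0 \<le> 2 ^ n0" by (simp add: less_imp_le)
  from n0[OF this] bound[of n0] show False by simp
qed

text \<open>Rescaling the variable reduces the interval \<open>[-r, r]\<close> to the unit interval.\<close>

lemma interval_bound:
  assumes X: "\<nu> [:0, 1:] \<le> r" and r: "r > 0" and M: "\<And>x. \<bar>x\<bar> \<le> r \<Longrightarrow> \<bar>poly p x\<bar> \<le> M"
  shows "\<nu> p \<le> M"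
proof -
  let ?\<nu> = "\<lambda>p. \<nu> (p \<circ>\<^sub>p [:0, 1/r:])"
  interpret scaled: poly_seminorm ?\<nu>
  proof
    show "(?\<nu> p)\<^sup>2 \<le> ?\<nu> (p\<^sup>2 + q\<^sup>2)" for p q
      using square by (simp add: power2_eq_square pcompose_add pcompose_mult)
  qed (auto simp: pcompose_add pcompose_mult pcompose_smult add mult smult one pcompose_1)
  have "[:0, 1:] \<circ>\<^sub>p [:0, 1/r:] = smult (1/r) [:0, 1:]" by (simp add: pcompose_pCons)
  then have X': "?\<nu> [:0, 1:] \<le> 1" using X r by (simp only: smult) simp
  have "?\<nu> (p \<circ>\<^sub>p [:0, r:]) \<le> M"
  proof (rule scaled.unit_interval_bound[OF X'])
    fix x :: real assume "\<bar>x\<bar> \<le> 1"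
    then have "\<bar>x * r\<bar> \<le> r" using r by (simp add: abs_mult)
    then show "\<bar>poly (p \<circ>\<^sub>p [:0, r:]) x\<bar> \<le> M" using M by (simp add: poly_pcompose)
  qed
  moreover have "[:0, r:] \<circ>\<^sub>p [:0, 1/r:] = [:0, 1:]" using r by (simp add: pcompose_pCons)
  ultimately show ?thesis by (simp flip: pcompose_assoc add: pcompose_idR)
qed

end

lemma weierstrass_poly:
  fixes g :: "real \<Rightarrow> real"
  assumes "continuous_on {-1..1} g" "e > 0"
  obtains p :: "real poly" where "\<And>x. \<bar>x\<bar> \<le> 1 \<Longrightarrow> \<bar>g x - poly p x\<bar> < e"
proof -
  obtain f where f: "real_polynomial_function f" "\<And>x. x \<in> {-1..1} \<Longrightarrow> \<bar>g x - f x\<bar> < e"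
    using Stone_Weierstrass_real_polynomial_function[OF _ assms] by auto
  obtain a n where "f = (\<lambda>x. \<Sum>i\<le>n. a i * x ^ i)"
    using f(1) by (auto simp: real_polynomial_function_iff_sum)
  then have "f x = poly (\<Sum>i\<le>n. monom (a i) i) x" for x
    by (simp add: poly_sum poly_monom)
  with f(2) show ?thesis by (intro that[of "\<Sum>i\<le>n. monom (a i) i"]) (metis abs_le_iff atLeastAtMost_iff minus_le_iff)
qed


section \<open>Operator algebras representing C*-algebras\<close>

lemma compose_add_left: "(S + T) o\<^sub>L X = (S o\<^sub>L X) + (T o\<^sub>L X)"
  by (rule blinfun_eqI) (simp add: blinfun.add_left)

lemma compose_add_right: "X o\<^sub>L (S + T) = (X o\<^sub>L S) + (X o\<^sub>L T)"
  by (rule blinfun_eqI) (simp add: blinfun.add_left blinfun.add_right)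

lemma compose_diff_left: "(S - T) o\<^sub>L X = (S o\<^sub>L X) - (T o\<^sub>L X)"
  by (rule blinfun_eqI) (simp add: blinfun.diff_left)

lemma compose_diff_right: "X o\<^sub>L (S - T) = (X o\<^sub>L S) - (X o\<^sub>L T)"
  by (rule blinfun_eqI) (simp add: blinfun.diff_left blinfun.diff_right)

lemma compose_scaleR_left: "(r *\<^sub>R S) o\<^sub>L X = r *\<^sub>R (S o\<^sub>L X)"
  by (rule blinfun_eqI) (simp add: blinfun.scaleR_left)

lemma compose_scaleR_right: "X o\<^sub>L (r *\<^sub>R S) = r *\<^sub>R (X o\<^sub>L S)"
  by (rule blinfun_eqI) (simp add: blinfun.scaleR_left blinfun.scaleR_right)

lemmas compose_distribs = compose_add_left compose_add_right compose_diff_left compose_diff_right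
  compose_scaleR_left compose_scaleR_right

lemma cscale_of_real: "cscale (of_real r) o\<^sub>L X = r *\<^sub>R X"
  by (rule blinfun_eqI) (simp add: scaleC_of_real blinfun.scaleR_left)

abbreviation op_alg :: "('k ell2 \<Rightarrow>\<^sub>L 'k ell2) set \<Rightarrow> ('k ell2 \<Rightarrow>\<^sub>L 'k ell2) cstar_alg" where
  "op_alg S \<equiv> bounded_ops\<lparr>carrier := S\<rparr>"

text \<open>A *-algebra of operators. For the image of a faithful representation, closedness in the operator
  norm is a theorem (\<open>closed_in_operator_norm\<close>) and so cannot be part of the notion.\<close>

locale op_star_algebra =
  fixes S :: "('k ell2 \<Rightarrow>\<^sub>L 'k ell2) set"
  assumes clin: "X \<in> S \<Longrightarrow> clin X"
    and zero: "0 \<in> S"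
    and add: "\<lbrakk>X \<in> S; Y \<in> S\<rbrakk> \<Longrightarrow> X + Y \<in> S"
    and compose: "\<lbrakk>X \<in> S; Y \<in> S\<rbrakk> \<Longrightarrow> X o\<^sub>L Y \<in> S"
    and adj: "X \<in> S \<Longrightarrow> adj X \<in> S"
    and cscale: "X \<in> S \<Longrightarrow> cscale c o\<^sub>L X \<in> S"
begin

lemma scaleR: "X \<in> S \<Longrightarrow> r *\<^sub>R X \<in> S"
  using cscale[of X "of_real r"] by (simp add: cscale_of_real)

lemma minus: "X \<in> S \<Longrightarrow> - X \<in> S"
  using scaleR[of X "-1"] by simp

lemma diff: "\<lbrakk>X \<in> S; Y \<in> S\<rbrakk> \<Longrightarrow> X - Y \<in> S"
  using add[of X "- Y"] minus[of Y] by simp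

end

text \<open>An object \<open>B\<close> of the category together with a *-isomorphism from an operator algebra. All computations
  take place in the operator algebra, where composition is associative and distributive without
  membership conditions. The C*-norm of \<open>B\<close> is transported to the function \<open>N\<close> on operators.\<close>

locale represented = op_star_algebra S for S :: "('k ell2 \<Rightarrow>\<^sub>L 'k ell2) set" +
  fixes \<theta> :: "('k ell2 \<Rightarrow>\<^sub>L 'k ell2) \<Rightarrow> 'u" and B :: "'u cstar_alg"
  assumes cstar: "cstar_algebra B" and iso: "\<theta> \<in> star_iso (op_alg S) B"
begin

sublocale cstar_algebra B by (rule cstar)

definition pre :: "'u \<Rightarrow> ('k ell2 \<Rightarrow>\<^sub>L 'k ell2)" where
  "pre = inv_into S \<theta>"

lemma bij: "bij_betw \<theta> S (carrier B)"
  using iso by (simp add: star_iso_def)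

lemma map_closed [simp]: "X \<in> S \<Longrightarrow> \<theta> X \<in> carrier B"
  using bij bij_betwE by blast

lemma pre_map [simp]: "X \<in> S \<Longrightarrow> pre (\<theta> X) = X"
  using bij by (simp add: pre_def bij_betw_inv_into_left)

lemma map_back [simp]: "b \<in> carrier B \<Longrightarrow> \<theta> (pre b) = b"
  using bij by (simp add: pre_def bij_betw_inv_into_right)

lemma pre_closed [simp]: "b \<in> carrier B \<Longrightarrow> pre b \<in> S"
  using bij by (simp add: pre_def bij_betw_def inv_into_into)

lemma map_eq_iff: "X \<in> S \<Longrightarrow> Y \<in> S \<Longrightarrow> \<theta> X = \<theta> Y \<longleftrightarrow> X = Y"
  by (metis pre_map)

lemma map_add: "X \<in> S \<Longrightarrow> Y \<in> S \<Longrightarrow> \<theta> (X + Y) = aplus B (\<theta> X) (\<theta> Y)"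
  and map_compose: "X \<in> S \<Longrightarrow> Y \<in> S \<Longrightarrow> \<theta> (X o\<^sub>L Y) = amult B (\<theta> X) (\<theta> Y)"
  and map_cscale: "X \<in> S \<Longrightarrow> \<theta> (cscale c o\<^sub>L X) = ascale B c (\<theta> X)"
  using iso by (auto simp: star_iso_def star_hom_def)

lemma map_adj: "X \<in> S \<Longrightarrow> \<theta> (adj X) = astar B (\<theta> X)"
  using iso by (auto simp: star_iso_def star_hom_def adjoint_op_eq_adj[OF clin])

lemma map_diff: "X \<in> S \<Longrightarrow> Y \<in> S \<Longrightarrow> \<theta> (X - Y) = aminus B (\<theta> X) (\<theta> Y)"
  using map_add[of X "cscale (-1) o\<^sub>L Y"] map_cscale[of Y "-1"] cscale[of Y "-1"]
    cscale_of_real[of "-1" Y]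
  by (simp add: aminus_def)

lemma map_zero: "\<theta> 0 = azero B"
proof -
  have "\<theta> (0 - 0) = azero B"
    by (simp only: map_diff zero) (simp add: aminus_def plus_minus zero)
  then show ?thesis by simp
qed

lemma pre_add: "a \<in> carrier B \<Longrightarrow> b \<in> carrier B \<Longrightarrow> pre (aplus B a b) = pre a + pre b"
  by (metis add pre_closed pre_map map_add map_back)

lemma pre_mult: "a \<in> carrier B \<Longrightarrow> b \<in> carrier B \<Longrightarrow> pre (amult B a b) = pre a o\<^sub>L pre b"
  by (metis compose pre_closed pre_map map_compose map_back)

lemma pre_scale: "a \<in> carrier B \<Longrightarrow> pre (ascale B c a) = cscale c o\<^sub>L pre a"
  by (metis cscale pre_closed pre_map map_cscale map_back)

lemma pre_star: "a \<in> carrier B \<Longrightarrow> pre (astar B a) = adj (pre a)"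
  by (metis adj pre_closed pre_map map_adj map_back)

lemma pre_zero: "pre (azero B) = 0"
  using pre_map[OF zero] by (simp add: map_zero)

definition N :: "('k ell2 \<Rightarrow>\<^sub>L 'k ell2) \<Rightarrow> real" where
  "N X = anorm B (\<theta> X)"

lemma N_zero_iff: "X \<in> S \<Longrightarrow> N X = 0 \<longleftrightarrow> X = 0"
  by (metis N_def map_closed map_eq_iff map_zero norm_zero_iff zero)

lemma N_zero [simp]: "N 0 = 0"
  by (simp add: N_zero_iff zero)

lemma N_add: "X \<in> S \<Longrightarrow> Y \<in> S \<Longrightarrow> N (X + Y) \<le> N X + N Y"
  by (simp add: N_def map_add norm_triangle)

lemma N_compose: "X \<in> S \<Longrightarrow> Y \<in> S \<Longrightarrow> N (X o\<^sub>L Y) \<le> N X * N Y"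
  by (simp add: N_def map_compose norm_submult)

lemma N_cscale: "X \<in> S \<Longrightarrow> N (cscale c o\<^sub>L X) = cmod c * N X"
  by (simp add: N_def map_cscale norm_scale)

lemma N_scaleR: "X \<in> S \<Longrightarrow> N (r *\<^sub>R X) = \<bar>r\<bar> * N X"
  using N_cscale[of X "of_real r"] by (simp add: cscale_of_real)

lemma N_minus [simp]: "X \<in> S \<Longrightarrow> N (- X) = N X"
  using N_scaleR[of X "-1"] by simp

lemma N_nonneg: "X \<in> S \<Longrightarrow> 0 \<le> N X"
  using N_add[of X "- X"] by (simp add: minus)

lemma N_diff: "X \<in> S \<Longrightarrow> Y \<in> S \<Longrightarrow> N (X - Y) \<le> N X + N Y"
  using N_add[of X "- Y"] by (simp add: minus)

lemma N_diff_commute: "X \<in> S \<Longrightarrow> Y \<in> S \<Longrightarrow> N (X - Y) = N (Y - X)"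
  using N_minus[of "X - Y"] by (simp add: diff)

lemma N_adj_compose: "X \<in> S \<Longrightarrow> N (adj X o\<^sub>L X) = (N X)\<^sup>2"
  by (simp add: N_def map_compose map_adj adj cstar_identity)

lemma N_adj: "X \<in> S \<Longrightarrow> N (adj X) = N X"
proof -
  have le: "N X \<le> N (adj X)" if X: "X \<in> S" for X
  proof (cases "N X = 0")
    case False
    have "N X * N X \<le> N (adj X) * N X"
      using N_adj_compose[OF X] N_compose[OF adj[OF X] X] by (simp add: power2_eq_square)
    then show ?thesis using False N_nonneg[OF X] by (simp add: mult_le_cancel_right)
  qed (use X N_nonneg adj in auto)
  show "X \<in> S \<Longrightarrow> N (adj X) = N X"
    using le[of X] le[of "adj X"] by (simp add: adj)
qed

lemma N_complete:
  assumes "\<And>n. X n \<in> S" "\<And>e. e > 0 \<Longrightarrow> \<exists>k. \<forall>m\<ge>k. \<forall>n\<ge>k. N (X m - X n) < e"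
  shows "\<exists>L\<in>S. (\<lambda>n. N (X n - L)) \<longlonglongrightarrow> 0"
proof -
  have "\<exists>L\<in>carrier B. (\<lambda>n. anorm B (aminus B (\<theta> (X n)) L)) \<longlonglongrightarrow> 0"
    by (rule complete) (use assms in \<open>auto simp: N_def map_diff\<close>)
  then obtain L where L: "L \<in> carrier B" "(\<lambda>n. anorm B (aminus B (\<theta> (X n)) L)) \<longlonglongrightarrow> 0"
    by blast
  show ?thesis
    by (rule bexI[of _ "pre L"]) (use L assms(1) in \<open>simp_all add: N_def map_diff\<close>)
qed

text \<open>Computing the norm of \<open>X\<close> from that of \<open>X\<^sup>* X X\<^sup>*\<close> allows to estimate it by testing against
  elements of the algebra on both sides.\<close>

lemma N_le_by_testing:
  assumes X: "X \<in> S" and YGZ: "Y \<in> S" "G \<in> S" "Z \<in> S"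
    and eq: "adj X o\<^sub>L (X o\<^sub>L adj X) = Y o\<^sub>L (G o\<^sub>L Z)" and le: "N Y \<le> N X" "N Z \<le> N X"
  shows "N X \<le> N G"
proof (cases "N X = 0")
  case True
  then show ?thesis using N_nonneg YGZ by simp
next
  case False
  then have pos: "N X > 0" using N_nonneg[OF X] by simp
  let ?c = "adj X o\<^sub>L (X o\<^sub>L adj X)"
  have c: "?c \<in> S" by (intro compose adj X)
  have "(N X)\<^sup>2 * (N X)\<^sup>2 = N (adj (adj X o\<^sub>L X) o\<^sub>L (adj X o\<^sub>L X))"
    using N_adj_compose[OF compose[OF adj[OF X] X]] N_adj_compose[OF X] by (simp add: power2_eq_square)
  also have "\<dots> = N (?c o\<^sub>L X)" by (simp add: compose_assoc)
  also have "\<dots> \<le> N ?c * N X" by (rule N_compose[OF c X])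
  also have "N ?c \<le> N Y * N (G o\<^sub>L Z)"
    unfolding eq by (intro N_compose compose YGZ)
  also have "\<dots> \<le> N Y * (N G * N Z)"
    by (intro mult_left_mono N_compose N_nonneg YGZ)
  also have "\<dots> \<le> N X * (N G * N X)"
    by (intro mult_mono le mult_nonneg_nonneg N_nonneg YGZ X order_refl)
  finally have "(N X)\<^sup>2 * (N X)\<^sup>2 \<le> N X * (N G * N X) * N X"
    using pos by (simp add: mult_right_mono)
  then have "N X * (N X * N X * N X) \<le> N G * (N X * N X * N X)"
    by (simp add: power2_eq_square ac_simps)
  then show ?thesis by (rule mult_right_le_imp_le) (use pos in simp)
qed

end

text \<open>A *-subalgebra that is complete in the inherited norm is again an object of the category.\<close>

lemma represented_subalgebra:
  assumes "represented S \<theta> B" and M: "op_star_algebra M" "M \<subseteq> S"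
    and M_complete: "\<And>X. \<lbrakk>\<And>n. X n \<in> M; \<And>e. e > 0 \<Longrightarrow> \<exists>k. \<forall>m\<ge>k. \<forall>n\<ge>k. represented.N \<theta> B (X m - X n) < e\<rbrakk>
      \<Longrightarrow> \<exists>L\<in>M. (\<lambda>n. represented.N \<theta> B (X n - L)) \<longlonglongrightarrow> 0"
  shows "represented M (restrict \<theta> M) (B\<lparr>carrier := \<theta> ` M\<rparr>)"
proof -
  interpret represented S \<theta> B by fact
  interpret M: op_star_algebra M by fact
  have S: "X \<in> M \<Longrightarrow> X \<in> S" for X using M(2) by blast
  have sub: "x \<in> \<theta> ` M \<Longrightarrow> x \<in> carrier B" for x using S by auto
  have plus: "aplus B x y \<in> \<theta> ` M" if "x \<in> \<theta> ` M" "y \<in> \<theta> ` M" for x y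
    using that S by (auto simp: map_add[symmetric] intro: M.add)
  have mult: "amult B x y \<in> \<theta> ` M" if "x \<in> \<theta> ` M" "y \<in> \<theta> ` M" for x y
    using that S by (auto simp: map_compose[symmetric] intro: M.compose)
  have scl: "ascale B c x \<in> \<theta> ` M" if "x \<in> \<theta> ` M" for x c
    using that S by (auto simp: map_cscale[symmetric] intro: M.cscale)
  have star: "astar B x \<in> \<theta> ` M" if "x \<in> \<theta> ` M" for x
    using that S by (auto simp: map_adj[symmetric] intro: M.adj)
  have zero': "azero B \<in> \<theta> ` M"
    using M.zero by (auto simp: map_zero[symmetric])
  have compl: "\<exists>L\<in>\<theta> ` M. (\<lambda>n. anorm B (aminus B (X n) L)) \<longlonglongrightarrow> 0"
    if X: "\<And>n. X n \<in> \<theta> ` M"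
      and Cauchy: "\<And>e. e > 0 \<Longrightarrow> \<exists>k. \<forall>m\<ge>k. \<forall>n\<ge>k. anorm B (aminus B (X m) (X n)) < e" for X
  proof -
    have "\<forall>n. \<exists>y. y \<in> M \<and> X n = \<theta> y" using X by (auto simp: image_iff)
    from choice[OF this] obtain Y where Y: "\<And>n. Y n \<in> M" "\<And>n. X n = \<theta> (Y n)"
      by auto
    have "\<exists>L\<in>M. (\<lambda>n. N (Y n - L)) \<longlonglongrightarrow> 0"
    proof (rule M_complete)
      fix e :: real assume "e > 0"
      then show "\<exists>k. \<forall>m\<ge>k. \<forall>n\<ge>k. N (Y m - Y n) < e"
        using Cauchy[of e] by (simp add: N_def map_diff S Y)
    qed (rule Y)
    then obtain L where "L \<in> M" "(\<lambda>n. N (Y n - L)) \<longlonglongrightarrow> 0" by blast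
    then show ?thesis
      by (intro bexI[of _ "\<theta> L"]) (simp_all add: N_def map_diff S Y)
  qed
  have am: "aminus (B\<lparr>carrier := \<theta> ` M\<rparr>) = aminus B"
    by (intro ext) (simp add: aminus_def)
  have cstar': "cstar_algebra (B\<lparr>carrier := \<theta> ` M\<rparr>)"
  proof (unfold_locales, goal_cases)
    case (28 X)
    have "\<exists>L\<in>\<theta> ` M. (\<lambda>n. anorm B (aminus B (X n) L)) \<longlonglongrightarrow> 0"
      by (rule compl) (use 28 in \<open>simp_all add: am\<close>)
    then show ?case by (simp add: am)
  next
    case (7 x y)
    then show ?case using plus_commute[of x y] sub by simp
  qed (simp_all add: plus mult scl star zero' sub plus_assoc zero_plus plus_minus scale_plus
      plus_scale scale_scale scale_one mult_assoc plus_mult mult_plus scale_mult mult_scale star_star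
      star_plus star_scale star_mult norm_zero_iff norm_triangle norm_scale norm_submult cstar_identity)
  have hom: "restrict \<theta> M \<in> star_iso (op_alg M) (B\<lparr>carrier := \<theta> ` M\<rparr>)"
    unfolding star_iso_def star_hom_def
  proof (intro CollectI conjI)
    show "bij_betw (restrict \<theta> M) (carrier (op_alg M)) (carrier (B\<lparr>carrier := \<theta> ` M\<rparr>))"
      using bij_betw_subset[OF bij M(2) refl] by simp
  qed (use S in \<open>auto simp: adjoint_op_eq_adj[OF M.clin] M.add M.compose M.cscale M.adj
      map_add map_compose map_cscale map_adj\<close>)
  show ?thesis
    by (intro represented.intro represented_axioms.intro M(1) cstar' hom)
qed


section \<open>Conjugation by isometric multipliers\<close>

text \<open>The homomorphism \<open>X \<mapsto> w X w\<^sup>*\<close> between two represented algebras, transported to the objects of the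
  category. It allows for different Hilbert spaces, because the row operator and the column embedding
  connect the space of the algebra with that of its stabilisation.\<close>

definition conj_map ::
  "('k ell2 \<Rightarrow>\<^sub>L 'k ell2) set \<Rightarrow> (('k ell2 \<Rightarrow>\<^sub>L 'k ell2) \<Rightarrow> 'u) \<Rightarrow> 'u cstar_alg \<Rightarrow>
   (('l ell2 \<Rightarrow>\<^sub>L 'l ell2) \<Rightarrow> 'v) \<Rightarrow> ('k ell2 \<Rightarrow>\<^sub>L 'l ell2) \<Rightarrow> 'u \<Rightarrow> 'v" where
  "conj_map S \<theta> B \<theta>' w = (\<lambda>b\<in>carrier B. \<theta>' (w o\<^sub>L (inv_into S \<theta> b o\<^sub>L adj w)))"

text \<open>Conjugation by \<open>w\<close> is multiplicative as soon as \<open>w\<^sup>* w\<close> acts as a left unit on the algebra.\<close>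

lemma conj_map_hom:
  fixes w :: "'k ell2 \<Rightarrow>\<^sub>L 'l ell2"
  assumes "represented S \<theta> B" "represented S' \<theta>' B'" and w: "clin w"
    and into: "\<And>X. X \<in> S \<Longrightarrow> w o\<^sub>L (X o\<^sub>L adj w) \<in> S'"
    and isom: "\<And>X. X \<in> S \<Longrightarrow> adj w o\<^sub>L (w o\<^sub>L X) = X"
  shows "conj_map S \<theta> B \<theta>' w \<in> star_hom B B'"
proof -
  interpret represented S \<theta> B by fact
  interpret R: represented S' \<theta>' B' by fact
  let ?f = "conj_map S \<theta> B \<theta>' w"
  have f: "?f b = \<theta>' (w o\<^sub>L (pre b o\<^sub>L adj w))" if "b \<in> carrier B" for b
    using that by (simp add: conj_map_def pre_def)
  have isom': "adj w o\<^sub>L (w o\<^sub>L (X o\<^sub>L Z)) = X o\<^sub>L Z" if "X \<in> S" for X Z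
    using isom[OF that] by (metis compose_assoc)
  show ?thesis
    unfolding star_hom_def
  proof (intro CollectI conjI ballI allI)
    show "?f \<in> carrier B \<rightarrow>\<^sub>E carrier B'"
      by (auto simp: f into conj_map_def pre_def[symmetric])
  next
    fix x y assume [simp]: "x \<in> carrier B" "y \<in> carrier B"
    show "?f (aplus B x y) = aplus B' (?f x) (?f y)"
      by (simp add: f plus_closed pre_add compose_distribs R.map_add into)
    have "w o\<^sub>L (pre (amult B x y) o\<^sub>L adj w) = (w o\<^sub>L (pre x o\<^sub>L adj w)) o\<^sub>L (w o\<^sub>L (pre y o\<^sub>L adj w))"
      by (simp add: pre_mult compose_assoc isom')
    then show "?f (amult B x y) = amult B' (?f x) (?f y)"
      by (simp add: f mult_closed R.map_compose into)
  next
    fix x c assume [simp]: "x \<in> carrier B"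
    have "w o\<^sub>L (pre (ascale B c x) o\<^sub>L adj w) = cscale c o\<^sub>L (w o\<^sub>L (pre x o\<^sub>L adj w))"
      using clin_comm'[OF w] by (simp add: pre_scale compose_assoc)
    then show "?f (ascale B c x) = ascale B' c (?f x)"
      by (simp add: f scale_closed R.map_cscale into)
    show "?f (astar B x) = astar B' (?f x)"
      by (simp add: f star_closed pre_star R.map_adj[OF into, symmetric] compose_assoc)
  qed
qed

lemma conj_map_compose:
  fixes w :: "'k ell2 \<Rightarrow>\<^sub>L 'l ell2" and w' :: "'l ell2 \<Rightarrow>\<^sub>L 'm ell2"
  assumes "represented S \<theta> B" "represented S' \<theta>' B'"
    and into: "\<And>X. X \<in> S \<Longrightarrow> w o\<^sub>L (X o\<^sub>L adj w) \<in> S'"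
  shows "compose (carrier B) (conj_map S' \<theta>' B' \<theta>'' w') (conj_map S \<theta> B \<theta>' w)
    = conj_map S \<theta> B \<theta>'' (w' o\<^sub>L w)"
proof -
  interpret represented S \<theta> B by fact
  interpret R: represented S' \<theta>' B' by fact
  show ?thesis
    by (rule ext)
      (simp add: conj_map_def compose_def into pre_def[symmetric] R.pre_def[symmetric] compose_assoc)
qed

lemma conj_map_cong:
  assumes "represented S \<theta> B"
    and "\<And>X. X \<in> S \<Longrightarrow> w o\<^sub>L (X o\<^sub>L adj w) = v o\<^sub>L (X o\<^sub>L adj v)"
  shows "conj_map S \<theta> B \<theta>' w = conj_map S \<theta> B \<theta>' v"
proof -
  interpret represented S \<theta> B by fact
  show ?thesis
    by (rule ext) (simp add: conj_map_def pre_def[symmetric] assms(2))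
qed

text \<open>Only multiplication from the left is required to preserve \<open>S\<close>. Multiplication by \<open>w\<^sup>*\<close> from the
  right then preserves \<open>S\<close> as well, and this suffices for conjugation by \<open>w\<close>. The multiplier with row
  \<open>(s\<^sub>0, s\<^sub>1, \<dots>)\<close> is of this one-sided kind: multiplying by it from the right may lead out of \<open>S\<close>.\<close>

definition isometric_multiplier ::
  "('k ell2 \<Rightarrow>\<^sub>L 'k ell2) set \<Rightarrow> ('k ell2 \<Rightarrow>\<^sub>L 'k ell2) \<Rightarrow> bool" where
  "isometric_multiplier S w \<longleftrightarrow> clin w \<and> (\<forall>X\<in>S. w o\<^sub>L X \<in> S \<and> adj w o\<^sub>L (w o\<^sub>L X) = X)"

locale orthogonal_multipliers = represented S \<theta> B
  for S :: "('k ell2 \<Rightarrow>\<^sub>L 'k ell2) set" and \<theta> and B :: "'u cstar_alg" +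
  fixes \<sigma> \<tau> :: "'k ell2 \<Rightarrow>\<^sub>L 'k ell2"
  assumes \<sigma>: "isometric_multiplier S \<sigma>" and \<tau>: "isometric_multiplier S \<tau>"
    and orth: "adj \<sigma> o\<^sub>L \<tau> = 0"

context represented
begin

lemma multiplier_right:
  assumes "isometric_multiplier S w" "X \<in> S"
  shows "X o\<^sub>L adj w \<in> S"
proof -
  have "adj (w o\<^sub>L adj X) \<in> S"
    using assms by (intro adj) (auto simp: isometric_multiplier_def adj)
  then show ?thesis by simp
qed

lemma N_multiplier:
  assumes w: "isometric_multiplier S w" and X: "X \<in> S"
  shows "N (w o\<^sub>L X) = N X"
proof -
  have "(N (w o\<^sub>L X))\<^sup>2 = (N X)\<^sup>2"
    using N_adj_compose[of "w o\<^sub>L X"] N_adj_compose[OF X] w X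
    by (simp add: isometric_multiplier_def compose_assoc)
  then show ?thesis using N_nonneg X w by (simp add: isometric_multiplier_def power2_eq_iff_nonneg)
qed

lemma N_multiplier_right:
  assumes w: "isometric_multiplier S w" and X: "X \<in> S"
  shows "N (X o\<^sub>L adj w) = N X"
  using N_multiplier[OF w adj[OF X]] N_adj[OF multiplier_right[OF w X]] N_adj[OF X] by simp

end

text \<open>Two isometric multipliers with orthogonal ranges realise the algebra of \<open>2 \<times> 2\<close> matrices as a
  corner of the algebra itself. The corner inherits the C*-norm.\<close>

context orthogonal_multipliers
begin

lemma multiplier_rules:
  assumes "X \<in> S"
  shows "adj \<sigma> o\<^sub>L (\<sigma> o\<^sub>L X) = X" "adj \<tau> o\<^sub>L (\<tau> o\<^sub>L X) = X"
    "adj \<sigma> o\<^sub>L (\<sigma> o\<^sub>L (X o\<^sub>L Z)) = X o\<^sub>L Z" "adj \<tau> o\<^sub>L (\<tau> o\<^sub>L (X o\<^sub>L Z)) = X o\<^sub>L Z"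
proof -
  show "adj \<sigma> o\<^sub>L (\<sigma> o\<^sub>L X) = X" "adj \<tau> o\<^sub>L (\<tau> o\<^sub>L X) = X"
    using \<sigma> \<tau> assms by (auto simp: isometric_multiplier_def)
  then show "adj \<sigma> o\<^sub>L (\<sigma> o\<^sub>L (X o\<^sub>L Z)) = X o\<^sub>L Z" "adj \<tau> o\<^sub>L (\<tau> o\<^sub>L (X o\<^sub>L Z)) = X o\<^sub>L Z"
    by (metis compose_assoc)+
qed

lemma orth': "adj \<tau> o\<^sub>L \<sigma> = 0"
  using arg_cong[OF orth, of adj] by simp

lemma orth_rules: "adj \<sigma> o\<^sub>L (\<tau> o\<^sub>L Z) = 0" "adj \<tau> o\<^sub>L (\<sigma> o\<^sub>L Z) = 0"
  by (simp_all add: compose_assoc[symmetric] orth orth')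

definition mat where
  "mat a b c d = (\<sigma> o\<^sub>L (a o\<^sub>L adj \<sigma>)) + (\<sigma> o\<^sub>L (b o\<^sub>L adj \<tau>)) + (\<tau> o\<^sub>L (c o\<^sub>L adj \<sigma>)) + (\<tau> o\<^sub>L (d o\<^sub>L adj \<tau>))"

definition M where
  "M = {mat a b c d | a b c d. a \<in> S \<and> b \<in> S \<and> c \<in> S \<and> d \<in> S}"

lemma M_I: "a \<in> S \<Longrightarrow> b \<in> S \<Longrightarrow> c \<in> S \<Longrightarrow> d \<in> S \<Longrightarrow> mat a b c d \<in> M"
  unfolding M_def by blast

lemma M_E:
  assumes "X \<in> M"
  obtains a b c d where "X = mat a b c d" "a \<in> S" "b \<in> S" "c \<in> S" "d \<in> S"
  using assms unfolding M_def by blast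

lemma entry_closed:
  assumes "X \<in> S"
  shows "\<sigma> o\<^sub>L (X o\<^sub>L adj \<sigma>) \<in> S" "\<sigma> o\<^sub>L (X o\<^sub>L adj \<tau>) \<in> S" "\<tau> o\<^sub>L (X o\<^sub>L adj \<sigma>) \<in> S" "\<tau> o\<^sub>L (X o\<^sub>L adj \<tau>) \<in> S"
  using multiplier_right[OF \<sigma> assms] multiplier_right[OF \<tau> assms] \<sigma> \<tau>
  by (simp_all add: isometric_multiplier_def)

lemma mat_in_S: "a \<in> S \<Longrightarrow> b \<in> S \<Longrightarrow> c \<in> S \<Longrightarrow> d \<in> S \<Longrightarrow> mat a b c d \<in> S"
  unfolding mat_def by (intro add entry_closed)

lemma M_subset: "M \<subseteq> S"
  using mat_in_S by (auto simp: M_def)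

lemma mat_add: "mat a b c d + mat a' b' c' d' = mat (a + a') (b + b') (c + c') (d + d')"
  by (simp add: mat_def compose_distribs)

lemma mat_diff: "mat a b c d - mat a' b' c' d' = mat (a - a') (b - b') (c - c') (d - d')"
  by (simp add: mat_def compose_distribs)

lemma mat_mult:
  assumes [simp]: "a \<in> S" "b \<in> S" "c \<in> S" "d \<in> S" "a' \<in> S" "b' \<in> S" "c' \<in> S" "d' \<in> S"
  shows "mat a b c d o\<^sub>L mat a' b' c' d'
    = mat ((a o\<^sub>L a') + (b o\<^sub>L c')) ((a o\<^sub>L b') + (b o\<^sub>L d')) ((c o\<^sub>L a') + (d o\<^sub>L c')) ((c o\<^sub>L b') + (d o\<^sub>L d'))"
  by (simp add: mat_def compose_distribs compose_assoc multiplier_rules orth_rules)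

lemma mat_adj: "adj (mat a b c d) = mat (adj a) (adj c) (adj b) (adj d)"
  by (simp add: mat_def compose_assoc)

lemma mat_cscale: "cscale r o\<^sub>L mat a b c d
  = mat (cscale r o\<^sub>L a) (cscale r o\<^sub>L b) (cscale r o\<^sub>L c) (cscale r o\<^sub>L d)"
proof -
  have "cscale r o\<^sub>L (\<sigma> o\<^sub>L Z) = \<sigma> o\<^sub>L (cscale r o\<^sub>L Z)" "cscale r o\<^sub>L (\<tau> o\<^sub>L Z) = \<tau> o\<^sub>L (cscale r o\<^sub>L Z)"
    for Z :: "'k ell2 \<Rightarrow>\<^sub>L 'k ell2"
    using \<sigma> \<tau> by (simp_all add: isometric_multiplier_def clin_comm')
  then show ?thesis by (simp add: mat_def compose_distribs compose_assoc)
qed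

lemma mat_zero: "mat 0 0 0 0 = 0"
  by (simp add: mat_def)

lemma M_star_algebra: "op_star_algebra M"
proof
  show "clin X" if "X \<in> M" for X using that M_subset clin by blast
  show "0 \<in> M" using M_I[OF zero zero zero zero] by (simp add: mat_zero)
  show "X + Y \<in> M" if "X \<in> M" "Y \<in> M" for X Y
    using that by (elim M_E) (auto simp: mat_add intro!: M_I add)
  show "X o\<^sub>L Y \<in> M" if "X \<in> M" "Y \<in> M" for X Y
    using that by (elim M_E) (auto simp: mat_mult intro!: M_I add compose)
  show "adj X \<in> M" if "X \<in> M" for X
    using that by (elim M_E) (auto simp: mat_adj intro!: M_I adj)
  show "cscale c o\<^sub>L X \<in> M" if "X \<in> M" for X c
    using that by (elim M_E) (auto simp: mat_cscale intro!: M_I cscale)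
qed

text \<open>Compressing a matrix to an entry would require \<open>\<sigma>\<^sup>*\<close> and \<open>\<tau>\<^sup>*\<close> as left multipliers. Testing
  against \<open>X\<^sup>*\<close> on both sides uses only products inside the algebra.\<close>

lemma N_entry_le:
  assumes S: "a \<in> S" "b \<in> S" "c \<in> S" "d \<in> S"
  shows "N a \<le> N (mat a b c d)" "N b \<le> N (mat a b c d)" "N c \<le> N (mat a b c d)" "N d \<le> N (mat a b c d)"
proof -
  let ?m = "mat a b c d"
  have m: "?m \<in> S" by (rule mat_in_S[OF S])
  note rules = mat_def compose_distribs compose_assoc multiplier_rules orth_rules adj S
  have test: "N X \<le> N ?m"
    if "X \<in> S" "isometric_multiplier S v" "isometric_multiplier S w"
      "adj X o\<^sub>L (X o\<^sub>L adj X) = (adj X o\<^sub>L adj v) o\<^sub>L (?m o\<^sub>L (w o\<^sub>L adj X))" for X v w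
  proof (rule N_le_by_testing[OF that(1) _ m _ that(4)])
    show "adj X o\<^sub>L adj v \<in> S" using that by (intro multiplier_right adj)
    show "w o\<^sub>L adj X \<in> S" using that adj by (auto simp: isometric_multiplier_def)
    show "N (adj X o\<^sub>L adj v) \<le> N X"
      using that N_multiplier_right[OF that(2) adj[OF that(1)]] N_adj[OF that(1)] by simp
    show "N (w o\<^sub>L adj X) \<le> N X"
      using that N_multiplier[OF that(3) adj[OF that(1)]] N_adj[OF that(1)] by simp
  qed
  show "N a \<le> N ?m" by (rule test[OF S(1) \<sigma> \<sigma>]) (simp add: rules)
  show "N b \<le> N ?m" by (rule test[OF S(2) \<sigma> \<tau>]) (simp add: rules)
  show "N c \<le> N ?m" by (rule test[OF S(3) \<tau> \<sigma>]) (simp add: rules)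
  show "N d \<le> N ?m" by (rule test[OF S(4) \<tau> \<tau>]) (simp add: rules)
qed

lemma N_mat_le:
  assumes S: "a \<in> S" "b \<in> S" "c \<in> S" "d \<in> S"
  shows "N (mat a b c d) \<le> N a + N b + N c + N d"
proof -
  have N_entry: "N (v o\<^sub>L (X o\<^sub>L adj w)) = N X"
    if "X \<in> S" "isometric_multiplier S v" "isometric_multiplier S w" for X v w
    using that N_multiplier[OF that(2) multiplier_right[OF that(3) that(1)]] N_multiplier_right by simp
  have "N (mat a b c d) \<le> N (\<sigma> o\<^sub>L (a o\<^sub>L adj \<sigma>)) + N (\<sigma> o\<^sub>L (b o\<^sub>L adj \<tau>)) + N (\<tau> o\<^sub>L (c o\<^sub>L adj \<sigma>))
      + N (\<tau> o\<^sub>L (d o\<^sub>L adj \<tau>))"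
    unfolding mat_def
    by (rule order_trans[OF N_add add_right_mono[OF order_trans[OF N_add add_right_mono[OF N_add]]]])
      (intro add entry_closed S)+
  then show ?thesis using \<sigma> \<tau> S by (simp add: N_entry)
qed

lemma M_complete:
  assumes X: "\<And>n. X n \<in> M" and Cauchy: "\<And>e. e > 0 \<Longrightarrow> \<exists>k. \<forall>m\<ge>k. \<forall>n\<ge>k. N (X m - X n) < e"
  shows "\<exists>L\<in>M. (\<lambda>n. N (X n - L)) \<longlonglongrightarrow> 0"
proof -
  have "\<exists>a b c d. X n = mat a b c d \<and> a \<in> S \<and> b \<in> S \<and> c \<in> S \<and> d \<in> S" for n
    using X[of n] by (auto simp: M_def)
  then obtain a b c d where eq: "\<And>n. X n = mat (a n) (b n) (c n) (d n)"
    and S: "\<And>n. a n \<in> S" "\<And>n. b n \<in> S" "\<And>n. c n \<in> S" "\<And>n. d n \<in> S" by metis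
  have le: "N (a m - a n) \<le> N (X m - X n)" "N (b m - b n) \<le> N (X m - X n)"
      "N (c m - c n) \<le> N (X m - X n)" "N (d m - d n) \<le> N (X m - X n)" for m n
    unfolding eq mat_diff by (intro N_entry_le diff S)+
  have limit: "\<exists>L\<in>S. (\<lambda>n. N (f n - L)) \<longlonglongrightarrow> 0"
    if "\<And>n. f n \<in> S" "\<And>m n. N (f m - f n) \<le> N (X m - X n)" for f
    by (rule N_complete[OF that(1)]) (meson Cauchy order_le_less_trans that(2))
  obtain a' b' c' d' where S': "a' \<in> S" "b' \<in> S" "c' \<in> S" "d' \<in> S"
    and lims: "(\<lambda>n. N (a n - a')) \<longlonglongrightarrow> 0" "(\<lambda>n. N (b n - b')) \<longlonglongrightarrow> 0"
      "(\<lambda>n. N (c n - c')) \<longlonglongrightarrow> 0" "(\<lambda>n. N (d n - d')) \<longlonglongrightarrow> 0"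
    using limit[of a] limit[of b] limit[of c] limit[of d] S le by metis
  have "(\<lambda>n. N (X n - mat a' b' c' d')) \<longlonglongrightarrow> 0"
  proof (rule tendsto_sandwich[OF _ _ tendsto_const])
    show "eventually (\<lambda>n. 0 \<le> N (X n - mat a' b' c' d')) sequentially"
      using eq S S' by (auto intro!: always_eventually N_nonneg diff mat_in_S)
    show "eventually (\<lambda>n. N (X n - mat a' b' c' d')
        \<le> N (a n - a') + N (b n - b') + N (c n - c') + N (d n - d')) sequentially"
      unfolding eq mat_diff by (intro always_eventually allI N_mat_le diff S S')
    have "(\<lambda>n. N (a n - a') + N (b n - b') + N (c n - c') + N (d n - d')) \<longlonglongrightarrow> 0 + 0 + 0 + 0"
      by (intro tendsto_add lims)
    then show "(\<lambda>n. N (a n - a') + N (b n - b') + N (c n - c') + N (d n - d')) \<longlonglongrightarrow> 0" by simp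
  qed
  then show ?thesis using M_I[OF S'] by blast
qed

abbreviation C where "C \<equiv> B\<lparr>carrier := \<theta> ` M\<rparr>"

lemma M_represented: "represented M (restrict \<theta> M) C"
  by (rule represented_subalgebra[OF represented_axioms M_star_algebra M_subset M_complete])

definition M2_map where
  "M2_map = (\<lambda>x\<in>carrier (M2 B).
    \<theta> (mat (pre (x $ 1 $ 1)) (pre (x $ 1 $ 2)) (pre (x $ 2 $ 1)) (pre (x $ 2 $ 2))))"

lemma mat_inj:
  assumes "a \<in> S" "b \<in> S" "c \<in> S" "d \<in> S" "a' \<in> S" "b' \<in> S" "c' \<in> S" "d' \<in> S"
    and eq: "mat a b c d = mat a' b' c' d'"
  shows "a = a'" "b = b'" "c = c'" "d = d'"
proof -
  have *: "mat (a - a') (b - b') (c - c') (d - d') = 0"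
    using eq by (simp flip: mat_diff)
  have **: "N (a - a') \<le> 0" "N (b - b') \<le> 0" "N (c - c') \<le> 0" "N (d - d') \<le> 0"
    using N_entry_le[of "a - a'" "b - b'" "c - c'" "d - d'"] assms(1-8) by (simp_all add: * diff)
  have "N (a - a') = 0" "N (b - b') = 0" "N (c - c') = 0" "N (d - d') = 0"
    using ** by (auto intro!: antisym N_nonneg diff assms)
  then show "a = a'" "b = b'" "c = c'" "d = d'"
    using N_zero_iff assms(1-8) by (auto simp: diff)
qed

lemma M2_map_iso: "M2_map \<in> star_iso (M2 B) C"
proof -
  let ?m = "\<lambda>x. mat (pre (x $ 1 $ 1)) (pre (x $ 1 $ 2)) (pre (x $ 2 $ 1)) (pre (x $ 2 $ 2))"
  have entries: "x $ i $ j \<in> carrier B" if "x \<in> carrier (M2 B)" for x i j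
    using that by (simp add: M2_def)
  have f: "M2_map x = \<theta> (?m x)" if "x \<in> carrier (M2 B)" for x
    using that by (simp add: M2_map_def)
  have m: "?m x \<in> M" "?m x \<in> S" if "x \<in> carrier (M2 B)" for x
    using entries[OF that] by (auto intro!: M_I mat_in_S)
  have "bij_betw M2_map (carrier (M2 B)) (\<theta> ` M)"
    unfolding bij_betw_def
  proof
    show "inj_on M2_map (carrier (M2 B))"
    proof (rule inj_onI)
      fix x y assume xy: "x \<in> carrier (M2 B)" "y \<in> carrier (M2 B)" "M2_map x = M2_map y"
      then have "?m x = ?m y" by (simp add: f m map_eq_iff)
      then have "pre (x $ 1 $ 1) = pre (y $ 1 $ 1)" "pre (x $ 1 $ 2) = pre (y $ 1 $ 2)"
          "pre (x $ 2 $ 1) = pre (y $ 2 $ 1)" "pre (x $ 2 $ 2) = pre (y $ 2 $ 2)"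
        using mat_inj entries[OF xy(1)] entries[OF xy(2)] by (metis pre_closed)+
      then have "x $ 1 $ 1 = y $ 1 $ 1" "x $ 1 $ 2 = y $ 1 $ 2" "x $ 2 $ 1 = y $ 2 $ 1" "x $ 2 $ 2 = y $ 2 $ 2"
        by (metis entries xy(1,2) map_back)+
      then show "x = y" by (simp add: vec_eq_iff forall_2)
    qed
    show "M2_map ` carrier (M2 B) = \<theta> ` M"
    proof (intro equalityI subsetI)
      fix z assume "z \<in> \<theta> ` M"
      then obtain a b c d where z: "z = \<theta> (mat a b c d)" and S: "a \<in> S" "b \<in> S" "c \<in> S" "d \<in> S"
        by (auto elim: M_E)
      let ?x = "\<chi> i j. if i = 1 then (if j = 1 then \<theta> a else \<theta> b) else (if j = 1 then \<theta> c else \<theta> d) :: 'u^2^2"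
      have x: "?x \<in> carrier (M2 B)" using S by (simp add: M2_def)
      have "?m ?x = mat a b c d" using S by simp
      then have "z = M2_map ?x" unfolding z f[OF x] by (rule arg_cong[symmetric])
      then show "z \<in> M2_map ` carrier (M2 B)" using x by (rule image_eqI)
    qed (auto simp: f m)
  qed
  moreover have "M2_map \<in> star_hom (M2 B) C"
    unfolding star_hom_def
  proof (intro CollectI conjI ballI allI)
    show "M2_map \<in> carrier (M2 B) \<rightarrow>\<^sub>E carrier C"
      using f m by (auto simp: M2_map_def)
  next
    fix x y assume x: "x \<in> carrier (M2 B)" and y: "y \<in> carrier (M2 B)"
    note e = entries[OF x] entries[OF y]
    have xy: "aplus (M2 B) x y \<in> carrier (M2 B)" "amult (M2 B) x y \<in> carrier (M2 B)"
      using e by (simp_all add: M2_def plus_closed mult_closed)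
    have "?m (aplus (M2 B) x y) = ?m x + ?m y"
      using e by (simp add: M2_def mat_add pre_add)
    then show "M2_map (aplus (M2 B) x y) = aplus C (M2_map x) (M2_map y)"
      using x y xy by (simp add: f m map_add)
    have "?m (amult (M2 B) x y) = ?m x o\<^sub>L ?m y"
      using e by (simp add: M2_def mat_mult pre_add pre_mult mult_closed)
    then show "M2_map (amult (M2 B) x y) = amult C (M2_map x) (M2_map y)"
      using x y xy by (simp add: f m map_compose)
  next
    fix x c assume x: "x \<in> carrier (M2 B)"
    note e = entries[OF x]
    have cx: "ascale (M2 B) c x \<in> carrier (M2 B)" "astar (M2 B) x \<in> carrier (M2 B)"
      using e by (simp_all add: M2_def scale_closed star_closed)
    have "?m (ascale (M2 B) c x) = cscale c o\<^sub>L ?m x"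
      using e by (simp add: M2_def mat_cscale pre_scale)
    then show "M2_map (ascale (M2 B) c x) = ascale C c (M2_map x)"
      using x cx by (simp add: f m map_cscale)
    have "?m (astar (M2 B) x) = adj (?m x)"
      using e by (simp add: M2_def mat_adj pre_star)
    then show "M2_map (astar (M2 B) x) = astar C (M2_map x)"
      using x cx by (simp add: f m map_adj)
  qed
  ultimately show ?thesis by (simp add: star_iso_def)
qed

text \<open>The upper left corner is embedded by conjugation with \<open>\<sigma>\<close>. Exchanging \<open>\<sigma>\<close> and \<open>\<tau>\<close> gives the same
  algebra with the other corner embedded, so stability applies to both corners.\<close>

lemma M2_map_corner:
  "compose (carrier B) M2_map (M2_corner B) = conj_map S \<theta> B (restrict \<theta> M) \<sigma>"
proof (rule ext)
  fix b
  have "M2_corner B b \<in> carrier (M2 B)" if "b \<in> carrier B"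
    using that zero_closed by (simp add: M2_corner_def M2_def)
  moreover have "\<sigma> o\<^sub>L (pre b o\<^sub>L adj \<sigma>) = mat (pre b) 0 0 0"
    by (simp add: mat_def)
  moreover have "mat (pre b) 0 0 0 \<in> M" if "b \<in> carrier B"
    using that by (intro M_I zero) simp
  ultimately show "compose (carrier B) M2_map (M2_corner B) b = conj_map S \<theta> B (restrict \<theta> M) \<sigma> b"
    by (simp add: compose_def conj_map_def M2_map_def M2_corner_def pre_zero pre_def[symmetric])
qed

end


section \<open>Stable functors do not see isometric conjugations\<close>

context represented
begin

lemma multiplier_rules_right:
  assumes w: "isometric_multiplier S w" and X: "X \<in> S"
  shows "X o\<^sub>L (adj w o\<^sub>L w) = X" "X o\<^sub>L (adj w o\<^sub>L (w o\<^sub>L Z)) = X o\<^sub>L Z"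
proof -
  have "adj (adj w o\<^sub>L (w o\<^sub>L adj X)) = X"
    using w adj[OF X] by (simp add: isometric_multiplier_def del: adj_compose)
  then show "X o\<^sub>L (adj w o\<^sub>L w) = X" by (simp add: compose_assoc)
  then show "X o\<^sub>L (adj w o\<^sub>L (w o\<^sub>L Z)) = X o\<^sub>L Z" by (metis compose_assoc)
qed

end

context orthogonal_multipliers
begin

lemma swapped: "orthogonal_multipliers S \<theta> B \<tau> \<sigma>"
  by unfold_locales (rule \<tau> \<sigma> orth')+

lemma swapped_M: "orthogonal_multipliers.M S \<tau> \<sigma> = M"
proof -
  interpret sw: orthogonal_multipliers S \<theta> B \<tau> \<sigma> by (rule swapped)
  have "sw.mat a b c d = mat d c b a" for a b c d
    by (simp add: mat_def sw.mat_def ac_simps)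
  then show ?thesis unfolding M_def sw.M_def by auto
qed

text \<open>Conjugation by \<open>diag(1, v)\<close> fixes the upper left corner of the \<open>2 \<times> 2\<close> matrices and restricts
  to conjugation by \<open>v\<close> on the lower right corner. A stable functor maps the inclusions of both
  corners to isomorphisms. Because of the first one it turns conjugation by \<open>diag(1, v)\<close> into the
  identity, and then, because of the second one, also conjugation by \<open>v\<close>.\<close>

lemma stable_functor_conj_map:
  assumes E: "cstar_functor E Emap" and stable: "M2_stable E Emap"
    and v: "isometric_multiplier S v" and x: "x \<in> carrier (E B)"
  shows "Emap B B (conj_map S \<theta> B \<theta> v) x = x"
proof -
  interpret E: cstar_functor E Emap by fact
  interpret sw: orthogonal_multipliers S \<theta> B \<tau> \<sigma> by (rule swapped)
  interpret R: represented M "restrict \<theta> M" C by (rule M_represented)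
  let ?\<theta> = "restrict \<theta> M"
  let ?ad = "\<lambda>u. conj_map S \<theta> B ?\<theta> u"
  \<comment> \<open>The matrix \<open>diag(1, v)\<close>.\<close>
  define w where "w = (\<sigma> o\<^sub>L adj \<sigma>) + (\<tau> o\<^sub>L (v o\<^sub>L adj \<tau>))"
  have [simp]: "clin \<sigma>" "clin \<tau>" "clin v"
    using \<sigma> \<tau> v by (auto simp: isometric_multiplier_def)
  have rep: "represented S \<theta> B" ..
  have clin_w: "clin w"
    unfolding w_def by (intro clin_add clin_compose clin_adj) simp_all
  have v_rules: "v o\<^sub>L X \<in> S" "adj v o\<^sub>L (v o\<^sub>L X) = X" if "X \<in> S" for X
    using v that by (auto simp: isometric_multiplier_def)
  have v_rules': "adj v o\<^sub>L (v o\<^sub>L (X o\<^sub>L Z)) = X o\<^sub>L Z" if "X \<in> S" for X and Z :: "'k ell2 \<Rightarrow>\<^sub>L 'k ell2"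
    using v_rules(2)[OF that] by (metis compose_assoc)
  have v_rules'': "adj \<tau> o\<^sub>L (\<tau> o\<^sub>L (v o\<^sub>L (X o\<^sub>L Z))) = v o\<^sub>L (X o\<^sub>L Z)" if "X \<in> S"
    for X and Z :: "'k ell2 \<Rightarrow>\<^sub>L 'k ell2"
    using multiplier_rules(4)[OF v_rules(1)[OF that], of Z] by (simp add: compose_assoc)
  note right_rules = multiplier_rules_right[OF \<sigma>] multiplier_rules_right[OF \<tau>] multiplier_rules_right[OF v]
  note rules = w_def compose_distribs compose_assoc multiplier_rules orth_rules orth orth' v_rules v_rules' v_rules''
    right_rules
  have w_\<sigma>: "w o\<^sub>L (\<sigma> o\<^sub>L (X o\<^sub>L Z)) = \<sigma> o\<^sub>L (X o\<^sub>L Z)"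
    and w_\<tau>: "w o\<^sub>L (\<tau> o\<^sub>L (X o\<^sub>L Z)) = \<tau> o\<^sub>L (v o\<^sub>L (X o\<^sub>L Z))" if "X \<in> S" for X and Z :: "'k ell2 \<Rightarrow>\<^sub>L 'k ell2"
    using that by (simp_all add: rules)
  have w'_\<sigma>: "X o\<^sub>L (adj \<sigma> o\<^sub>L adj w) = X o\<^sub>L adj \<sigma>"
    and w'_\<tau>: "X o\<^sub>L (adj \<tau> o\<^sub>L adj w) = X o\<^sub>L (adj v o\<^sub>L adj \<tau>)" if "X \<in> S" for X
    using that by (simp_all add: rules)
  have w'w_\<sigma>: "adj w o\<^sub>L (w o\<^sub>L (\<sigma> o\<^sub>L (X o\<^sub>L Z))) = \<sigma> o\<^sub>L (X o\<^sub>L Z)"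
    and w'w_\<tau>: "adj w o\<^sub>L (w o\<^sub>L (\<tau> o\<^sub>L (X o\<^sub>L Z))) = \<tau> o\<^sub>L (X o\<^sub>L Z)" if "X \<in> S" for X and Z :: "'k ell2 \<Rightarrow>\<^sub>L 'k ell2"
    using that by (simp_all add: rules)
  have w_into: "w o\<^sub>L (X o\<^sub>L adj w) \<in> M" if X_M: "X \<in> M" for X
  proof -
    obtain a b c d where X: "X = mat a b c d" and S: "a \<in> S" "b \<in> S" "c \<in> S" "d \<in> S"
      using M_E[OF X_M] by blast
    have "w o\<^sub>L (X o\<^sub>L adj w) = mat a (b o\<^sub>L adj v) (v o\<^sub>L c) (v o\<^sub>L (d o\<^sub>L adj v))"
      by (simp only: X mat_def compose_add_left compose_add_right compose_assoc w_\<sigma> w_\<tau> w'_\<sigma> w'_\<tau> S)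
    then show ?thesis
      using S by (simp add: M_I multiplier_right[OF v] v_rules)
  qed
  have w_isom: "adj w o\<^sub>L (w o\<^sub>L X) = X" if X_M: "X \<in> M" for X
  proof -
    obtain a b c d where X: "X = mat a b c d" and S: "a \<in> S" "b \<in> S" "c \<in> S" "d \<in> S"
      using M_E[OF X_M] by blast
    show ?thesis
      by (simp only: X mat_def compose_add_right w'w_\<sigma> w'w_\<tau> S)
  qed
  have entry_M: "\<sigma> o\<^sub>L (X o\<^sub>L adj \<sigma>) \<in> M" "\<tau> o\<^sub>L (X o\<^sub>L adj \<tau>) \<in> M" if "X \<in> S" for X
    using M_I[OF that zero zero zero] M_I[OF zero zero zero that] by (simp_all add: mat_def)
  have \<Psi>: "conj_map M ?\<theta> C ?\<theta> w \<in> star_hom C C"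
    by (rule conj_map_hom[OF M_represented M_represented clin_w w_into w_isom])
  have \<sigma>_hom: "?ad \<sigma> \<in> star_hom B C" and \<tau>_hom: "?ad \<tau> \<in> star_hom B C"
    by (rule conj_map_hom[OF rep M_represented]; simp add: entry_M multiplier_rules)+
  have v_into: "v o\<^sub>L (X o\<^sub>L adj v) \<in> S" if "X \<in> S" for X
    using that by (intro v_rules multiplier_right[OF v])
  have v_hom: "conj_map S \<theta> B \<theta> v \<in> star_hom B B"
    by (rule conj_map_hom[OF rep rep]) (simp_all add: v_into v_rules)
  have \<Psi>_\<sigma>: "compose (carrier B) (conj_map M ?\<theta> C ?\<theta> w) (?ad \<sigma>) = ?ad \<sigma>"
  proof (rule trans[OF conj_map_compose[OF rep M_represented entry_M(1)] conj_map_cong[OF rep]])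
    show "(w o\<^sub>L \<sigma>) o\<^sub>L (X o\<^sub>L adj (w o\<^sub>L \<sigma>)) = \<sigma> o\<^sub>L (X o\<^sub>L adj \<sigma>)" if "X \<in> S" for X
      using that by (simp only: adj_compose compose_assoc w_\<sigma> w'_\<sigma>)
  qed
  have "compose (carrier B) (conj_map M ?\<theta> C ?\<theta> w) (?ad \<tau>) = ?ad (\<tau> o\<^sub>L v)"
  proof (rule trans[OF conj_map_compose[OF rep M_represented entry_M(2)] conj_map_cong[OF rep]])
    show "(w o\<^sub>L \<tau>) o\<^sub>L (X o\<^sub>L adj (w o\<^sub>L \<tau>)) = (\<tau> o\<^sub>L v) o\<^sub>L (X o\<^sub>L adj (\<tau> o\<^sub>L v))" if "X \<in> S" for X
      using that by (simp only: adj_compose compose_assoc w_\<tau> w'_\<tau>)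
  qed
  also have "\<dots> = compose (carrier B) (?ad \<tau>) (conj_map S \<theta> B \<theta> v)"
    by (rule conj_map_compose[OF rep rep v_into, symmetric])
  finally have \<Psi>_\<tau>: "compose (carrier B) (conj_map M ?\<theta> C ?\<theta> w) (?ad \<tau>)
      = compose (carrier B) (?ad \<tau>) (conj_map S \<theta> B \<theta> v)" .
  have iso_\<sigma>: "Emap B C (?ad \<sigma>) \<in> iso (E B) (E C)"
    using stable cstar R.cstar M2_map_iso unfolding M2_stable_def M2_map_corner[symmetric] by blast
  have iso_\<tau>: "Emap B C (?ad \<tau>) \<in> iso (E B) (E C)"
    using stable cstar R.cstar sw.M2_map_iso
    unfolding M2_stable_def swapped_M sw.M2_map_corner[symmetric, unfolded swapped_M] by blast
  have \<Psi>_id: "Emap C C (conj_map M ?\<theta> C ?\<theta> w) y = y" if y: "y \<in> carrier (E C)" for y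
  proof -
    obtain z where z: "z \<in> carrier (E B)" "y = Emap B C (?ad \<sigma>) z"
      using iso_\<sigma> y by (auto simp: iso_def bij_betw_def)
    show ?thesis
      using E.map_compose[OF cstar R.cstar R.cstar \<sigma>_hom \<Psi> z(1)] unfolding \<Psi>_\<sigma> z(2) by simp
  qed
  have into: "Emap B C (?ad \<tau>) x \<in> carrier (E C)"
    using iso_\<tau> x by (auto simp: iso_def hom_def)
  have "Emap B C (?ad \<tau>) (Emap B B (conj_map S \<theta> B \<theta> v) x) = Emap B C (?ad \<tau>) x"
    using E.map_compose[OF cstar R.cstar R.cstar \<tau>_hom \<Psi> x]
      E.map_compose[OF cstar cstar R.cstar v_hom \<tau>_hom x] \<Psi>_id[OF into]
    unfolding \<Psi>_\<tau> by simp
  moreover have "Emap B B (conj_map S \<theta> B \<theta> v) x \<in> carrier (E B)"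
    using E.map_hom[OF cstar cstar v_hom] x by (auto simp: hom_def)
  ultimately show ?thesis
    using iso_\<tau> x by (auto simp: iso_def bij_betw_def dest: inj_onD)
qed

end


section \<open>The operator norm is the C*-norm\<close>

locale unital_represented = represented S \<theta> B
  for S :: "('k ell2 \<Rightarrow>\<^sub>L 'k ell2) set" and \<theta> and B :: "'u cstar_alg" +
  fixes e :: "'k ell2 \<Rightarrow>\<^sub>L 'k ell2"
  assumes unit_closed: "e \<in> S"
    and unit_left: "X \<in> S \<Longrightarrow> e o\<^sub>L X = X" and unit_right: "X \<in> S \<Longrightarrow> X o\<^sub>L e = X"
begin

lemma adj_unit: "adj e = e"
proof -
  have "e o\<^sub>L adj e = adj e" by (rule unit_left[OF adj[OF unit_closed]])
  moreover have "adj (e o\<^sub>L adj e) = e o\<^sub>L adj e" by simp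
  ultimately show ?thesis by (simp del: adj_compose)
qed

lemma N_unit_le: "N e \<le> 1"
proof -
  have "N e = (N e)\<^sup>2"
    using N_adj_compose[OF unit_closed] by (simp add: adj_unit unit_left unit_closed)
  then have "N e = 0 \<or> N e = 1" by (simp add: power2_eq_square)
  then show ?thesis by auto
qed

lemma norm_apply_unit_le: "e f \<bullet> f \<le> (norm f)\<^sup>2"
proof -
  have eq: "e f \<bullet> f = (norm (e f))\<^sup>2"
    using norm_square_adj[of e f] by (simp only: adj_unit unit_left unit_closed)
  then have "(norm (e f))\<^sup>2 \<le> norm (e f) * norm f"
    using norm_cauchy_schwarz[of "e f" f] by simp
  then have "norm (e f) \<le> norm f"
    by (cases "norm (e f) = 0") (auto simp: power2_eq_square)
  then show ?thesis unfolding eq by (intro power_mono) auto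
qed

text \<open>Evaluation of a polynomial by the Horner scheme, with the unit \<open>e\<close> of the algebra for the constants;
  \<open>e\<close> is a projection and may differ from the identity operator.\<close>

definition ev :: "('k ell2 \<Rightarrow>\<^sub>L 'k ell2) \<Rightarrow> real poly \<Rightarrow> ('k ell2 \<Rightarrow>\<^sub>L 'k ell2)" where
  "ev a p = fold_coeffs (\<lambda>c X. c *\<^sub>R e + (a o\<^sub>L X)) p 0"

lemma ev_0 [simp]: "ev a 0 = 0"
  by (simp add: ev_def)

lemma ev_pCons: "ev a (pCons c p) = c *\<^sub>R e + (a o\<^sub>L ev a p)"
  by (cases "p = 0 \<and> c = 0") (auto simp: ev_def)

lemma ev_closed: "a \<in> S \<Longrightarrow> ev a p \<in> S"
  by (induction p) (auto simp: ev_pCons zero intro!: add scaleR compose unit_closed)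

lemma ev_add: "ev a (p + q) = ev a p + ev a q"
  by (induction p q rule: poly_induct2) (simp_all add: ev_pCons compose_distribs scaleR_add_left)

lemma ev_smult: "ev a (smult c p) = c *\<^sub>R ev a p"
  by (induction p) (simp_all add: ev_pCons compose_distribs scaleR_add_right)

lemma ev_diff: "ev a (p - q) = ev a p - ev a q"
  using ev_add[of a p "smult (-1) q"] by (simp only: ev_smult) simp

lemma ev_one [simp]: "ev a 1 = e"
  by (simp add: ev_pCons one_pCons)

context
  fixes a assumes a: "a \<in> S" and sa: "adj a = a"
begin

lemma ev_mult: "ev a (p * q) = ev a p o\<^sub>L ev a q"
  using ev_closed[OF a, of q]
  by (induction p) (simp_all add: ev_pCons ev_add ev_smult compose_distribs compose_assoc unit_left)

lemma ev_X: "ev a [:0, 1:] = a"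
  by (simp add: ev_pCons unit_right a)

lemma ev_commute: "ev a p o\<^sub>L ev a q = ev a q o\<^sub>L ev a p"
  by (simp flip: ev_mult add: mult.commute)

lemma ev_adj: "adj (ev a p) = ev a p"
proof (induction p)
  case (pCons c p)
  then show ?case
    using ev_commute[of p "[:0, 1:]"] by (simp add: ev_pCons adj_unit sa unit_right a)
qed simp

lemma ev_square: "ev a (p\<^sup>2 + q\<^sup>2) = (ev a p o\<^sub>L ev a p) + (ev a q o\<^sub>L ev a q)"
  by (simp add: power2_eq_square ev_add ev_mult)

text \<open>Both norms satisfy the axioms: the C*-norm by the C*-identity for \<open>p(a) + \<i> q(a)\<close>, the operator norm
  because \<open>\<parallel>p(a) f\<parallel>\<^sup>2 + \<parallel>q(a) f\<parallel>\<^sup>2 = \<langle>(p\<^sup>2 + q\<^sup>2)(a) f, f\<rangle>\<close>.\<close>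

lemma N_poly_seminorm: "poly_seminorm (\<lambda>p. N (ev a p))"
proof
  note ev_closed[OF a, simp]
  fix p q c
  show "N (ev a (p + q)) \<le> N (ev a p) + N (ev a q)" by (simp add: ev_add N_add)
  show "N (ev a (p * q)) \<le> N (ev a p) * N (ev a q)" by (simp add: ev_mult N_compose)
  show "N (ev a (smult c p)) = \<bar>c\<bar> * N (ev a p)" by (simp add: ev_smult N_scaleR)
  show "N (ev a 1) \<le> 1" by (simp add: N_unit_le)
  let ?p = "ev a p" and ?q = "ev a q"
  let ?z = "?p + (cscale \<i> o\<^sub>L ?q)"
  have z: "?z \<in> S" by (intro add cscale) simp_all
  have clin': "clin ?p" "clin ?q" by (simp_all add: clin)
  have adj_z: "adj ?z = ?p + (cscale (- \<i>) o\<^sub>L ?q)"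
    using clin_comm[OF clin'(2), of "- \<i>"] by (simp add: ev_adj)
  have comm: "?p (?q f) = ?q (?p f)" for f
    using arg_cong[OF ev_commute[of p q], of "\<lambda>T. blinfun_apply T f"] by simp
  have "adj ?z o\<^sub>L ?z = (?p o\<^sub>L ?p) + (?q o\<^sub>L ?q)"
    unfolding adj_z
    by (rule blinfun_eqI)
      (simp add: blinfun.add_left blinfun.add_right clin_apply[OF clin'(1)] clin_apply[OF clin'(2)]
        scaleC_add comm flip: scaleC_add_left)
  then have "(N ?z)\<^sup>2 = N (ev a (p\<^sup>2 + q\<^sup>2))"
    using N_adj_compose[OF z] by (simp add: ev_square)
  moreover have "N ?p \<le> N ?z"
  proof -
    have "?z + adj ?z = 2 *\<^sub>R ?p"
      unfolding adj_z
      by (rule blinfun_eqI) (simp add: blinfun.add_left blinfun.scaleR_left scaleR_2 flip: scaleC_add_left)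
    then have "2 * N ?p \<le> N ?z + N (adj ?z)"
      using N_add[OF z adj[OF z]] by (simp add: N_scaleR del: adj_add adj_compose)
    then show ?thesis unfolding N_adj[OF z] by simp
  qed
  ultimately show "(N ?p)\<^sup>2 \<le> N (ev a (p\<^sup>2 + q\<^sup>2))"
    using N_nonneg[of ?p] by (metis ev_closed[OF a] power_mono)
qed

lemma op_norm_poly_seminorm: "poly_seminorm (\<lambda>p. norm (ev a p))"
proof
  fix p q c
  show "norm (ev a (p + q)) \<le> norm (ev a p) + norm (ev a q)" by (simp add: ev_add norm_triangle_ineq)
  show "norm (ev a (p * q)) \<le> norm (ev a p) * norm (ev a q)"
    by (simp add: ev_mult norm_blinfun_compose)
  show "norm (ev a (smult c p)) = \<bar>c\<bar> * norm (ev a p)" by (simp add: ev_smult)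
  have "norm e \<le> 1"
  proof (rule norm_blinfun_bound)
    fix f
    have "(norm (e f))\<^sup>2 = e f \<bullet> f"
      using norm_square_adj[of e f] by (simp only: adj_unit unit_left unit_closed)
    then show "norm (e f) \<le> 1 * norm f"
      using norm_apply_unit_le[of f] by (auto intro: power2_le_imp_le)
  qed simp
  then show "norm (ev a 1) \<le> 1" by simp
  let ?r = "norm (ev a (p\<^sup>2 + q\<^sup>2))"
  have "norm (ev a p) \<le> sqrt ?r"
  proof (rule norm_blinfun_bound)
    fix f
    have "(norm (ev a p f))\<^sup>2 \<le> (norm (ev a p f))\<^sup>2 + (norm (ev a q f))\<^sup>2" by simp
    also have "\<dots> = ev a (p\<^sup>2 + q\<^sup>2) f \<bullet> f"
      by (simp add: norm_square_adj ev_adj ev_square blinfun.add_left inner_add_left)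
    also have "\<dots> \<le> norm (ev a (p\<^sup>2 + q\<^sup>2) f) * norm f" by (rule norm_cauchy_schwarz)
    also have "\<dots> \<le> ?r * norm f * norm f" by (intro mult_right_mono norm_blinfun) simp
    also have "\<dots> = (sqrt ?r * norm f)\<^sup>2"
      unfolding power_mult_distrib real_sqrt_pow2[OF norm_ge_zero] by (simp add: power2_eq_square)
    finally have "(norm (ev a p f))\<^sup>2 \<le> (sqrt ?r * norm f)\<^sup>2" .
    then show "norm (ev a p f) \<le> sqrt ?r * norm f" by (rule power2_le_imp_le) simp
  qed simp
  then show "(norm (ev a p))\<^sup>2 \<le> ?r"
    using power_mono[of "norm (ev a p)" "sqrt ?r" 2] by simp
qed

text \<open>The complementary element \<open>y = \<surd>(e - a\<^sup>2)\<close> lies in the algebra. So \<open>e - a\<^sup>2\<close> is a positive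
  operator, which bounds the operator norm of \<open>a\<close>.\<close>

lemma complement_exists:
  assumes le: "N a \<le> 1"
  shows "\<exists>y\<in>S. adj y = y \<and> (a o\<^sub>L a) + (y o\<^sub>L y) = e"
proof -
  interpret \<nu>: poly_seminorm "\<lambda>p. N (ev a p)" by (rule N_poly_seminorm)
  have X: "N (ev a [:0, 1:]) \<le> 1" by (simp add: ev_X le)
  define Y where "Y n = ev a (1 - sqrt_iter n)" for n
  have Y: "Y n \<in> S" "adj (Y n) = Y n" for n
    by (simp_all add: Y_def ev_closed a ev_adj)
  let ?t = "\<lambda>n. poly (sqrt_iter n) 1"
  have le_t: "N (Y m - Y n) \<le> \<bar>?t m - ?t n\<bar>" for m n
  proof (induction m n rule: linorder_wlog)
    case (le m n)
    have "Y m - Y n = ev a (sqrt_iter n - sqrt_iter m)" by (simp add: Y_def ev_diff)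
    then show ?case using \<nu>.sqrt_iter_Cauchy[OF X le] by simp
  next
    case (sym m n)
    then show ?case using Y by (simp add: N_diff_commute[of "Y n"] abs_minus_commute)
  qed
  have "\<exists>L\<in>S. (\<lambda>n. N (Y n - L)) \<longlonglongrightarrow> 0"
  proof (rule N_complete[OF Y(1)])
    fix r :: real assume "r > 0"
    moreover have "Cauchy ?t" using sqrt_iter_at_1_convergent by (simp add: Cauchy_convergent_iff)
    ultimately obtain k where "\<And>m n. m \<ge> k \<Longrightarrow> n \<ge> k \<Longrightarrow> \<bar>?t m - ?t n\<bar> < r"
      unfolding Cauchy_def dist_real_def by meson
    then show "\<exists>k. \<forall>m\<ge>k. \<forall>n\<ge>k. N (Y m - Y n) < r"
      using le_t by (meson order_le_less_trans)
  qed
  then obtain L where L: "L \<in> S" and lim: "(\<lambda>n. N (Y n - L)) \<longlonglongrightarrow> 0" by blast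
  have zero_by_limit: "Z = 0" if "Z \<in> S" "\<And>n. N Z \<le> f n" "f \<longlonglongrightarrow> 0" for Z f
  proof -
    have "N Z \<le> 0" by (rule LIMSEQ_le_const[OF that(3)]) (use that(2) in auto)
    then show ?thesis using N_zero_iff[OF that(1)] N_nonneg[OF that(1)] by simp
  qed
  have "adj L - L = 0"
  proof (rule zero_by_limit)
    show "adj L - L \<in> S" by (intro diff adj L)
    show "N (adj L - L) \<le> N (Y n - L) + N (Y n - L)" for n
    proof -
      have "N (adj L - L) \<le> N (adj (L - Y n)) + N (Y n - L)"
        using N_add[of "adj (L - Y n)" "Y n - L"] adj diff L Y by simp
      also have "N (adj (L - Y n)) = N (Y n - L)"
        unfolding N_adj[OF diff[OF L Y(1)]] by (rule N_diff_commute[OF L Y(1)])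
      finally show ?thesis .
    qed
    show "(\<lambda>n. N (Y n - L) + N (Y n - L)) \<longlonglongrightarrow> 0"
      using tendsto_add[OF lim lim] by simp
  qed
  moreover have "((a o\<^sub>L a) + (L o\<^sub>L L)) - e = 0"
  proof (rule zero_by_limit)
    show "((a o\<^sub>L a) + (L o\<^sub>L L)) - e \<in> S" by (intro diff add compose a L unit_closed)
    let ?f = "\<lambda>n. unitary_error n + ((N L + N (Y n - L)) * N (Y n - L) + N (Y n - L) * N L)"
    show "N (((a o\<^sub>L a) + (L o\<^sub>L L)) - e) \<le> ?f n" for n
    proof -
      let ?d = "Y n - L" and ?u = "((a o\<^sub>L a) + (Y n o\<^sub>L Y n)) - e"
      have S: "?d \<in> S" "?u \<in> S" "Y n o\<^sub>L ?d \<in> S" "?d o\<^sub>L L \<in> S"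
        by (intro diff add compose a L Y unit_closed)+
      have "?u = ev a ([:0, 1:]\<^sup>2 + (1 - sqrt_iter n)\<^sup>2 - 1)"
        by (simp only: Y_def ev_diff ev_square ev_X ev_one)
      then have u: "N ?u \<le> unitary_error n" using \<nu>.sqrt_iter_error[OF X, of n] by simp
      have eq: "((a o\<^sub>L a) + (L o\<^sub>L L)) - e = ?u - ((Y n o\<^sub>L ?d) + (?d o\<^sub>L L))"
        by (simp add: compose_distribs)
      have "N (((a o\<^sub>L a) + (L o\<^sub>L L)) - e) \<le> N ?u + (N (Y n o\<^sub>L ?d) + N (?d o\<^sub>L L))"
        unfolding eq
        by (rule order_trans[OF N_diff[OF S(2) add[OF S(3,4)]] add_left_mono[OF N_add[OF S(3,4)]]])
      moreover have "N (Y n) \<le> N L + N ?d" using N_add[OF L S(1)] by simp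
      then have "N (Y n o\<^sub>L ?d) \<le> (N L + N ?d) * N ?d"
        by (rule order_trans[OF N_compose[OF Y(1) S(1)] mult_right_mono[OF _ N_nonneg[OF S(1)]]])
      moreover have "N (?d o\<^sub>L L) \<le> N ?d * N L" by (rule N_compose[OF S(1) L])
      ultimately show ?thesis using u by linarith
    qed
    have "?f \<longlonglongrightarrow> 0 + ((N L + 0) * 0 + 0 * N L)"
      by (intro tendsto_intros lim unitary_error_tendsto)
    then show "?f \<longlonglongrightarrow> 0" by simp
  qed
  ultimately show ?thesis using L by (intro bexI[of _ L]) simp_all
qed

lemma norm_le_one_if_N_le_one:
  assumes "N a \<le> 1"
  shows "norm a \<le> 1"
proof (rule norm_blinfun_bound)
  obtain y where y: "y \<in> S" "adj y = y" "(a o\<^sub>L a) + (y o\<^sub>L y) = e"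
    using complement_exists[OF assms] by blast
  fix f
  have "(norm (a f))\<^sup>2 \<le> (norm (a f))\<^sup>2 + (norm (y f))\<^sup>2" by simp
  also have "\<dots> = e f \<bullet> f"
    by (simp add: norm_square_adj sa y(2) blinfun.add_left inner_add_left flip: y(3))
  also have "\<dots> \<le> (norm f)\<^sup>2" by (rule norm_apply_unit_le)
  finally show "norm (a f) \<le> 1 * norm f" by (auto intro: power2_le_imp_le)
qed simp

text \<open>If the operator norm of \<open>a\<close> were smaller than its C*-norm, then some continuous function of
  \<open>a\<close> would vanish as an operator without vanishing in the algebra: take a function that is zero on
  \<open>[-r, r]\<close> and differs from the identity by at most \<open>r\<close>. If it vanished at \<open>a\<close> in the algebra as well,
  then \<open>\<parallel>a\<parallel> \<le> r < 1\<close> would follow.\<close>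

lemma norm_ge_one_if_N_eq_one:
  assumes N: "N a = 1"
    and norm_le_N: "\<And>X. X \<in> S \<Longrightarrow> norm X \<le> N X"
  shows "norm a \<ge> 1"
proof (rule ccontr)
  assume "\<not> norm a \<ge> 1"
  define r where "r = max (norm a) (1/2)"
  have r: "norm a \<le> r" "0 < r" "r < 1" using \<open>\<not> norm a \<ge> 1\<close> by (auto simp: r_def)
  interpret \<nu>: poly_seminorm "\<lambda>p. N (ev a p)" by (rule N_poly_seminorm)
  interpret \<mu>: poly_seminorm "\<lambda>p. norm (ev a p)" by (rule op_norm_poly_seminorm)
  have X: "N (ev a [:0, 1:]) \<le> 1" "norm (ev a [:0, 1:]) \<le> r" using N r by (simp_all add: ev_X)
  define g where "g x = x - max (- r) (min r x)" for x
  let ?i = "\<lambda>n. inverse (real (Suc n))"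
  have "\<exists>p. \<forall>x. \<bar>x\<bar> \<le> 1 \<longrightarrow> \<bar>g x - poly p x\<bar> < ?i n" for n
  proof -
    have "continuous_on {-1..1} g" unfolding g_def by (intro continuous_intros)
    then show ?thesis by (rule weierstrass_poly[of g "?i n"]) auto
  qed
  then obtain p where p: "\<And>n x. \<bar>x\<bar> \<le> 1 \<Longrightarrow> \<bar>g x - poly (p n) x\<bar> < ?i n" by metis
  define Y where "Y n = ev a (p n)" for n
  have Y: "Y n \<in> S" for n by (simp add: Y_def ev_closed a)
  have inv: "?i \<longlonglongrightarrow> 0" by (rule LIMSEQ_inverse_real_of_nat)
  have diff_le: "N (Y m - Y n) \<le> ?i m + ?i n" for m n
    unfolding Y_def ev_diff[symmetric]
  proof (rule \<nu>.unit_interval_bound[OF X(1)])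
    fix x :: real assume "\<bar>x\<bar> \<le> 1"
    then show "\<bar>poly (p m - p n) x\<bar> \<le> ?i m + ?i n" using p[of x m] p[of x n] by simp
  qed
  have "\<exists>L\<in>S. (\<lambda>n. N (Y n - L)) \<longlonglongrightarrow> 0"
  proof (rule N_complete[OF Y])
    fix d :: real assume "d > 0"
    then obtain k where k: "\<And>n. n \<ge> k \<Longrightarrow> ?i n < d/2"
      using order_tendstoD(2)[OF inv, of "d/2"] by (auto simp: eventually_sequentially)
    have "N (Y m - Y n) < d" if "m \<ge> k" "n \<ge> k" for m n
      using diff_le[of m n] k[OF that(1)] k[OF that(2)] by linarith
    then show "\<exists>k. \<forall>m\<ge>k. \<forall>n\<ge>k. N (Y m - Y n) < d" by blast
  qed
  then obtain L where L: "L \<in> S" and lim: "(\<lambda>n. N (Y n - L)) \<longlonglongrightarrow> 0" by blast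
  have "norm L \<le> 0"
  proof (rule LIMSEQ_le_const)
    show "(\<lambda>n. ?i n + N (Y n - L)) \<longlonglongrightarrow> 0" using tendsto_add[OF inv lim] by simp
    have "norm L \<le> ?i n + N (Y n - L)" for n
    proof -
      have "norm (Y n) \<le> ?i n"
        unfolding Y_def
      proof (rule \<mu>.interval_bound[OF X(2) r(2)])
        fix x :: real assume "\<bar>x\<bar> \<le> r"
        then show "\<bar>poly (p n) x\<bar> \<le> ?i n" using p[of x n] r by (simp add: g_def)
      qed
      moreover have "norm (Y n - L) \<le> N (Y n - L)" by (intro norm_le_N diff Y L)
      ultimately show ?thesis using norm_triangle_ineq4[of "Y n" "Y n - L"] by simp
    qed
    then show "\<exists>k. \<forall>n\<ge>k. norm L \<le> ?i n + N (Y n - L)" by blast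
  qed
  then have "L = 0" by simp
  have "1 \<le> r"
  proof (rule LIMSEQ_le_const)
    show "(\<lambda>n. (r + ?i n) + N (Y n - L)) \<longlonglongrightarrow> r"
      using tendsto_add[OF tendsto_add[OF tendsto_const[of r] inv] lim] by simp
    have "1 \<le> (r + ?i n) + N (Y n - L)" for n
    proof -
      have "N (ev a ([:0, 1:] - p n)) \<le> r + ?i n"
      proof (rule \<nu>.unit_interval_bound[OF X(1)])
        fix x :: real assume x: "\<bar>x\<bar> \<le> 1"
        have "\<bar>x - g x\<bar> \<le> r" using r by (auto simp: g_def)
        then show "\<bar>poly ([:0, 1:] - p n) x\<bar> \<le> r + ?i n" using p[OF x, of n] by simp
      qed
      then have "N (a - Y n) \<le> r + ?i n" by (simp only: ev_diff ev_X Y_def)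
      moreover have "N a \<le> N (a - Y n) + N (Y n)"
        using N_add[OF diff[OF a Y[of n]] Y[of n]] by simp
      ultimately show ?thesis using N \<open>L = 0\<close> by simp
    qed
    then show "\<exists>k. \<forall>n\<ge>k. 1 \<le> (r + ?i n) + N (Y n - L)" by blast
  qed
  then show False using r by simp
qed

end

lemma norm_le_N:
  assumes X: "X \<in> S"
  shows "norm X \<le> N X"
proof -
  have sa: "norm a \<le> N a" if a: "a \<in> S" "adj a = a" for a
  proof (cases "N a = 0")
    case True
    then show ?thesis using a N_zero_iff by simp
  next
    case False
    then have pos: "N a > 0" using N_nonneg[OF a(1)] by simp
    let ?b = "inverse (N a) *\<^sub>R a"
    have "norm ?b \<le> 1"
      by (rule norm_le_one_if_N_le_one) (use a pos in \<open>simp_all add: scaleR N_scaleR\<close>)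
    then show ?thesis using pos by (simp add: field_simps)
  qed
  show ?thesis
  proof (rule norm_blinfun_bound)
    fix f
    have "(norm (X f))\<^sup>2 = (adj X o\<^sub>L X) f \<bullet> f" by (rule norm_square_adj)
    also have "\<dots> \<le> norm ((adj X o\<^sub>L X) f) * norm f" by (rule norm_cauchy_schwarz)
    also have "\<dots> \<le> norm (adj X o\<^sub>L X) * norm f * norm f"
      by (intro mult_right_mono norm_blinfun) simp
    also have "\<dots> \<le> (N X)\<^sup>2 * norm f * norm f"
      using sa[of "adj X o\<^sub>L X"] X by (intro mult_right_mono) (simp_all add: compose adj N_adj_compose)
    finally have "(norm (X f))\<^sup>2 \<le> (N X * norm f)\<^sup>2"
      by (simp add: power_mult_distrib power2_eq_square ac_simps)
    then show "norm (X f) \<le> N X * norm f"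
      by (rule power2_le_imp_le) (simp add: N_nonneg X)
  qed (rule N_nonneg[OF X])
qed

lemma norm_eq_N:
  assumes X: "X \<in> S"
  shows "norm X = N X"
proof -
  have sa: "N a \<le> norm a" if a: "a \<in> S" "adj a = a" for a
  proof (cases "N a = 0")
    case False
    then have pos: "N a > 0" using N_nonneg[OF a(1)] by simp
    let ?b = "inverse (N a) *\<^sub>R a"
    have "norm ?b \<ge> 1"
      by (rule norm_ge_one_if_N_eq_one[OF _ _ _ norm_le_N])
        (use a pos in \<open>simp_all add: scaleR N_scaleR\<close>)
    then show ?thesis using pos by (simp add: field_simps)
  qed simp
  have "(N X)\<^sup>2 \<le> norm (adj X o\<^sub>L X)"
    using sa[of "adj X o\<^sub>L X"] X by (simp add: compose adj N_adj_compose)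
  also have "\<dots> \<le> (norm X)\<^sup>2"
    using norm_blinfun_compose[of "adj X" X] by (simp add: power2_eq_square)
  finally have "N X \<le> norm X" by (rule power2_le_imp_le) simp
  then show ?thesis using norm_le_N[OF X] by simp
qed

text \<open>Completeness in the C*-norm is completeness in the operator norm.\<close>

lemma closed_in_operator_norm: "closed S"
  unfolding closed_sequential_limits
proof (intro allI impI, elim conjE)
  fix X l assume X: "\<forall>n. X n \<in> S" and lim: "X \<longlonglongrightarrow> l"
  have "\<exists>L\<in>S. (\<lambda>n. N (X n - L)) \<longlonglongrightarrow> 0"
  proof (rule N_complete)
    fix r :: real assume "r > 0"
    then obtain k where "\<forall>m\<ge>k. \<forall>n\<ge>k. dist (X m) (X n) < r"
      using LIMSEQ_imp_Cauchy[OF lim] unfolding Cauchy_def by blast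
    then show "\<exists>k. \<forall>m\<ge>k. \<forall>n\<ge>k. N (X m - X n) < r"
      using X by (intro exI[of _ k]) (simp add: dist_norm norm_eq_N diff)
  qed (use X in auto)
  then obtain L where L: "L \<in> S" "(\<lambda>n. N (X n - L)) \<longlonglongrightarrow> 0" by blast
  then have "(\<lambda>n. norm (X n - L)) \<longlonglongrightarrow> 0" using X by (simp add: norm_eq_N diff)
  then have "X \<longlonglongrightarrow> L" by (rule LIM_zero_cancel[OF tendsto_norm_zero_cancel])
  then show "l \<in> S" using LIMSEQ_unique[OF lim] L by simp
qed

end


section \<open>Stabilisation of an algebra with orthogonal isometries\<close>

text \<open>Membership in closed subspaces and linear identities pass from generators to the closed span.
  The properties of the stabilisation are checked in this way on the elements \<open>a \<otimes> e\<^sub>j\<^sub>k\<close>.\<close>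

lemma closure_span_into:
  assumes f: "bounded_linear f" and T: "subspace T" "closed T"
    and G: "\<And>x. x \<in> G \<Longrightarrow> f x \<in> T" and x: "x \<in> closure (span G)"
  shows "f x \<in> T"
proof -
  have "subspace (f -` T)"
    using f T by (intro linear_subspace_vimage) (auto simp: bounded_linear.linear)
  moreover have "closed (f -` T)"
    by (rule continuous_closed_vimage[OF T(2)]) (rule linear_continuous_at[OF f])
  ultimately have "closure (span G) \<subseteq> f -` T"
    using G by (intro closure_minimal span_minimal) auto
  then show ?thesis using x by blast
qed

lemma subspace_closure:
  fixes S :: "'a::real_normed_vector set"
  assumes "subspace S"
  shows "subspace (closure S)"
  unfolding subspace_def
proof (intro conjI ballI allI)
  show "0 \<in> closure S"
    using subspace_0[OF assms] closure_subset by blast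
  fix x assume "x \<in> closure S"
  then obtain f where f: "\<And>n. f n \<in> S" "f \<longlonglongrightarrow> x" by (auto simp: closure_sequential)
  show "x + y \<in> closure S" if y: "y \<in> closure S" for y
  proof -
    obtain g where g: "\<And>n. g n \<in> S" "g \<longlonglongrightarrow> y" using y by (auto simp: closure_sequential)
    show ?thesis
      unfolding closure_sequential
      by (rule exI[of _ "\<lambda>n. f n + g n"]) (simp add: f g tendsto_add subspace_add[OF assms])
  qed
  show "c *\<^sub>R x \<in> closure S" for c
    unfolding closure_sequential
    by (rule exI[of _ "\<lambda>n. c *\<^sub>R f n"]) (simp add: f tendsto_scaleR subspace_scale[OF assms])
qed

lemma bounded_linear_compose_left: "bounded_linear (\<lambda>X. R o\<^sub>L X)"
  by (rule bounded_bilinear.bounded_linear_right[OF bounded_bilinear_blinfun_compose])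

lemma bounded_linear_compose_right: "bounded_linear (\<lambda>X. X o\<^sub>L R)"
  by (rule bounded_bilinear.bounded_linear_left[OF bounded_bilinear_blinfun_compose])

lemma subspace_clin: "subspace {X. clin X}"
  by (auto simp: subspace_def intro: clin_zero clin_add clin_scaleR)

lemma closed_clin: "closed {X :: 'i ell2 \<Rightarrow>\<^sub>L 'j ell2. clin X}"
proof -
  have "{X :: 'i ell2 \<Rightarrow>\<^sub>L 'j ell2. clin X} = (\<Inter>c. {X. X o\<^sub>L cscale c = cscale c o\<^sub>L X})"
    by (auto simp: clin_def)
  moreover have "closed {X :: 'i ell2 \<Rightarrow>\<^sub>L 'j ell2. X o\<^sub>L cscale c = cscale c o\<^sub>L X}" for c
    by (intro closed_Collect_eq linear_continuous_on bounded_linear_compose_left bounded_linear_compose_right)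
  ultimately show ?thesis by auto
qed

lemma compose_left_amp_emb: "left_amp X o\<^sub>L (emb j o\<^sub>L Y) = emb j o\<^sub>L (X o\<^sub>L Y)"
  by (metis compose_assoc left_amp_emb)

lemma col_adj_left_amp: "col j o\<^sub>L adj (left_amp X) = adj X o\<^sub>L col j"
  using arg_cong[OF left_amp_emb[of X j], of adj] by simp

lemma adj_left_amp_emb: "adj (left_amp X) o\<^sub>L emb j = emb j o\<^sub>L adj X"
  using arg_cong[OF col_left_amp[of j X], of adj] by simp

lemma compose_col_emb: "col j o\<^sub>L (emb k o\<^sub>L X) = (if j = k then X else 0)"
proof -
  have "col j o\<^sub>L (emb k o\<^sub>L X) = (col j o\<^sub>L emb k) o\<^sub>L X" by (simp only: compose_assoc)
  then show ?thesis by (auto simp: col_emb intro!: blinfun_eqI)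
qed

text \<open>The operator \<open>X \<otimes> e\<^sub>j\<^sub>k\<close>.\<close>

definition matrix_entry ::
  "'j \<Rightarrow> ('i ell2 \<Rightarrow>\<^sub>L 'i ell2) \<Rightarrow> 'j \<Rightarrow> (('i \<times> 'j) ell2 \<Rightarrow>\<^sub>L ('i \<times> 'j) ell2)" where
  "matrix_entry j X k = emb j o\<^sub>L (X o\<^sub>L col k)"

definition stabilised :: "('i ell2 \<Rightarrow>\<^sub>L 'i ell2) set \<Rightarrow> (('i \<times> 'j) ell2 \<Rightarrow>\<^sub>L ('i \<times> 'j) ell2) set" where
  "stabilised S = closure (span {matrix_entry j X k | j X k. X \<in> S})"

lemma matrix_entry_mult: "matrix_entry j X k o\<^sub>L matrix_entry l Y m = (if k = l then matrix_entry j (X o\<^sub>L Y) m else 0)"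
  by (simp add: matrix_entry_def compose_assoc compose_col_emb)

lemma matrix_entry_adj: "adj (matrix_entry j X k) = matrix_entry k (adj X) j"
  by (simp add: matrix_entry_def compose_assoc)

lemma matrix_entry_cscale: "cscale c o\<^sub>L matrix_entry j X k = matrix_entry j (cscale c o\<^sub>L X) k"
  by (simp add: matrix_entry_def compose_assoc clin_comm'[OF clin_emb])

lemma clin_matrix_entry: "clin X \<Longrightarrow> clin (matrix_entry j X k)"
  unfolding matrix_entry_def by (intro clin_compose clin_emb clin_col)

lemma matrix_entry_in_stabilised: "X \<in> S \<Longrightarrow> matrix_entry j X k \<in> stabilised S"
  unfolding stabilised_def by (rule subsetD[OF closure_subset], rule span_base) blast

lemma subspace_stabilised: "subspace (stabilised S)"
  unfolding stabilised_def by (intro subspace_closure subspace_span)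

lemma closed_stabilised: "closed (stabilised S)"
  by (simp add: stabilised_def)

lemma stabilised_into:
  assumes "bounded_linear f" "subspace T" "closed T"
    and "\<And>j X k. X \<in> S \<Longrightarrow> f (matrix_entry j X k) \<in> T" and "Y \<in> stabilised S"
  shows "f Y \<in> T"
  using closure_span_into[OF assms(1-3), of "{matrix_entry j X k | j X k. X \<in> S}" Y] assms(4,5)
  by (auto simp: stabilised_def)

lemma stabilised_eq:
  assumes "bounded_linear f" "bounded_linear g"
    and "\<And>j X k. X \<in> S \<Longrightarrow> f (matrix_entry j X k) = g (matrix_entry j X k)" and "Y \<in> stabilised S"
  shows "f Y = g Y"
proof -
  have "f Y - g Y \<in> {0}"
    by (rule stabilised_into[OF bounded_linear_sub[OF assms(1,2)] _ _ _ assms(4)])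
      (auto simp: assms(3) subspace_def)
  then show ?thesis by simp
qed

lemma (in op_star_algebra) stabilised_star_algebra: "op_star_algebra (stabilised S)"
proof
  note into = stabilised_into[OF _ subspace_stabilised closed_stabilised]
  show "clin X" if "X \<in> stabilised S" for X
    using stabilised_into[OF bounded_linear_ident subspace_clin closed_clin _ that]
    by (simp add: clin_matrix_entry clin)
  show "0 \<in> stabilised S" by (rule subspace_0[OF subspace_stabilised])
  show "X + Y \<in> stabilised S" if "X \<in> stabilised S" "Y \<in> stabilised S" for X Y
    by (rule subspace_add[OF subspace_stabilised that])
  show "X o\<^sub>L Y \<in> stabilised S" if X: "X \<in> stabilised S" and Y: "Y \<in> stabilised S" for X Y
  proof (rule into[OF bounded_linear_compose_right _ X])
    fix j Z k assume Z: "Z \<in> S"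
    show "matrix_entry j Z k o\<^sub>L Y \<in> stabilised S"
      by (rule into[OF bounded_linear_compose_left _ Y])
        (auto simp: matrix_entry_mult Z compose subspace_0[OF subspace_stabilised]
          intro: matrix_entry_in_stabilised)
  qed
  show "adj X \<in> stabilised S" if "X \<in> stabilised S" for X
    by (rule into[OF bounded_linear_adj _ that])
      (simp add: matrix_entry_adj adj matrix_entry_in_stabilised)
  show "cscale c o\<^sub>L X \<in> stabilised S" if "X \<in> stabilised S" for X c
    by (rule into[OF bounded_linear_compose_left _ that])
      (simp add: matrix_entry_cscale cscale matrix_entry_in_stabilised)
qed

lemma stabilised_left_mult:
  assumes w: "\<And>j X k. X \<in> S \<Longrightarrow> w o\<^sub>L matrix_entry j X k \<in> stabilised S" and "Y \<in> stabilised S"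
  shows "w o\<^sub>L Y \<in> stabilised S"
  by (rule stabilised_into[OF bounded_linear_compose_left subspace_stabilised closed_stabilised w assms(2)])

text \<open>A pair of isometries with orthogonal ranges in a unital algebra. The products
  \<open>isom j = \<tau>\<^sup>j \<sigma>\<close> form an infinite sequence of isometries with pairwise orthogonal ranges.\<close>

locale orthogonal_isometries = unital_represented S \<theta> B e
  for S :: "('i ell2 \<Rightarrow>\<^sub>L 'i ell2) set" and \<theta> and B :: "'u cstar_alg" and e +
  fixes \<sigma> \<tau> :: "'i ell2 \<Rightarrow>\<^sub>L 'i ell2"
  assumes \<sigma>_closed: "\<sigma> \<in> S" and \<tau>_closed: "\<tau> \<in> S"
    and \<sigma>_isom: "adj \<sigma> o\<^sub>L \<sigma> = e" and \<tau>_isom: "adj \<tau> o\<^sub>L \<tau> = e" and orth: "adj \<sigma> o\<^sub>L \<tau> = 0"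
begin

lemma multiplier_of_isometry: "V \<in> S \<Longrightarrow> adj V o\<^sub>L V = e \<Longrightarrow> isometric_multiplier S V"
  unfolding isometric_multiplier_def
  by (simp add: clin compose unit_left flip: compose_assoc)

sublocale orthogonal_multipliers S \<theta> B \<sigma> \<tau>
  by unfold_locales
    (auto intro: multiplier_of_isometry \<sigma>_closed \<tau>_closed \<sigma>_isom \<tau>_isom orth)

primrec isom :: "nat \<Rightarrow> 'i ell2 \<Rightarrow>\<^sub>L 'i ell2" where
  "isom 0 = \<sigma>"
| "isom (Suc n) = \<tau> o\<^sub>L isom n"

lemma isom_closed: "isom n \<in> S"
  by (induction n) (auto intro: compose \<sigma>_closed \<tau>_closed)

lemma isom_orthogonal: "adj (isom j) o\<^sub>L isom k = (if j = k then e else 0)"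
proof (induction j arbitrary: k)
  case 0
  show ?case by (cases k) (simp_all add: \<sigma>_isom orth_rules)
next
  case (Suc j)
  show ?case
  proof (cases k)
    case 0
    then show ?thesis by (simp add: compose_assoc orth')
  next
    case (Suc l)
    then show ?thesis
      using Suc.IH[of l] by (simp add: compose_assoc multiplier_rules isom_closed)
  qed
qed

lemma norm_isom_le: "norm (isom j f) \<le> norm f"
proof (rule power2_le_imp_le)
  show "(norm (isom j f))\<^sup>2 \<le> (norm f)\<^sup>2"
    unfolding norm_square_adj isom_orthogonal by (simp add: norm_apply_unit_le)
qed simp

text \<open>The row operator \<open>(isom 0, isom 1, \<dots>)\<close>. It is constructed through its adjoint, the column of
  the \<open>adj (isom j)\<close>.\<close>

definition row_op :: "('i \<times> nat) ell2 \<Rightarrow>\<^sub>L 'i ell2" where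
  "row_op = adj (stack (\<lambda>j. adj (isom j)))"

lemma col_adj_row: "col j o\<^sub>L adj row_op = adj (isom j)"
proof -
  have "(\<Sum>j\<in>F. (norm (adj (isom j) f))\<^sup>2) \<le> (1 * norm f)\<^sup>2" if "finite F" for F f
    using bessel[of isom F f] that by (simp add: isom_orthogonal norm_isom_le)
  from col_stack[OF this, of j] show ?thesis by (simp add: row_op_def)
qed

lemma row_emb: "row_op o\<^sub>L emb j = isom j"
  using arg_cong[OF col_adj_row[of j], of adj] by simp

lemma row_emb': "row_op o\<^sub>L (emb j o\<^sub>L X) = isom j o\<^sub>L X"
  using row_emb by (metis compose_assoc)

lemma clin_row: "clin row_op"
proof -
  have "clin (adj row_op)"
    by (rule clin_by_col) (simp add: col_adj_row clin_adj clin isom_closed)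
  from clin_adj[OF this] show ?thesis by simp
qed

lemma row_matrix_entry: "row_op o\<^sub>L matrix_entry j X k = isom j o\<^sub>L (X o\<^sub>L col k)"
  by (simp add: matrix_entry_def row_emb')

text \<open>On the generators this is the orthogonality of the isometries; \<open>W\<^sup>* W\<close> is the diagonal matrix with
  entries \<open>e\<close>.\<close>

lemma adj_row_row:
  assumes "Y \<in> stabilised S"
  shows "adj row_op o\<^sub>L (row_op o\<^sub>L Y) = Y"
proof -
  have "(adj row_op o\<^sub>L row_op) o\<^sub>L Y = Y"
  proof (rule stabilised_eq[OF bounded_linear_compose_left bounded_linear_ident _ assms])
    fix j k X assume X: "X \<in> S"
    show "(adj row_op o\<^sub>L row_op) o\<^sub>L matrix_entry j X k = matrix_entry j X k"
    proof (rule blinfun_eq_by_col)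
      fix l
      have "col l o\<^sub>L ((adj row_op o\<^sub>L row_op) o\<^sub>L matrix_entry j X k)
          = (col l o\<^sub>L adj row_op) o\<^sub>L (row_op o\<^sub>L matrix_entry j X k)"
        by (simp only: compose_assoc)
      also have "\<dots> = (adj (isom l) o\<^sub>L isom j) o\<^sub>L (X o\<^sub>L col k)"
        by (simp only: col_adj_row row_matrix_entry compose_assoc)
      also have "\<dots> = (if l = j then X o\<^sub>L col k else 0)"
        by (simp add: isom_orthogonal unit_left[OF X] flip: compose_assoc)
      also have "\<dots> = col l o\<^sub>L matrix_entry j X k"
        by (simp add: matrix_entry_def compose_col_emb)
      finally show "col l o\<^sub>L ((adj row_op o\<^sub>L row_op) o\<^sub>L matrix_entry j X k) = col l o\<^sub>L matrix_entry j X k" .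
    qed
  qed
  then show ?thesis by (simp add: compose_assoc)
qed

text \<open>The generator \<open>X \<otimes> e\<^sub>j\<^sub>k\<close> is sent to \<open>isom j X (isom k)\<^sup>*\<close>. For limits, the algebra has to be closed in
  the operator norm.\<close>

lemma row_into:
  assumes "Y \<in> stabilised S"
  shows "row_op o\<^sub>L (Y o\<^sub>L adj row_op) \<in> S"
proof (rule stabilised_into[OF _ _ closed_in_operator_norm _ assms, where f = "\<lambda>Y. row_op o\<^sub>L (Y o\<^sub>L adj row_op)"])
  show "bounded_linear (\<lambda>Y. row_op o\<^sub>L (Y o\<^sub>L adj row_op))"
    by (rule bounded_linear_compose[OF bounded_linear_compose_left bounded_linear_compose_right])
  show "subspace S"
    by (auto simp: subspace_def zero add scaleR)
  fix j X k assume "X \<in> S"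
  moreover have "row_op o\<^sub>L (matrix_entry j X k o\<^sub>L adj row_op) = isom j o\<^sub>L (X o\<^sub>L adj (isom k))"
    by (simp add: matrix_entry_def compose_assoc row_emb' col_adj_row)
  ultimately show "row_op o\<^sub>L (matrix_entry j X k o\<^sub>L adj row_op) \<in> S"
    by (simp add: compose adj isom_closed)
qed

lemma emb_row_multiplier: "isometric_multiplier (stabilised S) (emb 0 o\<^sub>L row_op)"
  unfolding isometric_multiplier_def
proof (intro conjI ballI)
  show "clin (emb 0 o\<^sub>L row_op)" by (intro clin_compose clin_emb clin_row)
  fix Y :: "('i \<times> nat) ell2 \<Rightarrow>\<^sub>L ('i \<times> nat) ell2" assume Y: "Y \<in> stabilised S"
  show "(emb 0 o\<^sub>L row_op) o\<^sub>L Y \<in> stabilised S"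
  proof (rule stabilised_left_mult[OF _ Y])
    fix j X k assume X: "X \<in> S"
    have "(emb 0 o\<^sub>L row_op) o\<^sub>L matrix_entry j X k = matrix_entry 0 (isom j o\<^sub>L X) k"
      by (simp add: compose_assoc row_matrix_entry) (simp add: matrix_entry_def compose_assoc)
    then show "(emb 0 o\<^sub>L row_op) o\<^sub>L matrix_entry j X k \<in> stabilised S"
      using X by (simp add: matrix_entry_in_stabilised compose isom_closed)
  qed
  show "adj (emb 0 o\<^sub>L row_op) o\<^sub>L ((emb 0 o\<^sub>L row_op) o\<^sub>L Y) = Y"
    using adj_row_row[OF Y] by (simp add: compose_assoc compose_col_emb)
qed

lemma left_amp_multiplier:
  assumes V: "V \<in> S" "adj V o\<^sub>L V = e"
  shows "isometric_multiplier (stabilised S :: (('i \<times> 'j) ell2 \<Rightarrow>\<^sub>L ('i \<times> 'j) ell2) set) (left_amp V)"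
  unfolding isometric_multiplier_def
proof (intro conjI ballI)
  show "clin (left_amp V)" by (intro clin_left_amp clin V)
  fix Y :: "('i \<times> 'j) ell2 \<Rightarrow>\<^sub>L ('i \<times> 'j) ell2" assume Y: "Y \<in> stabilised S"
  show "left_amp V o\<^sub>L Y \<in> stabilised S"
  proof (rule stabilised_left_mult[OF _ Y])
    fix j X k assume X: "X \<in> S"
    have "left_amp V o\<^sub>L matrix_entry j X k = matrix_entry j (V o\<^sub>L X) k"
      by (simp add: matrix_entry_def compose_left_amp_emb compose_assoc)
    then show "left_amp V o\<^sub>L matrix_entry j X k \<in> stabilised S"
      using X V by (simp add: matrix_entry_in_stabilised compose)
  qed
  have "(adj (left_amp V) o\<^sub>L left_amp V) o\<^sub>L Y = Y"
  proof (rule stabilised_eq[OF bounded_linear_compose_left bounded_linear_ident _ Y])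
    fix j k X assume X: "X \<in> S"
    have "(adj (left_amp V) o\<^sub>L left_amp V) o\<^sub>L matrix_entry j X k
        = (adj (left_amp V) o\<^sub>L emb j) o\<^sub>L (V o\<^sub>L (X o\<^sub>L col k))"
      by (simp only: matrix_entry_def compose_assoc compose_left_amp_emb)
    also have "\<dots> = emb j o\<^sub>L (((adj V o\<^sub>L V) o\<^sub>L X) o\<^sub>L col k)"
      by (simp only: adj_left_amp_emb compose_assoc)
    also have "\<dots> = matrix_entry j X k"
      by (simp add: V unit_left X matrix_entry_def)
    finally show "(adj (left_amp V) o\<^sub>L left_amp V) o\<^sub>L matrix_entry j X k = matrix_entry j X k" .
  qed
  then show "adj (left_amp V) o\<^sub>L (left_amp V o\<^sub>L Y) = Y" by (simp add: compose_assoc)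
qed

lemma left_amp_orth: "adj (left_amp \<sigma>) o\<^sub>L left_amp \<tau> = 0"
proof (rule blinfun_eq_by_col)
  fix j
  have "col j o\<^sub>L (adj (left_amp \<sigma>) o\<^sub>L left_amp \<tau>) = (adj \<sigma> o\<^sub>L col j) o\<^sub>L left_amp \<tau>"
    by (simp only: col_adj_left_amp flip: compose_assoc)
  also have "\<dots> = (adj \<sigma> o\<^sub>L \<tau>) o\<^sub>L col j" by (simp only: compose_assoc col_left_amp)
  finally show "col j o\<^sub>L (adj (left_amp \<sigma>) o\<^sub>L left_amp \<tau>) = col j o\<^sub>L 0" by (simp add: orth)
qed

text \<open>Corner inclusion and conjugation by the row operator are inverse to each other up to
  conjugations by isometric multipliers, one of the algebra and one of its stabilisation.\<close>

theorem stable_functor_corner_iso: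
  assumes E: "cstar_functor E Emap" and stable: "M2_stable E Emap"
    and P: "represented (stabilised S :: (('i \<times> nat) ell2 \<Rightarrow>\<^sub>L ('i \<times> nat) ell2) set) \<phi> (P :: 'u cstar_alg)"
  shows "Emap B P (conj_map S \<theta> B \<phi> (emb 0)) \<in> iso (E B) (E P)"
proof -
  interpret E: cstar_functor E Emap by fact
  interpret P: represented "stabilised S" \<phi> P by fact
  have rep: "represented S \<theta> B" ..
  let ?in = "conj_map S \<theta> B \<phi> (emb 0)" and ?out = "conj_map (stabilised S) \<phi> P \<theta> row_op"
  interpret Q: orthogonal_multipliers "stabilised S" \<phi> P "left_amp \<sigma>" "left_amp \<tau>"
    by unfold_locales
      (auto intro: left_amp_multiplier \<sigma>_closed \<tau>_closed \<sigma>_isom \<tau>_isom left_amp_orth)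
  have in_into: "emb 0 o\<^sub>L (X o\<^sub>L adj (emb 0)) \<in> stabilised S" if "X \<in> S" for X
    using matrix_entry_in_stabilised[OF that, of 0 0] by (simp add: matrix_entry_def)
  have in_hom: "?in \<in> star_hom B P"
    by (rule conj_map_hom[OF rep P clin_emb in_into]) (simp_all add: compose_col_emb)
  have out_hom: "?out \<in> star_hom P B"
    by (rule conj_map_hom[OF P rep clin_row row_into adj_row_row])
  have "compose (carrier B) ?out ?in = conj_map S \<theta> B \<theta> (row_op o\<^sub>L emb 0)"
    by (rule conj_map_compose[OF rep P in_into])
  also have "row_op o\<^sub>L emb 0 = \<sigma>" by (simp add: row_emb)
  finally have out_in: "compose (carrier B) ?out ?in = conj_map S \<theta> B \<theta> \<sigma>" .
  have in_out: "compose (carrier P) ?in ?out = conj_map (stabilised S) \<phi> P \<phi> (emb 0 o\<^sub>L row_op)"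
    by (rule conj_map_compose[OF P rep row_into])
  have left: "Emap P B ?out (Emap B P ?in x) = x" if "x \<in> carrier (E B)" for x
    using E.map_compose[OF cstar P.cstar cstar in_hom out_hom that]
      stable_functor_conj_map[OF E stable \<sigma> that] by (simp add: out_in)
  have right: "Emap B P ?in (Emap P B ?out y) = y" if "y \<in> carrier (E P)" for y
    using E.map_compose[OF P.cstar cstar P.cstar out_hom in_hom that]
      Q.stable_functor_conj_map[OF E stable emb_row_multiplier that] by (simp add: in_out)
  have hom: "Emap B P ?in \<in> hom (E B) (E P)" "Emap P B ?out \<in> hom (E P) (E B)"
    by (intro E.map_hom cstar P.cstar in_hom out_hom)+
  have "bij_betw (Emap B P ?in) (carrier (E B)) (carrier (E P))"
    by (rule bij_betw_byWitness[where f' = "Emap P B ?out"])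
      (use left right hom in \<open>auto simp: hom_def\<close>)
  then show ?thesis using hom by (simp add: iso_def)
qed

end


section \<open>The spatial tensor product with the compact operators\<close>

lemma right_amp_add: "right_amp (S + T) = right_amp S + right_amp T"
  by (metis add_diff_cancel_right' diff_add_cancel right_amp_diff)

lemma right_amp_zero: "right_amp 0 = 0"
  using right_amp_diff[of 0 0] by simp

lemma op_tensor_sum:
  assumes "clin S" "\<And>i. i \<in> F \<Longrightarrow> clin (T i)"
  shows "op_tensor S (\<Sum>i\<in>F. T i) = (\<Sum>i\<in>F. op_tensor S (T i))"
proof -
  have "left_amp S o\<^sub>L right_amp (\<Sum>i\<in>F. T i) = (\<Sum>i\<in>F. left_amp S o\<^sub>L right_amp (T i))"
    by (induction F rule: infinite_finite_induct)
      (simp_all add: right_amp_add right_amp_zero compose_distribs)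
  then show ?thesis using assms by (simp add: op_tensor_eq_amp clin_sum)
qed

lemma op_tensor_cscale:
  assumes "clin S" "clin T"
  shows "op_tensor S (cscale c o\<^sub>L T) = op_tensor (cscale c o\<^sub>L S) T"
proof (rule op_tensor_unique)
  show "clin (op_tensor (cscale c o\<^sub>L S) T)"
    using assms by (simp add: op_tensor_eq_amp clin_compose clin_left_amp clin_right_amp clin_cscale)
  fix f g
  have "op_tensor (cscale c o\<^sub>L S) T (ell2_tensor f g) = ell2_tensor ((cscale c o\<^sub>L S) f) (T g)"
    using assms
    by (simp add: op_tensor_eq_amp clin_compose clin_cscale right_amp_def left_amp_tensor swap_op_tensor)
  then show "op_tensor (cscale c o\<^sub>L S) T (ell2_tensor f g) = ell2_tensor (S f) ((cscale c o\<^sub>L T) g)"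
    by (auto intro!: ell2_eqI)
qed

text \<open>Since a compact operator is a limit of finite matrices, the spatial tensor product is generated
  by the elementary tensors with matrix units.\<close>

lemma (in op_star_algebra) closure_span_tensor_compact:
  "closure (span {op_tensor X T | X T. X \<in> S \<and> T \<in> carrier (compact_ops :: (nat ell2 \<Rightarrow>\<^sub>L nat ell2) cstar_alg)})
    = stabilised S"
proof (intro equalityI)
  let ?G = "{op_tensor X T | X T. X \<in> S \<and> T \<in> carrier (compact_ops :: (nat ell2 \<Rightarrow>\<^sub>L nat ell2) cstar_alg)}"
  have entry: "matrix_entry j X k = op_tensor X (matrix_unit j k)" if "X \<in> S" for j k :: nat and X
    by (simp add: op_tensor_matrix_unit clin that matrix_entry_def compose_assoc)
  have "{matrix_entry j X k | j X k. X \<in> S} \<subseteq> ?G"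
  proof safe
    fix j k :: nat and X assume "X \<in> S"
    then show "\<exists>X' T. matrix_entry j X k = op_tensor X' T \<and> X' \<in> S \<and> T \<in> carrier compact_ops"
      using entry matrix_unit_in_compact_ops by (intro exI[of _ X] exI[of _ "matrix_unit j k"]) simp
  qed
  then show "stabilised S \<subseteq> closure (span ?G)"
    unfolding stabilised_def by (intro closure_mono span_mono)
  have "op_tensor X T \<in> stabilised S" if X: "X \<in> S" and T: "T \<in> carrier compact_ops" for X and T :: "nat ell2 \<Rightarrow>\<^sub>L nat ell2"
  proof -
    have T': "clin T" "compact (closure (blinfun_apply T ` cball 0 1))"
      using T by (auto simp: compact_ops_def)
    have trunc_clin: "clin (trunc n o\<^sub>L T o\<^sub>L trunc n)" for n
      unfolding trunc_def by (intro clin_compose clin_sum clin_matrix_unit T')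
    have approx: "op_tensor X (trunc n o\<^sub>L T o\<^sub>L trunc n) \<in> stabilised S" for n
    proof -
      let ?c = "\<lambda>j k. ell2_nth (T (ell2_unit k)) j"
      have "op_tensor X (trunc n o\<^sub>L T o\<^sub>L trunc n)
          = (\<Sum>j<n. \<Sum>k<n. op_tensor (cscale (?c j k) o\<^sub>L X) (matrix_unit j k))"
        unfolding trunc_compose_trunc[OF T'(1)]
        by (simp add: op_tensor_sum op_tensor_cscale clin X clin_sum clin_compose clin_cscale clin_matrix_unit)
      also have "\<dots> = (\<Sum>j<n. \<Sum>k<n. matrix_entry j (cscale (?c j k) o\<^sub>L X) k)"
        by (intro sum.cong refl entry[symmetric] cscale X)
      also have "\<dots> \<in> stabilised S"
        by (intro subspace_sum[OF subspace_stabilised] matrix_entry_in_stabilised cscale X)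
      finally show ?thesis .
    qed
    have "op_tensor X T \<in> closure (stabilised S)"
      unfolding closure_approachable
    proof (intro allI impI)
      fix r :: real assume "r > 0"
      then obtain n where n: "norm (T - (trunc n o\<^sub>L T o\<^sub>L trunc n)) < r / (norm X + 1)"
        using compact_op_approx[OF T'(2), of "r / (norm X + 1)"] norm_ge_zero[of X]
        by (metis add_nonneg_pos divide_pos_pos zero_less_one)
      let ?t = "trunc n o\<^sub>L T o\<^sub>L trunc n"
      have "norm (op_tensor X T - op_tensor X ?t) = norm (left_amp X o\<^sub>L right_amp (T - ?t))"
        using X T' trunc_clin by (simp add: op_tensor_eq_amp clin right_amp_diff compose_distribs)
      also have "\<dots> \<le> norm X * norm (T - ?t)"
        by (rule order_trans[OF norm_blinfun_compose])
          (intro mult_mono norm_left_amp norm_right_amp norm_ge_zero)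
      also have "\<dots> \<le> (norm X + 1) * norm (T - ?t)"
        by (intro mult_right_mono) auto
      also have "\<dots> < r"
        using n norm_ge_zero[of X] by (simp add: pos_less_divide_eq mult.commute)
      finally show "\<exists>y\<in>stabilised S. dist y (op_tensor X T) < r"
        by (intro bexI[OF _ approx[of n]]) (simp only: dist_norm norm_minus_commute)
    qed
    then show ?thesis by (simp only: closure_closed[OF closed_stabilised])
  qed
  then have "?G \<subseteq> stabilised S" by blast
  then show "closure (span ?G) \<subseteq> stabilised S"
    by (intro closure_minimal span_minimal subspace_stabilised closed_stabilised)
qed

text \<open>The image of a faithful representation with the inverse of the representation, which is an
  algebraic isomorphism; its continuity is a consequence of \<open>norm_eq_N\<close>.\<close>

lemma faithful_rep_represented:
  assumes A: "cstar_algebra A" and \<pi>: "faithful_rep A \<pi>"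
  shows "represented (\<pi> ` carrier A) (restrict (inv_into (carrier A) \<pi>) (\<pi> ` carrier A)) A"
proof -
  interpret cstar_algebra A by fact
  let ?S = "\<pi> ` carrier A" and ?\<theta> = "restrict (inv_into (carrier A) \<pi>) (\<pi> ` carrier A)"
  have inj: "inj_on \<pi> (carrier A)" using \<pi> by (simp add: faithful_rep_def)
  have \<theta>: "?\<theta> (\<pi> x) = x" if "x \<in> carrier A" for x
    using that inj by simp
  have clin: "clin (\<pi> x)" if "x \<in> carrier A" for x
    using \<pi> that by (auto simp: faithful_rep_def star_hom_def)
  have hom: "\<pi> (aplus A x y) = \<pi> x + \<pi> y" "\<pi> (amult A x y) = \<pi> x o\<^sub>L \<pi> y"
      "\<pi> (ascale A c x) = cscale c o\<^sub>L \<pi> x" "\<pi> (astar A x) = adj (\<pi> x)"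
    if "x \<in> carrier A" "y \<in> carrier A" for x y c
    using \<pi> that by (auto simp: faithful_rep_def star_hom_def adjoint_op_eq_adj[OF clin])
  have zero: "\<pi> (azero A) = 0"
    using hom(1)[OF zero_closed zero_closed] by (simp add: zero_plus zero_closed)
  have alg: "op_star_algebra ?S"
  proof
    show "clin X" if "X \<in> ?S" for X using that clin by blast
    show "0 \<in> ?S" using zero zero_closed by (metis image_eqI)
    show "X + Y \<in> ?S" if "X \<in> ?S" "Y \<in> ?S" for X Y
      using that by (auto simp: hom(1)[symmetric] plus_closed)
    show "X o\<^sub>L Y \<in> ?S" if "X \<in> ?S" "Y \<in> ?S" for X Y
      using that by (auto simp: hom(2)[symmetric] mult_closed)
    show "adj X \<in> ?S" if "X \<in> ?S" for X
      using that by (auto simp: hom(4)[symmetric] star_closed)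
    show "cscale c o\<^sub>L X \<in> ?S" if "X \<in> ?S" for X c
      using that by (auto simp: hom(3)[symmetric] scale_closed)
  qed
  have "?\<theta> \<in> star_iso (op_alg ?S) A"
    unfolding star_iso_def star_hom_def
  proof (intro CollectI conjI)
    show "bij_betw ?\<theta> (carrier (op_alg ?S)) (carrier A)"
      using bij_betw_inv_into[OF inj_on_imp_bij_betw[OF inj]] by simp
    show "?\<theta> \<in> carrier (op_alg ?S) \<rightarrow>\<^sub>E carrier A"
      using \<theta> by auto
  qed (auto simp: \<theta> adjoint_op_eq_adj[OF clin] hom[symmetric] plus_closed mult_closed scale_closed
      star_closed simp del: restrict_apply restrict_apply')
  then show ?thesis
    using alg A by (intro represented.intro represented_axioms.intro)
qed

theorem proposition2p2:
  fixes E :: "'u cstar_alg \<Rightarrow> 'g monoid"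
    and Emap :: "'u cstar_alg \<Rightarrow> 'u cstar_alg \<Rightarrow> ('u \<Rightarrow> 'u) \<Rightarrow> 'g \<Rightarrow> 'g"
    and A :: "'u cstar_alg"
    and \<pi> :: "'u \<Rightarrow> ('i ell2 \<Rightarrow>\<^sub>L 'i ell2)"
    and K :: "(nat ell2 \<Rightarrow>\<^sub>L nat ell2) cstar_alg"
    and AK :: "(('i \<times> nat) ell2 \<Rightarrow>\<^sub>L ('i \<times> nat) ell2) cstar_alg"
    and j :: "'u \<Rightarrow> (('i \<times> nat) ell2 \<Rightarrow>\<^sub>L ('i \<times> nat) ell2)"
    and P :: "'u cstar_alg"
    and \<theta> :: "(('i \<times> nat) ell2 \<Rightarrow>\<^sub>L ('i \<times> nat) ell2) \<Rightarrow> 'u"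
  assumes "cstar_functor E Emap"
    and "M2_stable E Emap"
    and "cstar_algebra A"
    and "properly_infinite A"
    and "faithful_rep A \<pi>"
  defines "K \<equiv> compact_ops"
    and "AK \<equiv> spatial_tensor A K \<pi> (restrict id (carrier K))"
    and "j \<equiv> (\<lambda>a\<in>carrier A. op_tensor (\<pi> a) (matrix_unit 0 0))"
  assumes "cstar_algebra P"
    and "\<theta> \<in> star_iso AK P"
  shows "Emap A P (compose (carrier A) \<theta> j) \<in> iso (E A) (E P)"
proof -
  let ?S = "\<pi> ` carrier A"
  let ?\<theta> = "restrict (inv_into (carrier A) \<pi>) ?S"
  interpret R: represented ?S ?\<theta> A
    by (rule faithful_rep_represented) fact+
  have inj: "inj_on \<pi> (carrier A)"
    using \<open>faithful_rep A \<pi>\<close> by (simp add: faithful_rep_def)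
  have pre: "R.pre a = \<pi> a" if "a \<in> carrier A" for a
    using R.pre_map[of "\<pi> a"] that inj by simp
  obtain e where e_closed: "e \<in> carrier A"
    and e_unit: "\<forall>x\<in>carrier A. amult A e x = x \<and> amult A x e = x"
    and isometries: "\<exists>s\<in>carrier A. \<exists>t\<in>carrier A. amult A (astar A s) s = e \<and> amult A (astar A t) t = e \<and>
      amult A (amult A s (astar A s)) (amult A t (astar A t)) = azero A"
    using \<open>properly_infinite A\<close> unfolding properly_infinite_def
    by (rule bexE) (elim conjE, rule that)
  note e = e_closed bspec[OF e_unit, THEN conjunct1] bspec[OF e_unit, THEN conjunct2]
  obtain s where s: "s \<in> carrier A" and ex_t: "\<exists>t\<in>carrier A. amult A (astar A s) s = e \<and> amult A (astar A t) t = e \<and>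
      amult A (amult A s (astar A s)) (amult A t (astar A t)) = azero A"
    using isometries by (rule bexE)
  obtain t where t: "t \<in> carrier A" and rel: "amult A (astar A s) s = e \<and> amult A (astar A t) t = e \<and>
      amult A (amult A s (astar A s)) (amult A t (astar A t)) = azero A"
    using ex_t by (rule bexE)
  note st = s t rel[THEN conjunct1] rel[THEN conjunct2, THEN conjunct1] rel[THEN conjunct2, THEN conjunct2]
  have \<pi>_mult: "\<pi> x o\<^sub>L \<pi> y = \<pi> (amult A x y)" if "x \<in> carrier A" "y \<in> carrier A" for x y
    using R.pre_mult[OF that] that by (simp only: pre R.mult_closed)
  have \<pi>_star: "adj (\<pi> x) = \<pi> (astar A x)" if "x \<in> carrier A" for x
    using R.pre_star[OF that] that by (simp only: pre R.star_closed)
  have \<pi>_zero: "\<pi> (azero A) = 0"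
    using R.pre_zero by (simp only: pre R.zero_closed)
  have unital: "unital_represented ?S ?\<theta> A (\<pi> e)"
  proof unfold_locales
    show "\<pi> e \<in> ?S" using e(1) by (rule imageI)
    show "\<pi> e o\<^sub>L X = X" if "X \<in> ?S" for X
      using that by (elim imageE) (simp only: \<pi>_mult e)
    show "X o\<^sub>L \<pi> e = X" if "X \<in> ?S" for X
      using that by (elim imageE) (simp only: \<pi>_mult e)
  qed
  then interpret U: unital_represented ?S ?\<theta> A "\<pi> e" .
  have \<pi>: "adj (\<pi> s) o\<^sub>L \<pi> s = \<pi> e" "adj (\<pi> t) o\<^sub>L \<pi> t = \<pi> e"
    by (simp_all only: \<pi>_star \<pi>_mult st R.star_closed)
  have S: "\<pi> s \<in> ?S" "\<pi> t \<in> ?S" using st by auto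
  have "adj (\<pi> s) o\<^sub>L ((\<pi> s o\<^sub>L adj (\<pi> s)) o\<^sub>L (\<pi> t o\<^sub>L adj (\<pi> t))) o\<^sub>L \<pi> t = 0"
  proof -
    have "(\<pi> s o\<^sub>L adj (\<pi> s)) o\<^sub>L (\<pi> t o\<^sub>L adj (\<pi> t)) = 0"
      by (simp only: \<pi>_star \<pi>_mult st R.star_closed R.mult_closed \<pi>_zero)
    then show ?thesis by simp
  qed
  moreover have "adj (\<pi> s) o\<^sub>L ((\<pi> s o\<^sub>L adj (\<pi> s)) o\<^sub>L (\<pi> t o\<^sub>L adj (\<pi> t))) o\<^sub>L \<pi> t
      = (adj (\<pi> s) o\<^sub>L \<pi> s) o\<^sub>L (adj (\<pi> s) o\<^sub>L (\<pi> t o\<^sub>L (adj (\<pi> t) o\<^sub>L \<pi> t)))"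
    by (simp only: compose_assoc)
  \<comment> \<open>Orthogonality of the range projections implies that of the isometries.\<close>
  ultimately have orth: "adj (\<pi> s) o\<^sub>L \<pi> t = 0"
    using S by (simp add: \<pi> U.unit_right U.unit_left R.compose R.adj)
  interpret O: orthogonal_isometries ?S ?\<theta> A "\<pi> e" "\<pi> s" "\<pi> t"
    by unfold_locales (use S \<pi> orth in auto)
  have "{op_tensor (\<pi> a) (restrict id (carrier K) b) | a b. a \<in> carrier A \<and> b \<in> carrier K}
      = {op_tensor X T | X T. X \<in> ?S \<and> T \<in> carrier compact_ops}"
    unfolding K_def by auto
  then have AK: "AK = op_alg (stabilised ?S)"
    unfolding AK_def spatial_tensor_def by (simp add: R.closure_span_tensor_compact)
  have P: "represented (stabilised ?S) \<theta> P"
    using R.stabilised_star_algebra \<open>cstar_algebra P\<close> \<open>\<theta> \<in> star_iso AK P\<close>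
    unfolding AK by (intro represented.intro represented_axioms.intro)
  have "compose (carrier A) \<theta> j = conj_map ?S ?\<theta> A \<theta> (emb 0)"
  proof (rule ext)
    fix a
    show "compose (carrier A) \<theta> j a = conj_map ?S ?\<theta> A \<theta> (emb 0) a"
    proof (cases "a \<in> carrier A")
      case True
      then have "clin (\<pi> a)" by (intro R.clin) simp
      then show ?thesis
        using True pre[OF True]
        by (simp add: compose_def conj_map_def j_def op_tensor_matrix_unit compose_assoc R.pre_def)
    qed (simp add: compose_def conj_map_def)
  qed
  then show ?thesis
    using O.stable_functor_corner_iso[OF \<open>cstar_functor E Emap\<close> \<open>M2_stable E Emap\<close> P] by simp
qed

end
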